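(* Let $p\ge 5$ be a prime and let $a_1,a_2,a_3,b\in\mathbb{Z}_p$ with $a_i\ne a_j$ for some $i\neq j$ and $a_1a_2a_3\in\mathbb{Z}_p^{*}$. Set $$d_1=-a_3a_1^{-1},\quad d_2=-a_2a_1^{-1},\quad d_3=-a_1a_2^{-1},\quad d_4=-a_3a_2^{-1},\quad d_5=-a_1a_3^{-1},\quad d_6=-a_2a_3^{-1}.$$ Then $$\operatorname{rb}(\mathbb{Z}_p,\operatorname{eq}(a_1,a_2,a_3,b))=\begin{cases}3 & \text{if } |\langle d_1,d_2,\dots,d_6\rangle|=p-1 \text{ or } a_1+a_2+a_3=0\neq b,\\ 4 & \text{otherwise.}\end{cases}$$
   Context: $\mathbb{Z}_n$ denotes the integers modulo $n$, $\mathbb{Z}_n^{*}$ its group of units, and $[r]=\{1,\dots,r\}$. For $d_1,\dots,d_k\in\mathbb{Z}_n^*$, $\langle d_1,\dots,d_k\rangle$ is the multiplicative subgroup of $\mathbb{Z}_n^*$ generated by $d_1,\dots,d_k$. An exact $r$-coloring of $\mathbb{Z}_n$ is a surjective function $c:\mathbb{Z}_n\to[r]$. $\operatorname{eq}(a_1,a_2,a_3,b)$ denotes the equation $a_1x_1+a_2x_2+a_3x_3=b$; a solution in $\mathbb{Z}_n$ is an ordered triple $(s_1,s_2,s_3)$ of elements of $\mathbb{Z}_n$ with $a_1s_1+a_2s_2+a_3s_3\equiv b \pmod n$. A solution is rainbow (with respect to $c$) if $|\{c(s_1),c(s_2),c(s_3)\}|=3$. The rainbow number $\operatorname{rb}(\mathbb{Z}_n,eq)$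 is the smallest positive integer $r$ such that every exact $r$-coloring of $\mathbb{Z}_n$ has a rainbow solution to $eq$; by convention it equals $n+1$ if an exact $n$-coloring of $\mathbb{Z}_n$ contains no rainbow solution. *)

theory Defs
  imports "HOL-Number_Theory.Residues" "HOL-Algebra.Generated_Groups"
begin

abbreviation Zmod :: "nat \<Rightarrow> int ring"
  where "Zmod n \<equiv> residue_ring (int n)"

definition exact_coloring :: "nat \<Rightarrow> nat \<Rightarrow> (int \<Rightarrow> nat) \<Rightarrow> bool"
  where "exact_coloring n r c \<longleftrightarrow> c ` carrier (Zmod n) = {1..r}"

text \<open>An equation in three variables over the integers modulo \<open>n\<close> is represented by its set of
  solutions.\<close>

definition lin_eq :: "nat \<Rightarrow> int \<Rightarrow> int \<Rightarrow> int \<Rightarrow> int \<Rightarrow> (int \<times> int \<times> int) set"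
  where "lin_eq n a1 a2 a3 b =
    {(s1, s2, s3). s1 \<in> carrier (Zmod n) \<and> s2 \<in> carrier (Zmod n) \<and> s3 \<in> carrier (Zmod n) \<and>
      a1 \<otimes>\<^bsub>Zmod n\<^esub> s1 \<oplus>\<^bsub>Zmod n\<^esub> a2 \<otimes>\<^bsub>Zmod n\<^esub> s2 \<oplus>\<^bsub>Zmod n\<^esub> a3 \<otimes>\<^bsub>Zmod n\<^esub> s3 = b}"

definition has_rainbow_solution :: "(int \<times> int \<times> int) set \<Rightarrow> (int \<Rightarrow> nat) \<Rightarrow> bool"
  where "has_rainbow_solution S c \<longleftrightarrow> (\<exists>(s1, s2, s3) \<in> S. card {c s1, c s2, c s3} = 3)"

text \<open>The first branch is the usual convention; it agrees with the second one for \<open>n \<ge> 1\<close>, since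
  there is no exact \<open>(n+1)\<close>-coloring, and merging colors preserves the absence of rainbow
  solutions.\<close>

definition rb :: "nat \<Rightarrow> (int \<times> int \<times> int) set \<Rightarrow> nat"
  where "rb n S =
    (if \<exists>c. exact_coloring n n c \<and> \<not> has_rainbow_solution S c then n + 1
     else LEAST r. 0 < r \<and> (\<forall>c. exact_coloring n r c \<longrightarrow> has_rainbow_solution S c))"

end

(* Suppose a 3-colouring of the integers mod p with classes A, B, C has no rainbow solution.

If all classes have at least two elements, a contradiction comes from moments mod p. Give x in A
the weight 1 / prod (x - y) (y in A - {x}); then the weighted power sums of A are the complete
homogeneous polynomials h_r(A). Since S = a1 x + a2 y + a3 z - b is never 0 on A x B x C, Fermat
gives S^(p-1) = 1 there, so the weighted sum of x^i y^j z^k S^(p-1) is 0 for small i + j + k. As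
|A| + |B| + |C| = p, only few terms of its expansion survive, and they are equations between the
h_r of total degree i + j + k + 2, for every order of the coefficients. Counting solutions moreover
shows that every x completes equally many pairs coloured (A, B) and (B, A); hence the classes have
the same mean, which is moved to 0, and usually proportional second moments. Unless a1, a2, a3
agree up to sign, it follows inductively that h_r = 0 for 1 <= r <= |A|, where A is the smallest
class, so A = {0}. If they do agree up to sign the equation becomes x + y = z, the colouring is
symmetric, and Gallai's theorem on rainbow-triangle-free colourings of complete graphs applies.

If {s} is a class, then (a1 + a2 + a3) s = b and the colouring of the residues x - s is invariant
under multiplication by d1, ..., d6; conversely a union of cosets of the group generated by the d_i
gives a rainbow-free colouring. Two classes cannot both be singletons, and merging colours then
excludes four colours. *)

theory Submission
  imports Defs "HOL-Computational_Algebra.Polynomial"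
begin

section \<open>Moments of sets of residues\<close>

text \<open>In the unknowns a1^r h_r(A), a2^r h_r(B), a3^r h_r(C) the equations of level r = i + j +
  k + 2 are linear once the mixed products of lower moments vanish, with one equation per triple (i,
  j, k). Level 2 has a single triple, which is why the solution count has to supply a second
  relation; that relation carries a factor a2^2 - a3^2 and is lost exactly when the coefficients
  agree up to sign. From level 4 on three triples give a nonsingular system. Level 3 is the real
  obstacle. Because the sizes add up to p, its three equations have the common solution line t (x -
  1) x (x + 1) (x + 2), x being the size of the class, for every t. Only level 6, the first where
  two third moments are multiplied, rules out a nonzero t: an alternating sum over six triples
  eliminates the sixth moments and forces equal sizes, impossible for a prime above 3. Size 3 leaves
  too few indices for this and is settled by the sum of all cubes.\<close>

lemma fermat_int:
  fixes x :: int
  assumes "prime p" "\<not> int p dvd x"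
  shows "[x ^ (p - 1) = 1] (mod int p)"
proof -
  define y where "y = nat (x mod int p)"
  have p0: "int p > 0" using assms(1) prime_gt_0_nat by auto
  have y: "int y = x mod int p" unfolding y_def using p0 by simp
  have "\<not> p dvd y"
    using assms(2) y by (metis dvd_mod_iff dvd_refl int_dvd_int_iff)
  then have "[y ^ (p - 1) = 1] (mod p)" using assms(1) fermat_theorem by blast
  then have "[int y ^ (p - 1) = 1] (mod int p)"
    by (metis cong_int_iff of_nat_1 of_nat_power)
  moreover have "[x = int y] (mod int p)" by (simp add: y cong_def)
  ultimately show ?thesis by (meson cong_pow cong_trans)
qed

locale prime_modulus =
  fixes p :: nat
  assumes prime_p: "prime p"
begin

abbreviation P :: int where "P \<equiv> int p"

definition eqm :: "int \<Rightarrow> int \<Rightarrow> bool"  (infix "\<approx>" 50)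
  where "x \<approx> y \<longleftrightarrow> [x = y] (mod P)"

lemma eqm_refl [simp, intro!]: "x \<approx> x"
  by (simp add: eqm_def)

lemma eqm_sym: "x \<approx> y \<Longrightarrow> y \<approx> x"
  unfolding eqm_def by (rule cong_sym)

lemma eqm_trans [trans]: "x \<approx> y \<Longrightarrow> y \<approx> z \<Longrightarrow> x \<approx> z"
  unfolding eqm_def by (rule cong_trans)

lemma eqm_eq_trans [trans]: "x \<approx> y \<Longrightarrow> y = z \<Longrightarrow> x \<approx> z"
  by simp

lemma eq_eqm_trans [trans]: "x = y \<Longrightarrow> y \<approx> z \<Longrightarrow> x \<approx> z"
  by simp

lemma eqm_add: "x \<approx> y \<Longrightarrow> x' \<approx> y' \<Longrightarrow> x + x' \<approx> y + y'"
  unfolding eqm_def by (rule cong_add)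

lemma eqm_diff: "x \<approx> y \<Longrightarrow> x' \<approx> y' \<Longrightarrow> x - x' \<approx> y - y'"
  unfolding eqm_def by (rule cong_diff)

lemma eqm_mult: "x \<approx> y \<Longrightarrow> x' \<approx> y' \<Longrightarrow> x * x' \<approx> y * y'"
  unfolding eqm_def by (rule cong_mult)

lemma eqm_scalar_left: "x \<approx> y \<Longrightarrow> c * x \<approx> c * y"
  unfolding eqm_def by (rule cong_scalar_left)

lemma eqm_scalar_right: "x \<approx> y \<Longrightarrow> x * c \<approx> y * c"
  unfolding eqm_def by (rule cong_scalar_right)

lemma eqm_pow: "x \<approx> y \<Longrightarrow> x ^ n \<approx> y ^ n"
  unfolding eqm_def by (rule cong_pow)

lemma eqm_sum: "(\<And>x. x \<in> S \<Longrightarrow> f x \<approx> g x) \<Longrightarrow> sum f S \<approx> sum g S"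
  unfolding eqm_def by (rule cong_sum)

lemma eqm_iff_dvd: "x \<approx> y \<longleftrightarrow> P dvd x - y"
  by (simp add: eqm_def cong_iff_dvd_diff)

lemma eqm_sym_eq: "x \<approx> y \<longleftrightarrow> y \<approx> x"
  using eqm_sym by blast

lemma prime_P: "prime P"
  using prime_p by simp

lemma P_pos: "P > 0"
  using prime_p prime_gt_0_nat by auto

lemma eqm_0: "x \<approx> 0 \<longleftrightarrow> P dvd x"
  by (simp add: eqm_def cong_0_iff)

lemma dvd_mult_P: "P dvd x * y \<longleftrightarrow> P dvd x \<or> P dvd y"
  using prime_P prime_dvd_mult_iff by blast

lemma eqm_mult_0: "x * y \<approx> 0 \<longleftrightarrow> x \<approx> 0 \<or> y \<approx> 0"
  by (simp add: eqm_0 dvd_mult_P)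

lemma eqm_mult_cancel: "\<not> P dvd c \<Longrightarrow> c * x \<approx> c * y \<longleftrightarrow> x \<approx> y"
  unfolding eqm_iff_dvd by (metis dvd_mult_P right_diff_distrib)

lemma not_dvd_small: "0 < x \<Longrightarrow> x < P \<Longrightarrow> \<not> P dvd x"
  using zdvd_not_zless by blast

lemma not_dvd_fact: "n < p \<Longrightarrow> \<not> P dvd fact n"
  by (metis int_dvd_int_iff leD of_nat_fact prime_dvd_fact_iff prime_p)

definition inv_mod :: "int \<Rightarrow> int" where "inv_mod x = x ^ (p - 2)"

lemma inv_mod: "\<not> P dvd x \<Longrightarrow> x * inv_mod x \<approx> 1"
proof -
  assume "\<not> P dvd x"
  moreover have "Suc (p - 2) = p - 1" using prime_ge_2_nat[OF prime_p] by simp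
  ultimately show ?thesis
    unfolding inv_mod_def eqm_def using fermat_int[OF prime_p] by (metis power_Suc)
qed

section \<open>Lagrange weights and complete homogeneous sums\<close>

definition incongruent :: "int set \<Rightarrow> bool"
  where "incongruent A \<longleftrightarrow> (\<forall>x\<in>A. \<forall>y\<in>A. P dvd x - y \<longrightarrow> x = y)"

lemma incongruent_insert:
  "incongruent (insert x A) \<Longrightarrow> incongruent A"
  by (auto simp: incongruent_def)

text \<open>Splitting off X - a by synthetic division stays over the integers, and incongruence
  makes \<open>x - a\<close> invertible at the other roots, so the quotient vanishes there too. The
  usual bound on the number of roots over a field thus runs inside \<open>int poly\<close>.\<close>

lemma poly_roots_coeff:
  fixes f :: "int poly"
  assumes "finite A" "incongruent A" "degree f < card A" "\<And>x. x \<in> A \<Longrightarrow> P dvd poly f x"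
  shows "P dvd coeff f i"
  using assms
proof (induction A arbitrary: f i rule: finite_induct)
  case empty
  then show ?case by simp
next
  case (insert a A)
  define q where "q = synthetic_div f a"
  have f: "f = [:-a, 1:] * q + [:poly f a:]"
    unfolding q_def using synthetic_div_correct'[of a f] by simp
  have pa: "P dvd poly f a" using insert.prems by blast
  have qi: "P dvd coeff q i" for i
  proof (cases "degree f = 0")
    case True
    then have "q = 0" unfolding q_def by (simp add: synthetic_div_eq_0_iff)
    then show ?thesis by simp
  next
    case False
    have "degree q = degree f - 1" unfolding q_def by (simp add: degree_synthetic_div)
    then have "degree q < card A" using False insert by simp
    moreover have "P dvd poly q x" if "x \<in> A" for x
    proof -
      have "poly f x = (x - a) * poly q x + poly f a"
        by (subst f) (simp add: algebra_simps)
      moreover have "P dvd poly f x" using that insert.prems by blast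
      ultimately have "P dvd (x - a) * poly q x" using pa
        by (metis add_diff_cancel_right' dvd_diff)
      moreover have "\<not> P dvd x - a"
        using insert.prems(1) insert.hyps(2) that unfolding incongruent_def by auto
      ultimately show ?thesis by (simp add: dvd_mult_P)
    qed
    ultimately show ?thesis using insert.IH insert.prems(1) incongruent_insert by blast
  qed
  have "P dvd coeff ([:-a, 1:] * q) i"
    by (cases i) (auto simp: qi)
  moreover have "P dvd coeff [:poly f a:] i"
    using pa by (cases i) auto
  ultimately show ?case by (subst f) (simp only: coeff_add dvd_add)
qed

definition weight :: "int set \<Rightarrow> int \<Rightarrow> int"
  where "weight A x = inv_mod (\<Prod>y\<in>A - {x}. x - y)"

text \<open>The divided difference of X^n at the nodes A, modulo p.\<close>

definition moment :: "int set \<Rightarrow> nat \<Rightarrow> int"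
  where "moment A n = (\<Sum>x\<in>A. weight A x * x ^ n)"

lemma weight_inverse:
  assumes "finite A" "incongruent A" "x \<in> A"
  shows "(\<Prod>y\<in>A - {x}. x - y) * weight A x \<approx> 1"
proof -
  have "\<not> P dvd (\<Prod>y\<in>A - {x}. x - y)"
    using assms prime_P by (auto simp: prime_dvd_prod_iff incongruent_def)
  then show ?thesis unfolding weight_def using inv_mod by blast
qed

text \<open>Up to degree \<open>card A - 1\<close> the weighted sum reads off the top coefficient of the
  Lagrange interpolation polynomial.\<close>

lemma moment_low:
  assumes A: "finite A" "incongruent A" and n: "n < card A"
  shows "moment A n \<approx> (if n = card A - 1 then 1 else 0)"
proof -
  define L where "L x = (\<Prod>y\<in>A - {x}. [:-y, 1:])" for x :: int
  have degL: "degree (L x) = card A - 1" if "x \<in> A" for x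
    unfolding L_def using that A(1) by (subst degree_prod_sum_eq) auto
  have leadL: "coeff (L x) (card A - 1) = 1" if "x \<in> A" for x
  proof -
    have "lead_coeff (L x) = 1" unfolding L_def by (subst lead_coeff_prod) simp
    then show ?thesis using degL[OF that] by simp
  qed
  have pL: "poly (L x) z = (\<Prod>y\<in>A - {x}. z - y)" for x z
    unfolding L_def by (simp add: poly_prod)
  define f where "f = (\<Sum>x\<in>A. smult (weight A x * x ^ n) (L x)) - monom 1 n"
  have "degree f < card A"
  proof -
    have "degree (\<Sum>x\<in>A. smult (weight A x * x ^ n) (L x)) \<le> card A - 1"
      using A(1) degL by (intro degree_sum_le) (auto intro: order_trans[OF degree_smult_le])
    moreover have "degree (monom (1::int) n) \<le> card A - 1"
      using n by (simp add: degree_monom_eq)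
    ultimately have "degree f \<le> card A - 1"
      unfolding f_def by (rule degree_diff_le)
    then show ?thesis using n by simp
  qed
  moreover have "P dvd poly f z" if z: "z \<in> A" for z
  proof -
    have zero: "poly (L x) z = 0" if "x \<in> A - {z}" for x
      unfolding pL using that z A(1) by (auto simp: prod_zero_iff)
    have "poly f z = (\<Sum>x\<in>A. weight A x * x ^ n * poly (L x) z) - z ^ n"
      unfolding f_def by (simp add: poly_sum poly_monom)
    also have "(\<Sum>x\<in>A. weight A x * x ^ n * poly (L x) z)
        = (\<Sum>x\<in>{z}. weight A x * x ^ n * poly (L x) z)"
      using A(1) z zero by (intro sum.mono_neutral_right) auto
    finally have *: "poly f z = ((\<Prod>y\<in>A - {z}. z - y) * weight A z) * z ^ n - z ^ n"
      by (simp add: pL mult_ac)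
    have "((\<Prod>y\<in>A - {z}. z - y) * weight A z) * z ^ n \<approx> 1 * z ^ n"
      using weight_inverse[OF A z] eqm_scalar_right by blast
    then show ?thesis unfolding * eqm_iff_dvd by simp
  qed
  ultimately have "P dvd coeff f (card A - 1)"
    using poly_roots_coeff A by blast
  moreover have "coeff f (card A - 1) = moment A n - (if n = card A - 1 then 1 else 0)"
  proof -
    have "coeff f (card A - 1) = (\<Sum>x\<in>A. weight A x * x ^ n * coeff (L x) (card A - 1))
        - (if n = card A - 1 then 1 else 0)"
      unfolding f_def by (simp add: coeff_sum)
    also have "(\<Sum>x\<in>A. weight A x * x ^ n * coeff (L x) (card A - 1)) = moment A n"
      unfolding moment_def by (intro sum.cong refl) (simp only: leadL mult_1_right)
    finally show ?thesis .
  qed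
  ultimately show ?thesis by (simp add: eqm_iff_dvd)
qed

text \<open>The complete homogeneous polynomial of degree \<open>r\<close> in the elements of \<open>A\<close>, modulo \<open>p\<close>.\<close>

definition hsym :: "int set \<Rightarrow> nat \<Rightarrow> int"
  where "hsym A r = moment A (card A - 1 + r)"

text \<open>Newton's identity in the one case required. With Q = prod (X - y), a =
  \<open>card A\<close> and c the coefficient of X^(a - r), weighting x^(r - 1) Q(x) = 0 gives h_r +
  c = 0, and weighting x^r Q'(x) gives the power sum as a h_r + (a - r) c.\<close>

lemma newton_first:
  assumes A: "finite A" "incongruent A" and r: "1 \<le> r" "r \<le> card A"
    and zero: "\<And>s. 1 \<le> s \<Longrightarrow> s < r \<Longrightarrow> hsym A s \<approx> 0"
  shows "(\<Sum>x\<in>A. x ^ r) \<approx> int r * hsym A r"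
proof -
  define a where "a = card A"
  define Q where "Q = (\<Prod>y\<in>A. [:-y, 1:])"
  have degQ: "degree Q = a" unfolding Q_def a_def by (subst degree_prod_sum_eq) auto
  have leadQ: "coeff Q a = 1"
    using degQ lead_coeff_prod[of "\<lambda>y. [:-y, 1:]" A] unfolding Q_def by simp
  have a: "r \<le> a" "1 \<le> a" using r a_def by auto
  have mom: "moment A (k + r) \<approx> (if k = a - 1 then hsym A r else if k + r = a - 1 then 1 else 0)"
    if "k < a" for k
  proof (cases "k + r < a")
    case True
    then show ?thesis using moment_low[OF A, of "k + r"] a r unfolding a_def by auto
  next
    case False
    show ?thesis
    proof (cases "k = a - 1")
      case True
      then show ?thesis by (simp add: hsym_def a_def)
    next
      case k: False
      define s where "s = k + r - (a - 1)"
      have "k + r = card A - 1 + s" "1 \<le> s" "s < r"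
        using False k that a unfolding s_def a_def by auto
      then have "moment A (k + r) \<approx> 0" using zero[of s] by (simp add: hsym_def)
      then show ?thesis using k False a by auto
    qed
  qed
  \<comment> \<open>Only k = a - 1 (value h_r) and k = a - 1 - r (value h_0 = 1) survive: exponents
    below a - 1 have zero moment, and those between are h_s with 1 <= s < r.\<close>
  have top_two: "(\<Sum>k<a. f k * moment A (k + r)) \<approx> f (a - 1) * hsym A r + (if r < a then f (a - 1 - r) else 0)"
    for f :: "nat \<Rightarrow> int"
  proof -
    have "(\<Sum>k<a. f k * moment A (k + r)) \<approx>
        (\<Sum>k<a. f k * (if k = a - 1 then hsym A r else if k + r = a - 1 then 1 else 0))"
      by (intro eqm_sum eqm_scalar_left mom) auto
    also have "(\<Sum>k<a. f k * (if k = a - 1 then hsym A r else if k + r = a - 1 then 1 else 0))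
        = (\<Sum>k<a. (if k = a - 1 then f (a-1) * hsym A r else 0) + (if r < a \<and> k = a - 1 - r then f (a-1-r) else 0))"
      using r(1) by (intro sum.cong) auto
    also have "\<dots> = f (a - 1) * hsym A r + (if r < a then f (a - 1 - r) else 0)"
      using a by (simp add: sum.distrib)
    finally show ?thesis .
  qed
  define c where "c = coeff Q (a - r)"
  have root: "poly Q x = 0" if "x \<in> A" for x
    unfolding Q_def using that A(1) by (auto simp: poly_prod prod_zero_iff)
  have hc: "hsym A r + c \<approx> 0"
  proof -
    have e1: "(\<Sum>x\<in>A. weight A x * (x ^ (r - 1) * poly Q x)) = 0"
      using root by simp
    have "(\<Sum>x\<in>A. weight A x * (x ^ (r - 1) * poly Q x))
        = (\<Sum>x\<in>A. \<Sum>k\<le>a. coeff Q k * (weight A x * x ^ (k + (r - 1))))"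
      unfolding poly_altdef degQ by (simp add: sum_distrib_left mult_ac power_add)
    also have "\<dots> = (\<Sum>k\<le>a. coeff Q k * moment A (k + (r - 1)))"
      unfolding moment_def by (subst sum.swap) (simp add: sum_distrib_left)
    also have "\<dots> = coeff Q 0 * moment A (r - 1) + (\<Sum>k<a. coeff Q (Suc k) * moment A (k + r))"
      unfolding lessThan_Suc_atMost[symmetric] sum.lessThan_Suc_shift using r(1) by simp
    finally have "0 = coeff Q 0 * moment A (r - 1) + (\<Sum>k<a. coeff Q (Suc k) * moment A (k + r))"
      using e1 by simp
    also have "\<dots> \<approx> coeff Q 0 * (if r = a then 1 else 0)
        + (coeff Q (Suc (a - 1)) * hsym A r + (if r < a then coeff Q (Suc (a - 1 - r)) else 0))"
    proof (intro eqm_add eqm_scalar_left top_two)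
      have "r - 1 < card A" "r - 1 = card A - 1 \<longleftrightarrow> r = a" using r a_def by auto
      then show "moment A (r - 1) \<approx> (if r = a then 1 else 0)"
        using moment_low[OF A, of "r - 1"] by simp
    qed
    also have "\<dots> = hsym A r + c"
      using a r leadQ unfolding c_def by (auto simp: Suc_diff_Suc)
    finally show ?thesis by (simp add: eqm_sym_eq)
  qed
  \<comment> \<open>At a root the derivative of Q is the product that \<open>weight\<close> inverts,
    which turns the plain power sum into a weighted one.\<close>
  have deriv: "poly (pderiv Q) x = (\<Prod>y\<in>A - {x}. x - y)" if "x \<in> A" for x
  proof -
    have "poly (pderiv Q) x = (\<Sum>b\<in>A. \<Prod>y\<in>A - {b}. x - y)"
      unfolding Q_def by (simp add: pderiv_prod pderiv_pCons poly_sum poly_prod mult.commute)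
    also have "\<dots> = (\<Sum>b\<in>{x}. \<Prod>y\<in>A - {b}. x - y)"
      using that A(1) by (intro sum.mono_neutral_right) (auto simp: prod_zero_iff)
    finally show ?thesis by simp
  qed
  have "(\<Sum>x\<in>A. x ^ r) \<approx> (\<Sum>x\<in>A. weight A x * (x ^ r * poly (pderiv Q) x))"
  proof (intro eqm_sum)
    fix x assume x: "x \<in> A"
    have "x ^ r * 1 \<approx> x ^ r * ((\<Prod>y\<in>A - {x}. x - y) * weight A x)"
      using weight_inverse[OF A x] by (intro eqm_scalar_left) (simp add: eqm_sym_eq)
    then show "x ^ r \<approx> weight A x * (x ^ r * poly (pderiv Q) x)"
      by (simp add: deriv[OF x] mult_ac)
  qed
  also have "(\<Sum>x\<in>A. weight A x * (x ^ r * poly (pderiv Q) x))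
      = (\<Sum>x\<in>A. \<Sum>k\<le>a-1. coeff (pderiv Q) k * (weight A x * x ^ (k + r)))"
    unfolding poly_altdef degree_pderiv degQ by (simp add: sum_distrib_left mult_ac power_add)
  also have "\<dots> = (\<Sum>k\<le>a-1. coeff (pderiv Q) k * moment A (k + r))"
    unfolding moment_def by (subst sum.swap) (simp add: sum_distrib_left)
  also have "{..a-1} = {..<a}" using a by auto
  also have "(\<Sum>k<a. coeff (pderiv Q) k * moment A (k + r))
      \<approx> coeff (pderiv Q) (a - 1) * hsym A r + (if r < a then coeff (pderiv Q) (a - 1 - r) else 0)"
    by (rule top_two)
  also have "\<dots> = int a * hsym A r + int (a - r) * c"
  proof -
    have "Suc (a - 1) = a" "r < a \<Longrightarrow> Suc (a - 1 - r) = a - r" using a by auto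
    then show ?thesis using a leadQ unfolding coeff_pderiv c_def by auto
  qed
  also have "\<dots> = int r * hsym A r + int (a - r) * (hsym A r + c)"
    using a by (simp add: algebra_simps of_nat_diff)
  also have "\<dots> \<approx> int r * hsym A r + int (a - r) * 0"
    by (intro eqm_add eqm_scalar_left hc eqm_refl)
  finally show ?thesis by simp
qed

text \<open>The product L over the other elements isolates x: the weighted sum of z^a L(z) is x^a,
  while its expansion contains exactly h_1, ..., h_a with a = \<open>card A\<close>. Hence the
  induction over levels may stop at the size of the class.\<close>

lemma hsym_zero_imp_zero:
  assumes A: "finite A" "incongruent A"
    and zero: "\<And>r. 1 \<le> r \<Longrightarrow> r \<le> card A \<Longrightarrow> hsym A r \<approx> 0" and x: "x \<in> A"
  shows "P dvd x"
proof -
  define a where "a = card A"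
  have a: "1 \<le> a" unfolding a_def using A(1) x card_gt_0_iff by (simp add: Suc_le_eq) blast
  define L where "L = (\<Prod>y\<in>A - {x}. [:-y, 1:])"
  have degL: "degree L = a - 1"
    unfolding L_def a_def using x A(1) by (subst degree_prod_sum_eq) auto
  have pL: "poly L z = (\<Prod>y\<in>A - {x}. z - y)" for z
    unfolding L_def by (simp add: poly_prod)
  have "(\<Sum>z\<in>A. weight A z * (z ^ a * poly L z)) = (\<Sum>z\<in>{x}. weight A z * (z ^ a * poly L z))"
  proof (intro sum.mono_neutral_right)
    show "\<forall>i\<in>A - {x}. weight A i * (i ^ a * poly L i) = 0"
      using A(1) by (auto simp: pL prod_zero_iff)
  qed (use A x in auto)
  also have "\<dots> = x ^ a * ((\<Prod>y\<in>A - {x}. x - y) * weight A x)" by (simp add: pL mult_ac)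
  also have "\<dots> \<approx> x ^ a * 1" by (intro eqm_scalar_left weight_inverse A x)
  finally have 1: "(\<Sum>z\<in>A. weight A z * (z ^ a * poly L z)) \<approx> x ^ a" by simp
  have "(\<Sum>z\<in>A. weight A z * (z ^ a * poly L z))
      = (\<Sum>z\<in>A. \<Sum>k\<le>a-1. coeff L k * (weight A z * z ^ (k + a)))"
    unfolding poly_altdef degL by (simp add: sum_distrib_left mult_ac power_add)
  also have "\<dots> = (\<Sum>k\<le>a-1. coeff L k * moment A (k + a))"
    unfolding moment_def by (subst sum.swap) (simp add: sum_distrib_left)
  also have "\<dots> \<approx> (\<Sum>k\<le>a-1. coeff L k * 0)"
  proof (intro eqm_sum eqm_scalar_left)
    fix k assume "k \<in> {..a-1}"
    then have "hsym A (k + 1) \<approx> 0" using a by (intro zero) (auto simp: a_def)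
    moreover have "card A - 1 + (k + 1) = k + a" using a a_def by linarith
    then have "hsym A (k + 1) = moment A (k + a)" unfolding hsym_def by (rule arg_cong)
    ultimately show "moment A (k + a) \<approx> 0" by (simp only:)
  qed
  finally have "(\<Sum>z\<in>A. weight A z * (z ^ a * poly L z)) \<approx> 0" by simp
  then have "x ^ a \<approx> 0" using 1 eqm_sym eqm_trans by blast
  then have "P dvd x ^ a" by (simp add: eqm_0)
  then show ?thesis using prime_P prime_dvd_power by blast
qed

end

section \<open>Power moments of a linear form\<close>

lemma trinomial:
  fixes X Y Z :: "'a :: comm_ring_1"
  shows "(X + Y + Z) ^ n = (\<Sum>(l, q)\<in>(SIGMA l:{..n}. {..n - l}).
    of_nat ((n choose l) * ((n - l) choose q)) * X ^ l * Y ^ q * Z ^ (n - l - q))"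
proof -
  have "(X + Y + Z) ^ n = (\<Sum>l\<le>n. of_nat (n choose l) * X ^ l * (Y + Z) ^ (n - l))"
    using binomial_ring[of X "Y + Z" n] by (simp add: add.assoc)
  also have "\<dots> = (\<Sum>l\<le>n. \<Sum>q\<le>n - l.
      of_nat ((n choose l) * ((n - l) choose q)) * X ^ l * Y ^ q * Z ^ (n - l - q))"
    by (simp add: binomial_ring sum_distrib_left mult_ac)
  also have "\<dots> = (\<Sum>(l, q)\<in>(SIGMA l:{..n}. {..n - l}).
    of_nat ((n choose l) * ((n - l) choose q)) * X ^ l * Y ^ q * Z ^ (n - l - q))"
    by (subst sum.Sigma) auto
  finally show ?thesis .
qed

lemma trinomial_coeff:
  assumes "l + q + m = n"
  shows "(n choose l) * ((n - l) choose q) * (fact l * fact q * fact m) = (fact n :: nat)"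
proof -
  have "fact q * fact (n - l - q) * ((n - l) choose q) = (fact (n - l) :: nat)"
    using assms by (intro binomial_fact_lemma) auto
  moreover have "n - l - q = m" using assms by auto
  moreover have "fact l * fact (n - l) * (n choose l) = (fact n :: nat)"
    using assms by (intro binomial_fact_lemma) auto
  ultimately show ?thesis by (metis (no_types, lifting) mult.assoc mult.commute)
qed

lemma fact_pochhammer: "s \<le> r \<Longrightarrow> (fact (m + r) :: int) = fact (m + s) * pochhammer (int (m + s) + 1) (r - s)"
proof -
  assume "s \<le> r"
  then have "m + r = (m + s) + (r - s)" by simp
  then have "(fact (m + r) :: int) = pochhammer 1 ((m + s) + (r - s))"
    by (simp add: pochhammer_fact)
  also have "\<dots> = pochhammer 1 (m + s) * pochhammer (1 + of_nat (m + s)) (r - s)"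
    by (rule pochhammer_product') 
  finally show ?thesis by (simp add: pochhammer_fact add.commute)
qed

lemma sum_swap4:
  "(\<Sum>x\<in>A. \<Sum>y\<in>B. \<Sum>z\<in>C. \<Sum>s\<in>S. g x y z s) = (\<Sum>s\<in>S. \<Sum>x\<in>A. \<Sum>y\<in>B. \<Sum>z\<in>C. g x y z s)"
proof -
  have "(\<Sum>x\<in>A. \<Sum>y\<in>B. \<Sum>z\<in>C. \<Sum>s\<in>S. g x y z s) = (\<Sum>x\<in>A. \<Sum>y\<in>B. \<Sum>s\<in>S. \<Sum>z\<in>C. g x y z s)"
    by (rule sum.cong[OF refl], rule sum.cong[OF refl], rule sum.swap)
  also have "\<dots> = (\<Sum>x\<in>A. \<Sum>s\<in>S. \<Sum>y\<in>B. \<Sum>z\<in>C. g x y z s)"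
    by (rule sum.cong[OF refl], rule sum.swap)
  also have "\<dots> = (\<Sum>s\<in>S. \<Sum>x\<in>A. \<Sum>y\<in>B. \<Sum>z\<in>C. g x y z s)"
    by (rule sum.swap)
  finally show ?thesis .
qed

lemma sum_product3:
  fixes f g h :: "'a \<Rightarrow> 'b :: comm_semiring_1"
  shows "c * (sum f A * sum g B * sum h C) = (\<Sum>x\<in>A. \<Sum>y\<in>B. \<Sum>z\<in>C. c * (f x * g y * h z))"
proof -
  have "sum f A * sum g B = (\<Sum>x\<in>A. \<Sum>y\<in>B. f x * g y)"
    by (rule sum_product)
  then have "sum f A * sum g B * sum h C = (\<Sum>x\<in>A. \<Sum>y\<in>B. f x * g y * sum h C)"
    by (simp only: sum_distrib_right)
  then show ?thesis by (simp only: sum_distrib_left)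
qed

context prime_modulus
begin

lemma moment_zero: "finite A \<Longrightarrow> incongruent A \<Longrightarrow> n < card A - 1 \<Longrightarrow> moment A n \<approx> 0"
  using moment_low[of A n] by simp

lemma eqm_sum_subset:
  assumes "finite S" "T \<subseteq> S" "\<And>x. x \<in> S - T \<Longrightarrow> f x \<approx> 0"
  shows "sum f S \<approx> sum f T"
proof -
  have "sum f S = sum f T + sum f (S - T)"
    using assms by (metis add.commute sum.subset_diff)
  also have "\<dots> \<approx> sum f T + (\<Sum>x\<in>S - T. 0)"
    by (intro eqm_add eqm_sum assms eqm_refl) auto
  finally show ?thesis by simp
qed

definition power_moment ::
    "int set \<Rightarrow> int set \<Rightarrow> int set \<Rightarrow> int \<Rightarrow> int \<Rightarrow> int \<Rightarrow> nat \<Rightarrow> nat \<Rightarrow> nat \<Rightarrow> nat \<Rightarrow> int"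
  where "power_moment A B C a1 a2 a3 i j k n = (\<Sum>x\<in>A. \<Sum>y\<in>B. \<Sum>z\<in>C.
    weight A x * weight B y * weight C z * (x ^ i * y ^ j * z ^ k) * (a1 * x + a2 * y + a3 * z) ^ n)"

lemma power_moment_expand:
  "power_moment A B C a1 a2 a3 i j k n = (\<Sum>(l, q)\<in>(SIGMA l:{..n}. {..n - l}).
    of_nat ((n choose l) * ((n - l) choose q)) * (a1 ^ l * a2 ^ q * a3 ^ (n - l - q)) *
    (moment A (l + i) * moment B (q + j) * moment C (n - l - q + k)))"
proof -
  let ?S = "SIGMA l:{..n}. {..n - l}"
  let ?f = "\<lambda>x y z. \<lambda>(l, q). of_nat ((n choose l) * ((n - l) choose q)) * (a1 ^ l * a2 ^ q * a3 ^ (n - l - q)) *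
    ((weight A x * x ^ (l + i)) * (weight B y * y ^ (q + j)) * (weight C z * z ^ (n - l - q + k)))"
  have "power_moment A B C a1 a2 a3 i j k n = (\<Sum>x\<in>A. \<Sum>y\<in>B. \<Sum>z\<in>C. \<Sum>lq\<in>?S. ?f x y z lq)"
    unfolding power_moment_def trinomial
    by (intro sum.cong refl) (simp add: sum_distrib_left case_prod_unfold power_mult_distrib power_add mult_ac)
  also have "\<dots> = (\<Sum>lq\<in>?S. \<Sum>x\<in>A. \<Sum>y\<in>B. \<Sum>z\<in>C. ?f x y z lq)"
    by (rule sum_swap4)
  also have "\<dots> = (\<Sum>(l, q)\<in>?S. of_nat ((n choose l) * ((n - l) choose q)) * (a1 ^ l * a2 ^ q * a3 ^ (n - l - q)) *
    (moment A (l + i) * moment B (q + j) * moment C (n - l - q + k)))"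
    unfolding moment_def case_prod_unfold
    by (intro sum.cong refl) (simp only: sum_product3)
  finally show ?thesis .
qed

text \<open>By pigeonhole every term of the trinomial expansion has an exponent below its
  \<open>card - 1\<close>, and that moment is zero.\<close>

lemma power_moment_low:
  assumes "finite A" "incongruent A" "finite B" "incongruent B" "finite C" "incongruent C"
    and "n + i + j + k + 3 < card A + card B + card C"
  shows "power_moment A B C a1 a2 a3 i j k n \<approx> 0"
proof -
  have "(\<Sum>(l, q)\<in>(SIGMA l:{..n}. {..n - l}).
    of_nat ((n choose l) * ((n - l) choose q)) * (a1 ^ l * a2 ^ q * a3 ^ (n - l - q)) *
    (moment A (l + i) * moment B (q + j) * moment C (n - l - q + k))) \<approx>
    (\<Sum>(l, q)\<in>(SIGMA l:{..n}. {..n - l}). 0)"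
  proof (rule eqm_sum, goal_cases)
    case (1 x)
    then obtain l q where lq: "x = (l, q)" "l \<in> {..n}" "q \<in> {..n - l}" by auto
    then have "l + i < card A - 1 \<or> q + j < card B - 1 \<or> n - l - q + k < card C - 1"
      using assms(7) by auto
    then have "moment A (l + i) \<approx> 0 \<or> moment B (q + j) \<approx> 0 \<or> moment C (n - l - q + k) \<approx> 0"
      using moment_zero assms(1-6) by blast
    then show ?case unfolding lq(1) case_prod_conv by (simp only: eqm_mult_0) blast
  qed
  then show ?thesis by (simp add: power_moment_expand)
qed

text \<open>The factorials on the left clear the denominators of the trinomial coefficients.\<close>

lemma power_moment_excess:
  assumes A: "finite A" "incongruent A" "card A = Suc \<alpha> + i"
    and B: "finite B" "incongruent B" "card B = Suc \<beta> + j"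
    and C: "finite C" "incongruent C" "card C = Suc \<gamma> + k"
    and n: "n = \<alpha> + \<beta> + \<gamma> + r"
  shows "fact (\<alpha> + r) * fact (\<beta> + r) * fact (\<gamma> + r) * power_moment A B C a1 a2 a3 i j k n \<approx>
    fact n * (a1 ^ \<alpha> * a2 ^ \<beta> * a3 ^ \<gamma>) * (\<Sum>(s, t)\<in>(SIGMA s:{..r}. {..r - s}).
      (a1 ^ s * pochhammer (int (\<alpha> + s) + 1) (r - s) * hsym A s) *
      (a2 ^ t * pochhammer (int (\<beta> + t) + 1) (r - t) * hsym B t) *
      (a3 ^ (r - s - t) * pochhammer (int (\<gamma> + (r - s - t)) + 1) (r - (r - s - t)) * hsym C (r - s - t)))"
proof -
  let ?S = "SIGMA l:{..n}. {..n - l}" and ?T = "SIGMA s:{..r}. {..r - s}"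
  \<comment> \<open>The surviving exponents are \<alpha> + s, \<beta> + t and \<gamma> + u with s +
    t + u = r: r is the excess of the total degree over the sum of the three
    \<open>card - 1\<close>.\<close>
  let ?g = "\<lambda>(s, t). (\<alpha> + s, \<beta> + t)"
  let ?f = "\<lambda>(l, q). of_nat ((n choose l) * ((n - l) choose q)) * (a1 ^ l * a2 ^ q * a3 ^ (n - l - q)) *
    (moment A (l + i) * moment B (q + j) * moment C (n - l - q + k)) :: int"
  let ?D = "fact (\<alpha> + r) * fact (\<beta> + r) * fact (\<gamma> + r) :: int"
  have "power_moment A B C a1 a2 a3 i j k n = sum ?f ?S" by (rule power_moment_expand)
  also have "\<dots> \<approx> sum ?f (?g ` ?T)"
  proof (rule eqm_sum_subset)
    show "?g ` ?T \<subseteq> ?S" using n by auto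
    fix x assume x: "x \<in> ?S - ?g ` ?T"
    obtain l q where lq: "x = (l, q)" by force
    have "l < \<alpha> \<or> q < \<beta> \<or> n - l - q < \<gamma>"
    proof (rule ccontr)
      assume "\<not> ?thesis"
      then have "(l - \<alpha>, q - \<beta>) \<in> ?T" "?g (l - \<alpha>, q - \<beta>) = x" using n x lq by auto
      then show False using x by (metis DiffD2 image_eqI)
    qed
    then have "l + i < card A - 1 \<or> q + j < card B - 1 \<or> n - l - q + k < card C - 1"
      using A B C by auto
    then have "moment A (l + i) \<approx> 0 \<or> moment B (q + j) \<approx> 0 \<or> moment C (n - l - q + k) \<approx> 0"
      using moment_zero A B C by blast
    then show "?f x \<approx> 0" unfolding lq case_prod_conv by (simp only: eqm_mult_0) blast
  qed auto
  also have "sum ?f (?g ` ?T) = sum (?f \<circ> ?g) ?T"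
    by (intro sum.reindex) (auto simp: inj_on_def)
  finally have 1: "power_moment A B C a1 a2 a3 i j k n \<approx> sum (?f \<circ> ?g) ?T" .
  have 2: "?D * sum (?f \<circ> ?g) ?T =
    fact n * (a1 ^ \<alpha> * a2 ^ \<beta> * a3 ^ \<gamma>) * (\<Sum>(s, t)\<in>?T.
      (a1 ^ s * pochhammer (int (\<alpha> + s) + 1) (r - s) * hsym A s) *
      (a2 ^ t * pochhammer (int (\<beta> + t) + 1) (r - t) * hsym B t) *
      (a3 ^ (r - s - t) * pochhammer (int (\<gamma> + (r - s - t)) + 1) (r - (r - s - t)) * hsym C (r - s - t)))"
    unfolding sum_distrib_left
  proof (rule sum.cong[OF refl], goal_cases)
    case (1 x)
    then obtain s t where st: "x = (s, t)" "s \<in> {..r}" "t \<in> {..r - s}" by blast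
    define u where "u = r - s - t"
    have stu: "s + t + u = r" using st u_def by auto
    have m: "n - (\<alpha> + s) - (\<beta> + t) = \<gamma> + u" using stu n by auto
    define M where "M = (n choose (\<alpha> + s)) * ((n - (\<alpha> + s)) choose (\<beta> + t))"
    have "M * (fact (\<alpha> + s) * fact (\<beta> + t) * fact (\<gamma> + u)) = (fact n :: nat)"
      unfolding M_def using n stu by (intro trinomial_coeff) auto
    then have M: "int M * (fact (\<alpha> + s) * fact (\<beta> + t) * fact (\<gamma> + u)) = (fact n :: int)"
      by (metis of_nat_fact of_nat_mult)
    define F where "F = (fact (\<alpha> + s) * fact (\<beta> + t) * fact (\<gamma> + u) :: int)"
    define R where "R = pochhammer (int (\<alpha> + s) + 1) (r - s) * pochhammer (int (\<beta> + t) + 1) (r - t) *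
         pochhammer (int (\<gamma> + u) + 1) (r - u)"
    have MF: "int M * F = fact n" using M F_def by simp
    have D: "?D = F * R" unfolding F_def R_def
      using fact_pochhammer[of s r \<alpha>] fact_pochhammer[of t r \<beta>] fact_pochhammer[of u r \<gamma>] stu by simp
    have hm: "moment A (\<alpha> + s + i) = hsym A s" "moment B (\<beta> + t + j) = hsym B t"
        "moment C (\<gamma> + u + k) = hsym C u"
      using A(3) B(3) C(3) by (auto simp: hsym_def add_ac)
    define G where "G = (a1 ^ (\<alpha> + s) * a2 ^ (\<beta> + t) * a3 ^ (\<gamma> + u)) * (hsym A s * hsym B t * hsym C u)"
    have "?D * (?f \<circ> ?g) (s, t) = F * R * (int M * G)"
      by (simp only: D) (simp only: o_def case_prod_conv m hm M_def G_def mult.assoc)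
    also have "\<dots> = (int M * F) * (R * G)" by (simp only: mult_ac)
    also have "\<dots> = fact n * (R * G)" by (simp only: MF)
    also have "R * G = (a1 ^ \<alpha> * a2 ^ \<beta> * a3 ^ \<gamma>) *
      ((a1 ^ s * pochhammer (int (\<alpha> + s) + 1) (r - s) * hsym A s) *
      (a2 ^ t * pochhammer (int (\<beta> + t) + 1) (r - t) * hsym B t) *
      (a3 ^ u * pochhammer (int (\<gamma> + u) + 1) (r - u) * hsym C u))"
      by (simp only: R_def G_def power_add mult_ac)
    finally show ?case unfolding st(1) case_prod_conv by (simp only: u_def mult.assoc)
  qed
  show ?thesis unfolding 2[symmetric] by (intro eqm_scalar_left 1)
qed

text \<open>The linear form does not vanish modulo \<open>p\<close> on \<open>A \<times> B \<times> C\<close>, so its power \<open>p - 1\<close> is 1 there.\<close>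

lemma power_moment_avoid:
  assumes avoid: "\<And>x y z. x \<in> A \<Longrightarrow> y \<in> B \<Longrightarrow> z \<in> C \<Longrightarrow> \<not> P dvd a1 * x + a2 * y + a3 * z - b"
  shows "(\<Sum>q\<le>p - 1. of_nat (p - 1 choose q) * (-b) ^ q * power_moment A B C a1 a2 a3 i j k (p - 1 - q))
    \<approx> moment A i * moment B j * moment C k"
proof -
  let ?w = "\<lambda>x y z. weight A x * weight B y * weight C z * (x ^ i * y ^ j * z ^ k)"
  have "(\<Sum>q\<le>p - 1. of_nat (p - 1 choose q) * (-b) ^ q * power_moment A B C a1 a2 a3 i j k (p - 1 - q))
    = (\<Sum>q\<le>p - 1. \<Sum>x\<in>A. \<Sum>y\<in>B. \<Sum>z\<in>C.
        ?w x y z * (of_nat (p - 1 choose q) * (-b) ^ q * (a1 * x + a2 * y + a3 * z) ^ (p - 1 - q)))"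
    unfolding power_moment_def by (simp add: sum_distrib_left mult_ac)
  also have "\<dots> = (\<Sum>x\<in>A. \<Sum>y\<in>B. \<Sum>z\<in>C. \<Sum>q\<le>p - 1.
        ?w x y z * (of_nat (p - 1 choose q) * (-b) ^ q * (a1 * x + a2 * y + a3 * z) ^ (p - 1 - q)))"
    by (rule sum_swap4[symmetric])
  also have "\<dots> = (\<Sum>x\<in>A. \<Sum>y\<in>B. \<Sum>z\<in>C. ?w x y z * (- b + (a1 * x + a2 * y + a3 * z)) ^ (p - 1))"
    by (simp only: binomial_ring sum_distrib_left)
  also have "\<dots> \<approx> (\<Sum>x\<in>A. \<Sum>y\<in>B. \<Sum>z\<in>C. ?w x y z * 1)"
  proof (intro eqm_sum eqm_scalar_left)
    fix x y z assume "x \<in> A" "y \<in> B" "z \<in> C"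
    from avoid[OF this] have "\<not> P dvd - b + (a1 * x + a2 * y + a3 * z)" by (simp add: algebra_simps)
    then show "(- b + (a1 * x + a2 * y + a3 * z)) ^ (p - 1) \<approx> 1"
      unfolding eqm_def using fermat_int prime_p by blast
  qed
  also have "(\<Sum>x\<in>A. \<Sum>y\<in>B. \<Sum>z\<in>C. ?w x y z * 1) = 1 * (moment A i * moment B j * moment C k)"
    unfolding moment_def sum_product3 by (simp add: mult_ac)
  finally show ?thesis by simp
qed

text \<open>The right-hand sum of \<open>power_moment_excess\<close>: the excess r is split as s + t
  + u, and \<open>pochhammer (int (\<alpha> + s) + 1) (r - s)\<close> is (\<alpha> + r)! / (\<alpha>
  + s)!.\<close>

definition excess_sum ::
    "int set \<Rightarrow> int set \<Rightarrow> int set \<Rightarrow> int \<Rightarrow> int \<Rightarrow> int \<Rightarrow> nat \<Rightarrow> nat \<Rightarrow> nat \<Rightarrow> nat \<Rightarrow> int"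
  where "excess_sum A B C a1 a2 a3 \<alpha> \<beta> \<gamma> r = (\<Sum>(s, t)\<in>(SIGMA s:{..r}. {..r - s}).
      (a1 ^ s * pochhammer (int (\<alpha> + s) + 1) (r - s) * hsym A s) *
      (a2 ^ t * pochhammer (int (\<beta> + t) + 1) (r - t) * hsym B t) *
      (a3 ^ (r - s - t) * pochhammer (int (\<gamma> + (r - s - t)) + 1) (r - (r - s - t)) * hsym C (r - s - t)))"

lemma hsym_0: "finite A \<Longrightarrow> incongruent A \<Longrightarrow> A \<noteq> {} \<Longrightarrow> hsym A 0 \<approx> 1"
  using moment_low[of A "card A - 1"] unfolding hsym_def by (simp add: card_gt_0_iff)

text \<open>\<open>low\<close> asks for one vanishing factor in each mixed product rather than for
  all lower moments: levels 4 and 5 are used while third moments may be nonzero, and neither 4 nor 5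
  is a sum of 3s.\<close>

lemma excess_sum_single:
  assumes A: "finite A" "incongruent A" "A \<noteq> {}"
    and B: "finite B" "incongruent B" "B \<noteq> {}"
    and C: "finite C" "incongruent C" "C \<noteq> {}"
    and r: "1 \<le> r"
    and low: "\<And>s t u. s + t + u = r \<Longrightarrow> s < r \<Longrightarrow> t < r \<Longrightarrow> u < r \<Longrightarrow>
      hsym A s \<approx> 0 \<or> hsym B t \<approx> 0 \<or> hsym C u \<approx> 0"
  shows "excess_sum A B C a1 a2 a3 \<alpha> \<beta> \<gamma> r \<approx>
    a1 ^ r * hsym A r * (pochhammer (int \<beta> + 1) r * pochhammer (int \<gamma> + 1) r) +
    a2 ^ r * hsym B r * (pochhammer (int \<alpha> + 1) r * pochhammer (int \<gamma> + 1) r) +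
    a3 ^ r * hsym C r * (pochhammer (int \<alpha> + 1) r * pochhammer (int \<beta> + 1) r)"
proof -
  let ?S = "SIGMA s:{..r}. {..r - s}"
  let ?f = "\<lambda>(s, t). (a1 ^ s * pochhammer (int (\<alpha> + s) + 1) (r - s) * hsym A s) *
      (a2 ^ t * pochhammer (int (\<beta> + t) + 1) (r - t) * hsym B t) *
      (a3 ^ (r - s - t) * pochhammer (int (\<gamma> + (r - s - t)) + 1) (r - (r - s - t)) * hsym C (r - s - t))"
  have "excess_sum A B C a1 a2 a3 \<alpha> \<beta> \<gamma> r = sum ?f ?S" unfolding excess_sum_def ..
  also have "\<dots> \<approx> sum ?f {(r, 0), (0, r), (0, 0)}"
  proof (rule eqm_sum_subset)
    fix x assume x: "x \<in> ?S - {(r, 0), (0, r), (0, 0)}"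
    obtain s t where st: "x = (s, t)" by force
    have "s + t + (r - s - t) = r" "s < r" "t < r" "r - s - t < r"
      using x st r by auto
    then have "hsym A s \<approx> 0 \<or> hsym B t \<approx> 0 \<or> hsym C (r - s - t) \<approx> 0" by (rule low)
    then show "?f x \<approx> 0" unfolding st case_prod_conv by (simp only: eqm_mult_0) blast
  qed (use r in auto)
  also have "sum ?f {(r, 0), (0, r), (0, 0)} =
     a1 ^ r * hsym A r * (pochhammer (int \<beta> + 1) r * pochhammer (int \<gamma> + 1) r) * (hsym B 0 * hsym C 0) +
     a2 ^ r * hsym B r * (pochhammer (int \<alpha> + 1) r * pochhammer (int \<gamma> + 1) r) * (hsym A 0 * hsym C 0) +
     a3 ^ r * hsym C r * (pochhammer (int \<alpha> + 1) r * pochhammer (int \<beta> + 1) r) * (hsym A 0 * hsym B 0)"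
    using r by (simp add: mult_ac)
  also have "\<dots> \<approx>
     a1 ^ r * hsym A r * (pochhammer (int \<beta> + 1) r * pochhammer (int \<gamma> + 1) r) * (1 * 1) +
     a2 ^ r * hsym B r * (pochhammer (int \<alpha> + 1) r * pochhammer (int \<gamma> + 1) r) * (1 * 1) +
     a3 ^ r * hsym C r * (pochhammer (int \<alpha> + 1) r * pochhammer (int \<beta> + 1) r) * (1 * 1)"
    by (intro eqm_add eqm_scalar_left eqm_mult hsym_0 A B C)
  finally show ?thesis by (simp only: mult_1_right)
qed

text \<open>As the sizes add up to p, the three \<open>card - 1\<close> add up to p - 3, so the
  exponent p - 1 has excess 2; the monomial x^i y^j z^k raises it to i + j + k + 2. The bound on r
  keeps one of i, j, k below its \<open>card - 1\<close>, which kills the product of moments on the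
  other side of \<open>power_moment_avoid\<close>.\<close>

lemma level_equation:
  assumes A: "finite A" "incongruent A" "card A = Suc \<alpha> + i"
    and B: "finite B" "incongruent B" "card B = Suc \<beta> + j"
    and C: "finite C" "incongruent C" "card C = Suc \<gamma> + k"
    and cards: "card A + card B + card C = p"
    and coeffs: "\<not> P dvd a1" "\<not> P dvd a2" "\<not> P dvd a3"
    and avoid: "\<And>x y z. x \<in> A \<Longrightarrow> y \<in> B \<Longrightarrow> z \<in> C \<Longrightarrow> \<not> P dvd a1 * x + a2 * y + a3 * z"
    and r: "r = i + j + k + 2" "r < p - 1"
  shows "excess_sum A B C a1 a2 a3 \<alpha> \<beta> \<gamma> r \<approx> 0"
proof -
  have n: "p - 1 = \<alpha> + \<beta> + \<gamma> + r" using A B C cards r by auto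
  have "i < card A - 1 \<or> j < card B - 1 \<or> k < card C - 1"
    using r cards A(3) B(3) C(3) by auto
  then have mm: "moment A i * moment B j * moment C k \<approx> 0"
    using moment_zero A B C by (auto simp: eqm_mult_0)
  have "(\<Sum>q\<le>p - 1. of_nat (p - 1 choose q) * (-0) ^ q * power_moment A B C a1 a2 a3 i j k (p - 1 - q))
      = (\<Sum>q\<in>{0}. of_nat (p - 1 choose q) * (-0) ^ q * power_moment A B C a1 a2 a3 i j k (p - 1 - q))"
    by (intro sum.mono_neutral_right) auto
  then have "power_moment A B C a1 a2 a3 i j k (p - 1) \<approx> moment A i * moment B j * moment C k"
    using power_moment_avoid[of A B C a1 a2 a3 0 i j k] avoid by simp
  then have 0: "power_moment A B C a1 a2 a3 i j k (p - 1) \<approx> 0" using mm by (rule eqm_trans)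
  have "fact (p - 1) * (a1 ^ \<alpha> * a2 ^ \<beta> * a3 ^ \<gamma>) * excess_sum A B C a1 a2 a3 \<alpha> \<beta> \<gamma> r \<approx>
      fact (\<alpha> + r) * fact (\<beta> + r) * fact (\<gamma> + r) * power_moment A B C a1 a2 a3 i j k (p - 1)"
    unfolding excess_sum_def by (rule eqm_sym, rule power_moment_excess[OF A B C n])
  also have "\<dots> \<approx> fact (\<alpha> + r) * fact (\<beta> + r) * fact (\<gamma> + r) * 0"
    by (rule eqm_scalar_left[OF 0])
  finally have "fact (p - 1) * (a1 ^ \<alpha> * a2 ^ \<beta> * a3 ^ \<gamma>) * excess_sum A B C a1 a2 a3 \<alpha> \<beta> \<gamma> r \<approx> 0"
    by simp
  moreover have "\<not> P dvd fact (p - 1)" using prime_gt_0_nat[OF prime_p] by (intro not_dvd_fact) simp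
  moreover have "\<not> P dvd a1 ^ \<alpha> * a2 ^ \<beta> * a3 ^ \<gamma>"
    using coeffs prime_P prime_dvd_power by (metis dvd_mult_P)
  ultimately show ?thesis by (simp add: eqm_0 dvd_mult_P)
qed

text \<open>With b present the exponents p - 1, p - 2, p - 3 have excess 2, 1, 0 and all smaller
  ones contribute nothing. Excess 1 dies with the first moments, and excess 0 leaves the term in
  b^2. The factor 2 clears the binomial coefficient of p - 1 over 2.\<close>

lemma level_two:
  assumes A: "finite A" "incongruent A" "A \<noteq> {}" "hsym A 1 \<approx> 0"
    and B: "finite B" "incongruent B" "B \<noteq> {}" "hsym B 1 \<approx> 0"
    and C: "finite C" "incongruent C" "C \<noteq> {}" "hsym C 1 \<approx> 0"
    and cards: "card A + card B + card C = p" "p > 3"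
    and coeffs: "\<not> P dvd a1" "\<not> P dvd a2" "\<not> P dvd a3"
    and avoid: "\<And>x y z. x \<in> A \<Longrightarrow> y \<in> B \<Longrightarrow> z \<in> C \<Longrightarrow> \<not> P dvd a1 * x + a2 * y + a3 * z - b"
    and abc: "a = int (card A)" "b' = int (card B)" "c = int (card C)"
  shows "2 * (a1\<^sup>2 * hsym A 2 * (b' * (b' + 1) * (c * (c + 1))) +
      a2\<^sup>2 * hsym B 2 * (a * (a + 1) * (c * (c + 1))) +
      a3\<^sup>2 * hsym C 2 * (a * (a + 1) * (b' * (b' + 1)))) +
      b\<^sup>2 * (a * (a + 1) * (b' * (b' + 1)) * (c * (c + 1))) \<approx> 0"
proof -
  define \<alpha> \<beta> \<gamma> where "\<alpha> = card A - 1" and "\<beta> = card B - 1" and "\<gamma> = card C - 1"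
  have cA: "card A = Suc \<alpha> + 0" and cB: "card B = Suc \<beta> + 0" and cC: "card C = Suc \<gamma> + 0"
    using A B C unfolding \<alpha>_def \<beta>_def \<gamma>_def by (auto simp: card_gt_0_iff)
  have n: "p - 1 = \<alpha> + \<beta> + \<gamma> + 2" "p - 2 = \<alpha> + \<beta> + \<gamma> + 1" "p - 3 = \<alpha> + \<beta> + \<gamma> + 0"
    using cA cB cC cards by auto
  let ?M = "power_moment A B C a1 a2 a3 0 0 0"
  let ?a = "a1 ^ \<alpha> * a2 ^ \<beta> * a3 ^ \<gamma>"
  let ?E = "excess_sum A B C a1 a2 a3 \<alpha> \<beta> \<gamma>"
  let ?D = "\<lambda>r. fact (\<alpha> + r) * fact (\<beta> + r) * fact (\<gamma> + r) :: int"
  have M: "?D r * ?M (\<alpha> + \<beta> + \<gamma> + r) \<approx> fact (\<alpha> + \<beta> + \<gamma> + r) * ?a * ?E r" for r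
    unfolding excess_sum_def by (rule power_moment_excess[OF A(1,2) cA B(1,2) cB C(1,2) cC refl])
  have ab: "a = int \<alpha> + 1" "b' = int \<beta> + 1" "c = int \<gamma> + 1" using abc cA cB cC by auto
  have nd: "\<not> P dvd ?D 1"
  proof -
    have "\<alpha> + 1 < p" "\<beta> + 1 < p" "\<gamma> + 1 < p" using cA cB cC cards by auto
    then show ?thesis using not_dvd_fact by (simp only: dvd_mult_P) blast
  qed
  have "?E 1 \<approx>
    a1 ^ 1 * hsym A 1 * (pochhammer (int \<beta> + 1) 1 * pochhammer (int \<gamma> + 1) 1) +
    a2 ^ 1 * hsym B 1 * (pochhammer (int \<alpha> + 1) 1 * pochhammer (int \<gamma> + 1) 1) +
    a3 ^ 1 * hsym C 1 * (pochhammer (int \<alpha> + 1) 1 * pochhammer (int \<beta> + 1) 1)"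
    by (rule excess_sum_single) (use A B C in auto)
  also have "\<dots> \<approx>
    a1 ^ 1 * 0 * (pochhammer (int \<beta> + 1) 1 * pochhammer (int \<gamma> + 1) 1) +
    a2 ^ 1 * 0 * (pochhammer (int \<alpha> + 1) 1 * pochhammer (int \<gamma> + 1) 1) +
    a3 ^ 1 * 0 * (pochhammer (int \<alpha> + 1) 1 * pochhammer (int \<beta> + 1) 1)"
    by (intro eqm_add eqm_scalar_left eqm_scalar_right A B C)
  finally have E1: "?E 1 \<approx> 0" by simp
  have "?D 1 * ?M (p - 2) \<approx> fact (p - 2) * ?a * ?E 1" using M[of 1] by (simp only: n)
  also have "\<dots> \<approx> fact (p - 2) * ?a * 0" by (rule eqm_scalar_left[OF E1])
  finally have M1: "?M (p - 2) \<approx> 0" using nd by (simp add: eqm_0 dvd_mult_P)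
  have "?E 0 = hsym A 0 * hsym B 0 * hsym C 0" by (simp add: excess_sum_def)
  also have "\<dots> \<approx> 1 * 1 * 1" by (intro eqm_mult hsym_0 A B C)
  finally have E0: "?E 0 \<approx> 1" by simp
  have "?D 0 * ?M (p - 3) \<approx> fact (p - 3) * ?a * ?E 0" using M[of 0] by (simp only: n)
  also have "\<dots> \<approx> fact (p - 3) * ?a * 1" by (rule eqm_scalar_left[OF E0])
  finally have M0: "?D 0 * ?M (p - 3) \<approx> fact (p - 3) * ?a" by simp
  have M2: "?D 2 * ?M (p - 1) \<approx> fact (p - 1) * ?a * ?E 2" using M[of 2] by (simp only: n)
  \<comment> \<open>The quotient of \<open>?D 2\<close> by \<open>?D 0\<close>, that is (\<alpha> +
    1) (\<alpha> + 2) and its analogues multiplied.\<close>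
  define K where "K = a * (a + 1) * (b' * (b' + 1)) * (c * (c + 1))"
  have D20: "?D 2 = ?D 0 * K"
    unfolding K_def ab by (simp add: numeral_2_eq_2 algebra_simps)
  define G where "G = int (p - 1 choose 2)"
  have G: "2 * G * fact (p - 3) = fact (p - 1)"
  proof -
    have "fact 2 * fact (p - 1 - 2) * (p - 1 choose 2) = (fact (p - 1) :: nat)"
      using cards(2) by (intro binomial_fact_lemma) auto
    moreover have "p - 1 - 2 = p - 3" by simp
    ultimately have "2 * fact (p - 3) * (p - 1 choose 2) = (fact (p - 1) :: nat)" by simp
    then have "int (2 * fact (p - 3) * (p - 1 choose 2)) = int (fact (p - 1))" by (rule arg_cong)
    then show ?thesis by (simp add: G_def mult_ac)
  qed
  let ?Q = "\<lambda>q. of_nat (p - 1 choose q) * (-b) ^ q * ?M (p - 1 - q)"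
  have "moment A 0 * moment B 0 * moment C 0 \<approx> 0"
  proof -
    have "0 < card A - 1 \<or> 0 < card B - 1 \<or> 0 < card C - 1" using cards by auto
    then show ?thesis using moment_zero A B C by (simp only: eqm_mult_0) blast
  qed
  then have "0 \<approx> (\<Sum>q\<le>p - 1. ?Q q)"
    using power_moment_avoid[of A B C a1 a2 a3 b 0 0 0] avoid eqm_trans eqm_sym by blast
  also have "(\<Sum>q\<le>p - 1. ?Q q) \<approx> (\<Sum>q\<in>{0,1,2}. ?Q q)"
  proof (rule eqm_sum_subset)
    fix q assume "q \<in> {..p - 1} - {0, 1, 2}"
    then have "p - 1 - q + 0 + 0 + 0 + 3 < card A + card B + card C" using cards by auto
    then have "?M (p - 1 - q) \<approx> 0" using power_moment_low A B C by blast
    then show "?Q q \<approx> 0" by (simp only: eqm_mult_0) blast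
  qed (use cards in auto)
  also have "(\<Sum>q\<in>{0,1,2}. ?Q q) = ?M (p - 1) + (- b * int (p - 1)) * ?M (p - 2) + G * b\<^sup>2 * ?M (p - 3)"
  proof -
    have "p - 1 - 1 = p - 2" "p - 1 - 2 = p - 3" by auto
    then show ?thesis by (simp add: G_def algebra_simps)
  qed
  also have "\<dots> \<approx> ?M (p - 1) + (- b * int (p - 1)) * 0 + G * b\<^sup>2 * ?M (p - 3)"
    by (intro eqm_add eqm_scalar_left M1 eqm_refl)
  finally have Q: "0 \<approx> ?M (p - 1) + G * b\<^sup>2 * ?M (p - 3)" by simp
  have "0 = 2 * ?D 2 * 0" by simp
  also have "\<dots> \<approx> 2 * ?D 2 * (?M (p - 1) + G * b\<^sup>2 * ?M (p - 3))"
    by (rule eqm_scalar_left[OF Q])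
  also have "\<dots> = 2 * (?D 2 * ?M (p - 1)) + 2 * G * b\<^sup>2 * K * (?D 0 * ?M (p - 3))"
    unfolding D20 by (simp only: distrib_left mult_ac)
  also have "\<dots> \<approx> 2 * (fact (p - 1) * ?a * ?E 2) + 2 * G * b\<^sup>2 * K * (fact (p - 3) * ?a)"
    by (intro eqm_add eqm_scalar_left M2 M0)
  also have "2 * G * b\<^sup>2 * K * (fact (p - 3) * ?a) = (2 * G * fact (p - 3)) * (b\<^sup>2 * K * ?a)"
    by (simp only: mult_ac)
  also have "\<dots> = fact (p - 1) * (b\<^sup>2 * K * ?a)" by (simp only: G)
  also have "2 * (fact (p - 1) * ?a * ?E 2) + fact (p - 1) * (b\<^sup>2 * K * ?a)
      = fact (p - 1) * ?a * (2 * ?E 2 + b\<^sup>2 * K)"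
    by (simp only: distrib_left mult_ac)
  finally have "fact (p - 1) * ?a * (2 * ?E 2 + b\<^sup>2 * K) \<approx> 0" by (rule eqm_sym)
  moreover have "\<not> P dvd fact (p - 1)" using prime_gt_0_nat[OF prime_p] by (intro not_dvd_fact) simp
  moreover have "\<not> P dvd ?a"
    using coeffs prime_P prime_dvd_power by (metis dvd_mult_P)
  ultimately have F: "2 * ?E 2 + b\<^sup>2 * K \<approx> 0" by (simp add: eqm_0 dvd_mult_P)
  have "?E 2 \<approx>
    a1 ^ 2 * hsym A 2 * (pochhammer (int \<beta> + 1) 2 * pochhammer (int \<gamma> + 1) 2) +
    a2 ^ 2 * hsym B 2 * (pochhammer (int \<alpha> + 1) 2 * pochhammer (int \<gamma> + 1) 2) +
    a3 ^ 2 * hsym C 2 * (pochhammer (int \<alpha> + 1) 2 * pochhammer (int \<beta> + 1) 2)"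
  proof (rule excess_sum_single)
    fix s t u :: nat assume "s + t + u = 2" "s < 2" "t < 2" "u < 2"
    then have "s = 1 \<or> t = 1" by auto
    then show "hsym A s \<approx> 0 \<or> hsym B t \<approx> 0 \<or> hsym C u \<approx> 0" using A B by blast
  qed (use A B C in auto)
  also have "\<dots> = a1\<^sup>2 * hsym A 2 * (b' * (b' + 1) * (c * (c + 1))) +
      a2\<^sup>2 * hsym B 2 * (a * (a + 1) * (c * (c + 1))) +
      a3\<^sup>2 * hsym C 2 * (a * (a + 1) * (b' * (b' + 1)))" (is "_ = ?F")
    unfolding ab by (simp add: numeral_2_eq_2 pochhammer_Suc)
  finally have "?E 2 \<approx> ?F" .
  then have "2 * ?F + b\<^sup>2 * K \<approx> 2 * ?E 2 + b\<^sup>2 * K"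
    by (intro eqm_add eqm_scalar_left eqm_refl) (rule eqm_sym)
  then show ?thesis using F unfolding K_def by (rule eqm_trans)
qed

section \<open>Rainbow-free colourings modulo a prime\<close>

lemma ex_inverse: "\<not> P dvd c \<Longrightarrow> \<exists>d. c * d \<approx> 1"
  using inv_mod by blast

lemma linear_solution:
  assumes "\<not> P dvd c"
  obtains u where "u \<in> {0..<P}" "P dvd c * u + d" "\<And>v. v \<in> {0..<P} \<Longrightarrow> P dvd c * v + d \<Longrightarrow> v = u"
proof -
  obtain e where e: "c * e \<approx> 1" using ex_inverse assms by blast
  define u where "u = (- d * e) mod P"
  have u: "u \<in> {0..<P}" using P_pos by (simp add: u_def)
  have "u \<approx> - d * e" by (simp add: u_def eqm_def cong_def)
  then have "c * u \<approx> c * (- d * e)" by (rule eqm_scalar_left)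
  also have "c * (- d * e) = - d * (c * e)" by simp
  also have "\<dots> \<approx> - d * 1" by (rule eqm_scalar_left[OF e])
  finally have 1: "P dvd c * u + d" by (simp add: eqm_iff_dvd)
  moreover have "v = u" if v: "v \<in> {0..<P}" "P dvd c * v + d" for v
  proof -
    have "P dvd c * (v - u)" using dvd_diff[OF v(2) 1] by (simp add: algebra_simps)
    then have "P dvd v - u" using assms dvd_mult_P by blast
    then have "v mod P = u mod P" by (simp add: mod_eq_dvd_iff)
    then show "v = u" using u v by simp
  qed
  ultimately show ?thesis using u that by blast
qed

lemma sum_linear_solution:
  assumes "\<not> P dvd c"
  shows "(\<Sum>u\<in>{0..<P}. if P dvd c * u + d then v else 0) = (v :: int)"
proof -
  obtain w where w: "w \<in> {0..<P}" "P dvd c * w + d"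
    "\<And>v. v \<in> {0..<P} \<Longrightarrow> P dvd c * v + d \<Longrightarrow> v = w"
    using linear_solution[OF assms, of d] by blast
  have "P dvd c * u + d \<longleftrightarrow> u = w" if "u \<in> {0..<P}" for u
    using w that by blast
  then have "(\<Sum>u\<in>{0..<P}. if P dvd c * u + d then v else 0) = (\<Sum>u\<in>{0..<P}. if u = w then v else 0)"
    by (intro sum.cong refl) (simp only:)
  then show ?thesis using w(1) by simp
qed

text \<open>Quantified over all integers, so that translating and scaling a colouring needs no
  reduction; \<open>periodic\<close> ties it to residues.\<close>

definition rainbow_free :: "int \<Rightarrow> int \<Rightarrow> int \<Rightarrow> int \<Rightarrow> (int \<Rightarrow> nat) \<Rightarrow> bool"
  where "rainbow_free a1 a2 a3 b k \<longleftrightarrow>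
    (\<forall>x y z. P dvd a1 * x + a2 * y + a3 * z - b \<longrightarrow> k x = k y \<or> k y = k z \<or> k x = k z)"

definition periodic :: "(int \<Rightarrow> nat) \<Rightarrow> bool"
  where "periodic k \<longleftrightarrow> (\<forall>x. k (x mod P) = k x)"

definition cls :: "(int \<Rightarrow> nat) \<Rightarrow> nat \<Rightarrow> int set"
  where "cls k i = {x \<in> {0..<P}. k x = i}"

lemma rainbow_free_swap12: "rainbow_free a1 a2 a3 b k \<Longrightarrow> rainbow_free a2 a1 a3 b k"
  unfolding rainbow_free_def by (metis add.commute)

lemma rainbow_free_swap23: "rainbow_free a1 a2 a3 b k \<Longrightarrow> rainbow_free a1 a3 a2 b k"
  unfolding rainbow_free_def by (metis add.commute add.assoc)

lemma cls_props [simp]: "finite (cls k i)" "incongruent (cls k i)" "cls k i \<subseteq> {0..<P}"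
proof -
  show "incongruent (cls k i)"
    unfolding incongruent_def cls_def
  proof clarsimp
    fix x y assume "0 \<le> x" "x < P" "0 \<le> y" "y < P" "P dvd x - y"
    then have "x mod P = y mod P" by (metis mod_eq_dvd_iff)
    then show "x = y" using \<open>0 \<le> x\<close> \<open>x < P\<close> \<open>0 \<le> y\<close> \<open>y < P\<close> by (metis mod_pos_pos_trivial)
  qed
  show "cls k i \<subseteq> {0..<P}" by (auto simp: cls_def)
  then show "finite (cls k i)" by (rule finite_subset) simp
qed

lemma sum_cls:
  assumes "\<And>x. k x \<in> {i, j, l}" "i \<noteq> j" "i \<noteq> l" "j \<noteq> l"
  shows "sum f {0..<P} = sum f (cls k i) + sum f (cls k j) + sum f (cls k l)"
proof -
  have "{0..<P} = cls k i \<union> cls k j \<union> cls k l" using assms(1) by (auto simp: cls_def)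
  moreover have "cls k i \<inter> cls k j = {}" "(cls k i \<union> cls k j) \<inter> cls k l = {}"
    using assms(2-4) by (auto simp: cls_def)
  ultimately show ?thesis by (simp add: sum.union_disjoint)
qed

lemma card_cls:
  assumes "\<And>x. k x \<in> {i, j, l}" "i \<noteq> j" "i \<noteq> l" "j \<noteq> l"
  shows "card (cls k i) + card (cls k j) + card (cls k l) = p"
proof -
  have "card (cls k i) + card (cls k j) + card (cls k l) = card {0..<P}"
    unfolding card_eq_sum by (rule sum_cls[OF assms, symmetric])
  also have "\<dots> = p" by simp
  finally show ?thesis .
qed

text \<open>For \<open>x\<close> of colour \<open>i\<close> the solutions \<open>(x, y, z)\<close> with \<open>z\<close> of colour \<open>j\<close> and those with
  \<open>y\<close> of colour \<open>j\<close> are equally many, and both contain the ones of type \<open>(i, j, j)\<close>. So every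
  \<open>x\<close> completes as many pairs coloured \<open>(i, j)\<close> as pairs coloured \<open>(j, i)\<close>.\<close>

lemma exchange:
  assumes rf: "rainbow_free a1 a2 a3 b k"
    and k: "\<And>x. k x \<in> {i, j, l}" "i \<noteq> j" "i \<noteq> l" "j \<noteq> l"
    and coeffs: "\<not> P dvd a1" "\<not> P dvd a2" "\<not> P dvd a3"
  shows "(\<Sum>y\<in>cls k i. \<Sum>z\<in>cls k j. (a2 * y + a3 * z) ^ r) \<approx>
    (\<Sum>y\<in>cls k j. \<Sum>z\<in>cls k i. (a2 * y + a3 * z) ^ r)"
proof -
  let ?U = "{0..<P}"
  \<comment> \<open>Solutions in X x Y x Z, each weighted by (b - a1 x)^r. The weight depends on x
    alone, which makes \<open>U2\<close> and \<open>U3\<close> mere counts, yet on a solution it is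
    congruent to (a2 y + a3 z)^r, which removes x from the final statement.\<close>
  define N where "N X Y Z = (\<Sum>x\<in>X. \<Sum>y\<in>Y. \<Sum>z\<in>Z. if P dvd a1 * x + a2 * y + a3 * z - b then (b - a1 * x) ^ r else 0)"
    for X Y Z :: "int set"
  have split: "sum f {0..<P} = sum f (cls k i) + sum f (cls k j) + sum f (cls k l)" for f :: "int \<Rightarrow> int"
    by (rule sum_cls[OF k])
  have N0: "N (cls k s) (cls k t) (cls k u) = 0" if "s \<noteq> t" "t \<noteq> u" "s \<noteq> u" for s t u
    unfolding N_def
  proof (intro sum.neutral ballI)
    fix x y z assume "x \<in> cls k s" "y \<in> cls k t" "z \<in> cls k u"
    then show "(if P dvd a1 * x + a2 * y + a3 * z - b then (b - a1 * x) ^ r else 0) = 0"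
      using rf that unfolding rainbow_free_def cls_def by auto
  qed
  have N1: "N ?U Y Z = N (cls k i) Y Z + N (cls k j) Y Z + N (cls k l) Y Z" for Y Z
    unfolding N_def by (rule split)
  have N2: "N X ?U Z = N X (cls k i) Z + N X (cls k j) Z + N X (cls k l) Z" for X Z
    unfolding N_def by (simp only: split sum.distrib)
  have N3: "N X Y ?U = N X Y (cls k i) + N X Y (cls k j) + N X Y (cls k l)" for X Y
    unfolding N_def by (simp only: split sum.distrib)
  have U3: "N X Y ?U = int (card Y) * (\<Sum>x\<in>X. (b - a1 * x) ^ r)" for X Y
  proof -
    have "(\<Sum>z\<in>?U. if P dvd a1 * x + a2 * y + a3 * z - b then (b - a1 * x) ^ r else 0) = (b - a1 * x) ^ r" for x y
    proof -
      have "a1 * x + a2 * y + a3 * z - b = a3 * z + (a1 * x + a2 * y - b)" for z by simp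
      then show ?thesis by (simp only: sum_linear_solution[OF coeffs(3)])
    qed
    then show ?thesis unfolding N_def by (simp add: sum_distrib_left)
  qed
  have U2: "N X ?U Z = int (card Z) * (\<Sum>x\<in>X. (b - a1 * x) ^ r)" for X Z
  proof -
    have "(\<Sum>y\<in>?U. if P dvd a1 * x + a2 * y + a3 * z - b then (b - a1 * x) ^ r else 0) = (b - a1 * x) ^ r" for x z
    proof -
      have "a1 * x + a2 * y + a3 * z - b = a2 * y + (a1 * x + a3 * z - b)" for y by simp
      then show ?thesis by (simp only: sum_linear_solution[OF coeffs(2)])
    qed
    moreover have "N X ?U Z = (\<Sum>x\<in>X. \<Sum>z\<in>Z. \<Sum>y\<in>?U. if P dvd a1 * x + a2 * y + a3 * z - b then (b - a1 * x) ^ r else 0)"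
      unfolding N_def by (rule sum.cong[OF refl], rule sum.swap)
    ultimately show ?thesis by (simp add: sum_distrib_left)
  qed
  have 1: "N ?U Y Z \<approx> (\<Sum>y\<in>Y. \<Sum>z\<in>Z. (a2 * y + a3 * z) ^ r)" for Y Z
  proof -
    have "N ?U Y Z = (\<Sum>y\<in>Y. \<Sum>x\<in>?U. \<Sum>z\<in>Z. if P dvd a1 * x + a2 * y + a3 * z - b then (b - a1 * x) ^ r else 0)"
      unfolding N_def by (rule sum.swap)
    also have "\<dots> = (\<Sum>y\<in>Y. \<Sum>z\<in>Z. \<Sum>x\<in>?U. if P dvd a1 * x + a2 * y + a3 * z - b then (b - a1 * x) ^ r else 0)"
      by (rule sum.cong[OF refl], rule sum.swap)
    also have "\<dots> \<approx> (\<Sum>y\<in>Y. \<Sum>z\<in>Z. \<Sum>x\<in>?U. if P dvd a1 * x + (a2 * y + a3 * z - b) then (a2 * y + a3 * z) ^ r else 0)"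
    proof (intro eqm_sum)
      fix x y z
      show "(if P dvd a1 * x + a2 * y + a3 * z - b then (b - a1 * x) ^ r else 0) \<approx>
        (if P dvd a1 * x + (a2 * y + a3 * z - b) then (a2 * y + a3 * z) ^ r else 0)"
      proof (cases "P dvd a1 * x + a2 * y + a3 * z - b")
        case True
        then have "P dvd - (a1 * x + a2 * y + a3 * z - b)" by (simp only: dvd_minus_iff)
        then have "b - a1 * x \<approx> a2 * y + a3 * z" by (simp add: eqm_iff_dvd algebra_simps)
        then show ?thesis using True by (simp add: eqm_pow algebra_simps)
      qed (simp add: algebra_simps)
    qed
    also have "\<dots> = (\<Sum>y\<in>Y. \<Sum>z\<in>Z. (a2 * y + a3 * z) ^ r)"
      by (simp only: sum_linear_solution[OF coeffs(1)])
    finally show ?thesis .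
  qed
  have e1: "N (cls k i) (cls k i) (cls k j) = N (cls k i) (cls k j) (cls k i)"
    using U2[of "cls k i" "cls k j"] U3[of "cls k i" "cls k j"] N2[of "cls k i" "cls k j"] N3[of "cls k i" "cls k j"]
      N0[of i l j] N0[of i j l] k by simp
  have e2: "N (cls k j) (cls k i) (cls k j) = N (cls k j) (cls k j) (cls k i)"
    using U2[of "cls k j" "cls k i"] U3[of "cls k j" "cls k i"] N2[of "cls k j" "cls k i"] N3[of "cls k j" "cls k i"]
      N0[of j l i] N0[of j i l] k by simp
  have e3: "N ?U (cls k i) (cls k j) = N ?U (cls k j) (cls k i)"
    using N1[of "cls k i" "cls k j"] N1[of "cls k j" "cls k i"] e1 e2 N0[of l i j] N0[of l j i] k by simp
  show ?thesis by (rule eqm_trans[OF eqm_sym[OF 1] 1[of "cls k j" "cls k i", folded e3]])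
qed

text \<open>The factor a2 - a3 explains why differing coefficients are later rotated into the last
  two places.\<close>

lemma exchange_1:
  assumes "rainbow_free a1 a2 a3 b k"
    "\<And>x. k x \<in> {i, j, l}" "i \<noteq> j" "i \<noteq> l" "j \<noteq> l"
    "\<not> P dvd a1" "\<not> P dvd a2" "\<not> P dvd a3"
  shows "(a2 - a3) * (int (card (cls k j)) * \<Sum>(cls k i) - int (card (cls k i)) * \<Sum>(cls k j)) \<approx> 0"
proof -
  have *: "(\<Sum>y\<in>Y. \<Sum>z\<in>Z. (a2 * y + a3 * z) ^ 1) = a2 * int (card Z) * \<Sum>Y + a3 * int (card Y) * \<Sum>Z" for Y Z
    by (simp add: sum.distrib sum_distrib_left mult_ac)
  show ?thesis using exchange[OF assms, of 1] unfolding * eqm_iff_dvd by (simp add: algebra_simps)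
qed

text \<open>The mixed term 2 a2 a3 y z has the same sum in both orders of the classes and cancels,
  leaving the difference of squares.\<close>

lemma exchange_2:
  assumes "rainbow_free a1 a2 a3 b k"
    "\<And>x. k x \<in> {i, j, l}" "i \<noteq> j" "i \<noteq> l" "j \<noteq> l"
    "\<not> P dvd a1" "\<not> P dvd a2" "\<not> P dvd a3"
  shows "(a2\<^sup>2 - a3\<^sup>2) * (int (card (cls k j)) * (\<Sum>x\<in>cls k i. x\<^sup>2) - int (card (cls k i)) * (\<Sum>x\<in>cls k j. x\<^sup>2)) \<approx> 0"
proof -
  have *: "(\<Sum>y\<in>Y. \<Sum>z\<in>Z. (a2 * y + a3 * z) ^ 2) =
      a2\<^sup>2 * int (card Z) * (\<Sum>x\<in>Y. x\<^sup>2) + 2 * a2 * a3 * (\<Sum>Y * \<Sum>Z) + a3\<^sup>2 * int (card Y) * (\<Sum>x\<in>Z. x\<^sup>2)" for Y Z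
  proof -
    have "(\<Sum>y\<in>Y. \<Sum>z\<in>Z. (a2 * y + a3 * z) ^ 2) =
       (\<Sum>y\<in>Y. \<Sum>z\<in>Z. a2\<^sup>2 * y\<^sup>2 + 2 * a2 * a3 * (y * z) + a3\<^sup>2 * z\<^sup>2)"
      by (intro sum.cong refl) (simp add: power2_eq_square algebra_simps)
    also have "\<dots> = a2\<^sup>2 * int (card Z) * (\<Sum>x\<in>Y. x\<^sup>2) + 2 * a2 * a3 * (\<Sum>Y * \<Sum>Z) + a3\<^sup>2 * int (card Y) * (\<Sum>x\<in>Z. x\<^sup>2)"
    proof -
      have "(\<Sum>y\<in>Y. \<Sum>z\<in>Z. a2\<^sup>2 * y\<^sup>2) = a2\<^sup>2 * int (card Z) * (\<Sum>x\<in>Y. x\<^sup>2)"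
        "(\<Sum>y\<in>Y. \<Sum>z\<in>Z. a3\<^sup>2 * z\<^sup>2) = a3\<^sup>2 * int (card Y) * (\<Sum>x\<in>Z. x\<^sup>2)"
        by (simp_all add: sum_distrib_left mult_ac)
      moreover have "(\<Sum>y\<in>Y. \<Sum>z\<in>Z. 2 * a2 * a3 * (y * z)) = 2 * a2 * a3 * (\<Sum>Y * \<Sum>Z)"
        by (simp only: sum_product) (simp only: sum_distrib_left)
      ultimately show ?thesis by (simp only: sum.distrib)
    qed
    finally show ?thesis .
  qed
  show ?thesis using exchange[OF assms, of 2] unfolding * eqm_iff_dvd by (simp add: algebra_simps)
qed

text \<open>Moving the origin changes only the right-hand side. It serves to centre the classes, to
  homogenize the Schur case and to bring a singleton class to 0.\<close>

lemma translate_rainbow_free: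
  assumes "rainbow_free a1 a2 a3 b k"
  shows "rainbow_free a1 a2 a3 (b - m * (a1 + a2 + a3)) (\<lambda>x. k (x + m))"
  unfolding rainbow_free_def
proof (intro allI impI)
  fix x y z assume "P dvd a1 * x + a2 * y + a3 * z - (b - m * (a1 + a2 + a3))"
  then have "P dvd a1 * (x + m) + a2 * (y + m) + a3 * (z + m) - b" by (simp add: algebra_simps)
  then show "k (x + m) = k (y + m) \<or> k (y + m) = k (z + m) \<or> k (x + m) = k (z + m)"
    using assms unfolding rainbow_free_def by blast
qed

lemma translate_periodic: "periodic k \<Longrightarrow> periodic (\<lambda>x. k (x + m))"
  unfolding periodic_def by (metis mod_add_left_eq)

lemma translate_bij:
  assumes "periodic k"
  shows "bij_betw (\<lambda>x. (x + m) mod P) (cls (\<lambda>x. k (x + m)) i) (cls k i)"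
proof (rule bij_betw_byWitness[where f' = "\<lambda>x. (x - m) mod P"])
  show "\<forall>x\<in>cls (\<lambda>x. k (x + m)) i. ((x + m) mod P - m) mod P = x"
    by (auto simp: cls_def mod_diff_left_eq)
  show "\<forall>x\<in>cls k i. ((x - m) mod P + m) mod P = x"
    by (auto simp: cls_def mod_add_left_eq)
  show "(\<lambda>x. (x + m) mod P) ` cls (\<lambda>x. k (x + m)) i \<subseteq> cls k i"
    using assms P_pos by (auto simp: cls_def periodic_def)
  have "k ((x - m) mod P + m) = k x" for x
    using assms unfolding periodic_def by (metis diff_add_cancel mod_add_left_eq)
  then show "(\<lambda>x. (x - m) mod P) ` cls k i \<subseteq> cls (\<lambda>x. k (x + m)) i"
    using P_pos by (auto simp: cls_def)
qed

lemma translate_card: "periodic k \<Longrightarrow> card (cls (\<lambda>x. k (x + m)) i) = card (cls k i)"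
  using translate_bij bij_betw_same_card by blast

lemma translate_sum:
  assumes "periodic k"
  shows "\<Sum>(cls (\<lambda>x. k (x + m)) i) \<approx> \<Sum>(cls k i) - int (card (cls k i)) * m"
proof -
  let ?X = "cls (\<lambda>x. k (x + m)) i"
  have "\<Sum>?X = (\<Sum>x\<in>?X. x + m) - int (card ?X) * m" by (simp add: sum.distrib)
  also have "\<dots> \<approx> (\<Sum>x\<in>?X. (x + m) mod P) - int (card ?X) * m"
    by (intro eqm_diff eqm_sum) (auto simp: eqm_def cong_def)
  also have "(\<Sum>x\<in>?X. (x + m) mod P) = \<Sum>(cls k i)"
    by (rule sum.reindex_bij_betw[OF translate_bij[OF assms], of id, simplified])
  finally show ?thesis using translate_card[OF assms] by simp
qed

section \<open>First and second moments\<close>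

text \<open>The configuration to be refuted. It is stable under permuting coefficients and colours
  (\<open>good_swap\<close>), so later facts are proved for one class or one pair only.\<close>

definition good :: "int \<Rightarrow> int \<Rightarrow> int \<Rightarrow> int \<Rightarrow> (int \<Rightarrow> nat) \<Rightarrow> nat \<Rightarrow> nat \<Rightarrow> nat \<Rightarrow> bool"
  where "good a1 a2 a3 b k i j l \<longleftrightarrow> rainbow_free a1 a2 a3 b k \<and> periodic k \<and> (\<forall>x. k x \<in> {i, j, l}) \<and>
    i \<noteq> j \<and> i \<noteq> l \<and> j \<noteq> l \<and> 2 \<le> card (cls k i) \<and> 2 \<le> card (cls k j) \<and> 2 \<le> card (cls k l) \<and>
    \<not> P dvd a1 \<and> \<not> P dvd a2 \<and> \<not> P dvd a3"

lemma dvd_small: "P dvd x \<Longrightarrow> \<bar>x\<bar> < P \<Longrightarrow> x = 0"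
  using dvd_imp_le_int[of x P] by linarith

lemma good_swap:
  assumes "good a1 a2 a3 b k i j l"
  shows "good a2 a1 a3 b k i j l" "good a1 a3 a2 b k i j l"
    "good a1 a2 a3 b k j i l" "good a1 a2 a3 b k i l j"
  using assms unfolding good_def
  by (auto intro: rainbow_free_swap12 rainbow_free_swap23)

lemma good_perm:
  assumes "good a1 a2 a3 b k i j l"
  shows "good a2 a1 a3 b k i j l" "good a1 a3 a2 b k i j l" "good a2 a3 a1 b k i j l"
    "good a3 a1 a2 b k i j l" "good a3 a2 a1 b k i j l"
  using good_swap(1,2) assms by blast+

lemma good_card: "good a1 a2 a3 b k i j l \<Longrightarrow> card (cls k i) + card (cls k j) + card (cls k l) = p"
  unfolding good_def by (intro card_cls) auto

lemma good_card_ge: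
  assumes "good a1 a2 a3 b k i j l"
  shows "2 \<le> card (cls k i)" "2 \<le> card (cls k j)" "2 \<le> card (cls k l)"
  using assms unfolding good_def by blast+

lemma good_coeffs:
  assumes "good a1 a2 a3 b k i j l"
  shows "\<not> P dvd a1" "\<not> P dvd a2" "\<not> P dvd a3"
  using assms unfolding good_def by blast+

lemma good_card_lt:
  assumes "good a1 a2 a3 b k i j l"
  shows "card (cls k i) + 4 \<le> p" "card (cls k j) + 4 \<le> p" "card (cls k l) + 4 \<le> p"
  using good_card[OF assms] good_card_ge[OF assms] by linarith+

lemma good_nonempty:
  assumes "good a1 a2 a3 b k i j l"
  shows "cls k i \<noteq> {}" "cls k j \<noteq> {}" "cls k l \<noteq> {}"
  using good_card_ge[OF assms] by auto

lemma card_not_dvd: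
  assumes "good a1 a2 a3 b k i j l"
  shows "\<not> P dvd int (card (cls k i))"
  using good_card_ge(1)[OF assms] good_card_lt(1)[OF assms] by (intro not_dvd_small) linarith+

lemma good_avoid:
  assumes "good a1 a2 a3 b k i j l" "x \<in> cls k i" "y \<in> cls k j" "z \<in> cls k l"
  shows "\<not> P dvd a1 * x + a2 * y + a3 * z - b"
  using assms unfolding good_def rainbow_free_def cls_def by force

lemma good_shift_b:
  assumes "good a1 a2 a3 b k i j l" "P dvd b"
  shows "good a1 a2 a3 0 k i j l"
proof -
  have "P dvd x - b" if "P dvd x" for x using that assms(2) by (rule dvd_diff)
  then show ?thesis using assms(1) unfolding good_def rainbow_free_def by simp
qed

lemma mean_eq:
  assumes g: "good a1 a2 a3 b k i j l" and ne: "\<not> (a1 \<approx> a2 \<and> a2 \<approx> a3)"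
  shows "int (card (cls k j)) * \<Sum>(cls k i) \<approx> int (card (cls k i)) * \<Sum>(cls k j)"
proof -
  let ?d = "int (card (cls k j)) * \<Sum>(cls k i) - int (card (cls k i)) * \<Sum>(cls k j)"
  have *: "(e2 - e3) * ?d \<approx> 0" if "good e1 e2 e3 b k i j l" for e1 e2 e3
    using that unfolding good_def by (intro exchange_1[of e1 e2 e3 b k i j l]) auto
  have "?d \<approx> 0"
    using *[OF g] *[OF good_perm(4)[OF g]] ne
    unfolding eqm_0 dvd_mult_P eqm_iff_dvd[of a1 a2] eqm_iff_dvd[of a2 a3] by blast
  then show ?thesis by (simp add: eqm_iff_dvd)
qed

lemma center:
  assumes g: "good a1 a2 a3 b k i j l" and ne: "\<not> (a1 \<approx> a2 \<and> a2 \<approx> a3)"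
  obtains m where "\<And>t. t \<in> {i, j, l} \<Longrightarrow> \<Sum>(cls (\<lambda>x. k (x + m)) t) \<approx> 0"
    "good a1 a2 a3 (b - m * (a1 + a2 + a3)) (\<lambda>x. k (x + m)) i j l"
proof -
  have per: "periodic k" using g good_def by blast
  let ?n = "\<lambda>t. int (card (cls k t))"
  obtain e where e: "?n i * e \<approx> 1" using ex_inverse card_not_dvd[OF g] by blast
  \<comment> \<open>The mean of class i modulo p, which \<open>mean_eq\<close> turns into the mean
    of every class.\<close>
  define m where "m = e * \<Sum>(cls k i)"
  have "?n i * m \<approx> 1 * \<Sum>(cls k i)"
    unfolding m_def using eqm_scalar_right[OF e] by (simp add: mult.assoc)
  then have mi: "?n i * m \<approx> \<Sum>(cls k i)" by simp
  have mt: "?n t * m \<approx> \<Sum>(cls k t)" if t: "?n t * \<Sum>(cls k i) \<approx> ?n i * \<Sum>(cls k t)" for t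
  proof -
    have "?n i * (?n t * m) = ?n t * (?n i * m)" by simp
    also have "\<dots> \<approx> ?n t * \<Sum>(cls k i)" by (rule eqm_scalar_left[OF mi])
    also have "\<dots> \<approx> ?n i * \<Sum>(cls k t)" by (rule t)
    finally show ?thesis using eqm_mult_cancel card_not_dvd[OF g] by blast
  qed
  have all: "?n t * m \<approx> \<Sum>(cls k t)" if "t \<in> {i, j, l}" for t
    using that mi mt mean_eq[OF g ne] mean_eq[OF good_swap(4)[OF g] ne] by blast
  have "\<Sum>(cls (\<lambda>x. k (x + m)) t) \<approx> 0" if "t \<in> {i, j, l}" for t
  proof -
    have "\<Sum>(cls (\<lambda>x. k (x + m)) t) \<approx> \<Sum>(cls k t) - ?n t * m" by (rule translate_sum[OF per])
    also have "\<dots> \<approx> \<Sum>(cls k t) - \<Sum>(cls k t)" by (intro eqm_diff all that eqm_refl)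
    finally show ?thesis by simp
  qed
  moreover have "good a1 a2 a3 (b - m * (a1 + a2 + a3)) (\<lambda>x. k (x + m)) i j l"
    using g translate_rainbow_free[of a1 a2 a3 b k m] translate_periodic[OF per]
    unfolding good_def translate_card[OF per] by blast
  ultimately show ?thesis using that by blast
qed

lemma hsym_1:
  assumes g: "good a1 a2 a3 b k i j l" and "\<Sum>(cls k i) \<approx> 0"
  shows "hsym (cls k i) 1 \<approx> 0"
proof -
  have "(\<Sum>x\<in>cls k i. x ^ 1) \<approx> int 1 * hsym (cls k i) 1"
    by (rule newton_first) (use good_card_ge[OF g] in auto)
  then have "\<Sum>(cls k i) \<approx> hsym (cls k i) 1" by simp
  then show ?thesis using assms(2) eqm_sym eqm_trans by blast
qed

lemma hsym_2:
  assumes g: "good a1 a2 a3 b k i j l" and "\<Sum>(cls k i) \<approx> 0"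
  shows "(\<Sum>x\<in>cls k i. x\<^sup>2) \<approx> 2 * hsym (cls k i) 2"
proof -
  have "(\<Sum>x\<in>cls k i. x ^ 2) \<approx> int 2 * hsym (cls k i) 2"
  proof (rule newton_first)
    fix s :: nat assume "1 \<le> s" "s < 2"
    then have "s = 1" by simp
    then show "hsym (cls k i) s \<approx> 0" using hsym_1[OF assms] by simp
  qed (use good_card_ge[OF g] in auto)
  then show ?thesis by simp
qed

text \<open>The first proportion comes from counting solutions (\<open>exchange_2\<close>). The
  second is the difference of two level 2 equations with two coefficients interchanged, where b and
  the third class cancel.\<close>

lemma second_moment_eq:
  assumes g: "good a1 a2 a3 b k i j l" and p3: "p > 3" and ne: "\<not> (a1\<^sup>2 \<approx> a2\<^sup>2 \<and> a2\<^sup>2 \<approx> a3\<^sup>2)"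
    and mean: "\<And>t. t \<in> {i, j, l} \<Longrightarrow> \<Sum>(cls k t) \<approx> 0"
  defines "n \<equiv> int (card (cls k i))" and "m \<equiv> int (card (cls k j))"
  shows "m * hsym (cls k i) 2 \<approx> n * hsym (cls k j) 2"
    "m * (m + 1) * hsym (cls k i) 2 \<approx> n * (n + 1) * hsym (cls k j) 2"
proof -
  let ?u = "hsym (cls k i) 2" and ?v = "hsym (cls k j) 2" and ?w = "hsym (cls k l) 2"
  define c where "c = int (card (cls k l))"
  have nd: "\<not> P dvd 2"
    using p3 by (intro not_dvd_small) auto
  have hi: "(\<Sum>x\<in>cls k i. x\<^sup>2) \<approx> 2 * ?u" by (rule hsym_2[OF g]) (simp add: mean)
  have hj: "(\<Sum>x\<in>cls k j. x\<^sup>2) \<approx> 2 * ?v" by (rule hsym_2[OF good_swap(3)[OF g]]) (simp add: mean)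
  have 1: "(e2\<^sup>2 - e3\<^sup>2) * (m * ?u - n * ?v) \<approx> 0" if "good e1 e2 e3 b k i j l" for e1 e2 e3
  proof -
    have "2 * ((e2\<^sup>2 - e3\<^sup>2) * (m * ?u - n * ?v)) = (e2\<^sup>2 - e3\<^sup>2) * (m * (2 * ?u) - n * (2 * ?v))"
      by (simp add: algebra_simps)
    also have "\<dots> \<approx> (e2\<^sup>2 - e3\<^sup>2) * (m * (\<Sum>x\<in>cls k i. x\<^sup>2) - n * (\<Sum>x\<in>cls k j. x\<^sup>2))"
      by (intro eqm_scalar_left eqm_diff eqm_sym[OF hi] eqm_sym[OF hj])
    also have "\<dots> \<approx> 0"
      unfolding n_def m_def using that unfolding good_def by (intro exchange_2[of e1 e2 e3 b k i j l]) auto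
    finally show ?thesis using nd by (simp add: eqm_0 dvd_mult_P)
  qed
  have "m * ?u - n * ?v \<approx> 0"
    using 1[OF g] 1[OF good_perm(4)[OF g]] ne
    unfolding eqm_0 dvd_mult_P eqm_iff_dvd[of "a1\<^sup>2" "a2\<^sup>2"] eqm_iff_dvd[of "a2\<^sup>2" "a3\<^sup>2"] by blast
  then show "m * ?u \<approx> n * ?v" by (simp add: eqm_iff_dvd)
  have nc: "\<not> P dvd c * (c + 1)"
    using good_card_ge(3)[OF g] good_card_lt(3)[OF g] not_dvd_small[of c] not_dvd_small[of "c + 1"]
    unfolding c_def dvd_mult_P by linarith
  have 2: "2 * (e1\<^sup>2 * ?u * (m * (m + 1) * (c * (c + 1))) +
      e2\<^sup>2 * ?v * (n * (n + 1) * (c * (c + 1))) +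
      e3\<^sup>2 * ?w * (n * (n + 1) * (m * (m + 1)))) +
      b\<^sup>2 * (n * (n + 1) * (m * (m + 1)) * (c * (c + 1))) \<approx> 0" if h: "good e1 e2 e3 b k i j l" for e1 e2 e3
  proof (rule level_two)
    show "hsym (cls k i) 1 \<approx> 0" by (rule hsym_1[OF g]) (simp add: mean)
    show "hsym (cls k j) 1 \<approx> 0" by (rule hsym_1[OF good_swap(3)[OF g]]) (simp add: mean)
    show "hsym (cls k l) 1 \<approx> 0" by (rule hsym_1[OF good_swap(3)[OF good_swap(4)[OF g]]]) (simp add: mean)
    show "cls k i \<noteq> {}" "cls k j \<noteq> {}" "cls k l \<noteq> {}" by (rule good_nonempty[OF g])+
    show "\<not> P dvd e1" "\<not> P dvd e2" "\<not> P dvd e3" by (rule good_coeffs[OF h])+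
    show "\<not> P dvd e1 * x + e2 * y + e3 * z - b" if "x \<in> cls k i" "y \<in> cls k j" "z \<in> cls k l" for x y z
      using good_avoid[OF h that] .
  qed (use good_card[OF g] p3 in \<open>simp_all add: n_def m_def c_def\<close>)
  have 3: "(e1\<^sup>2 - e2\<^sup>2) * (m * (m + 1) * ?u - n * (n + 1) * ?v) \<approx> 0" if "good e1 e2 e3 b k i j l" for e1 e2 e3
  proof -
    have "P dvd 2 * ((c * (c + 1)) * ((e1\<^sup>2 - e2\<^sup>2) * (m * (m + 1) * ?u - n * (n + 1) * ?v)))"
      using dvd_diff[OF 2[OF that, unfolded eqm_0] 2[OF good_perm(1)[OF that], unfolded eqm_0]]
      by (simp add: algebra_simps)
    then show ?thesis using nd nc by (simp add: eqm_0 dvd_mult_P)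
  qed
  have "m * (m + 1) * ?u - n * (n + 1) * ?v \<approx> 0"
    using 3[OF g] 3[OF good_perm(3)[OF g]] ne
    unfolding eqm_0 dvd_mult_P eqm_iff_dvd[of "a1\<^sup>2" "a2\<^sup>2"] eqm_iff_dvd[of "a2\<^sup>2" "a3\<^sup>2"] by blast
  then show "m * (m + 1) * ?u \<approx> n * (n + 1) * ?v" by (simp add: eqm_iff_dvd)
qed

text \<open>The two proportions combine to m (m - n) h_2 = 0. A nonzero h_2 would make all three
  sizes equal, so p would be a multiple of 3.\<close>

lemma second_moment_zero:
  assumes g: "good a1 a2 a3 b k i j l" and p3: "p > 3" and ne: "\<not> (a1\<^sup>2 \<approx> a2\<^sup>2 \<and> a2\<^sup>2 \<approx> a3\<^sup>2)"
    and mean: "\<And>t. t \<in> {i, j, l} \<Longrightarrow> \<Sum>(cls k t) \<approx> 0"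
  shows "hsym (cls k i) 2 \<approx> 0"
proof (rule ccontr)
  assume u: "\<not> hsym (cls k i) 2 \<approx> 0"
  have *: "card (cls k i) = card (cls k t)" if h: "good a1 a2 a3 b k i t s" and ts: "{i, t, s} = {i, j, l}" for t s
  proof -
    let ?n = "int (card (cls k i))" and ?m = "int (card (cls k t))"
    let ?u = "hsym (cls k i) 2" and ?v = "hsym (cls k t) 2"
    have mean': "\<And>r. r \<in> {i, t, s} \<Longrightarrow> \<Sum>(cls k r) \<approx> 0" using mean ts by blast
    note e = second_moment_eq[OF h p3 ne mean']
    have eq: "(?m * (?m + 1) * ?u - ?n * (?n + 1) * ?v) - (?n + 1) * (?m * ?u - ?n * ?v) = ?m * (?m - ?n) * ?u"
      by (simp add: algebra_simps)
    have "P dvd ?m * (?m - ?n) * ?u"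
      by (rule dvd_diff[OF e(2)[unfolded eqm_iff_dvd] dvd_mult[OF e(1)[unfolded eqm_iff_dvd]], of "?n + 1", unfolded eq])
    then have "P dvd ?m - ?n"
      using u card_not_dvd[OF good_swap(3)[OF h]] unfolding eqm_0 dvd_mult_P by blast
    moreover have "\<bar>?m - ?n\<bar> < P" using good_card_lt[OF h] by linarith
    ultimately have "?m - ?n = 0" by (rule dvd_small)
    then show ?thesis by simp
  qed
  have "card (cls k i) = card (cls k j)" "card (cls k i) = card (cls k l)"
    using *[OF g] *[OF good_swap(4)[OF g]] by auto
  then have "p = 3 * card (cls k i)" using good_card[OF g] by linarith
  then have "3 dvd p" by (rule dvdI)
  then have "3 = (1::nat) \<or> 3 = p" using prime_p unfolding prime_nat_iff by blast
  then show False using p3 by linarith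
qed

text \<open>Without second moments the level 2 equation keeps only b^2 times a product prime to p. A
  centred configuration therefore belongs to a homogeneous equation.\<close>

lemma inhomogeneity_zero:
  assumes g: "good a1 a2 a3 b k i j l" and p3: "p > 3" and ne: "\<not> (a1\<^sup>2 \<approx> a2\<^sup>2 \<and> a2\<^sup>2 \<approx> a3\<^sup>2)"
    and mean: "\<And>t. t \<in> {i, j, l} \<Longrightarrow> \<Sum>(cls k t) \<approx> 0"
  shows "P dvd b"
proof -
  define n m c where "n = int (card (cls k i))" and "m = int (card (cls k j))" and "c = int (card (cls k l))"
  let ?u = "hsym (cls k i) 2" and ?v = "hsym (cls k j) 2" and ?w = "hsym (cls k l) 2"
  have g': "good a1 a2 a3 b k j i l" "good a1 a2 a3 b k l i j"
    using good_swap(3,4) g by blast+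
  have z: "?u \<approx> 0" "?v \<approx> 0" "?w \<approx> 0"
    by (rule second_moment_zero[OF g p3 ne mean] second_moment_zero[OF g'(1) p3 ne mean]
        second_moment_zero[OF g'(2) p3 ne mean]; auto)+
  have "2 * (a1\<^sup>2 * ?u * (m * (m + 1) * (c * (c + 1))) +
      a2\<^sup>2 * ?v * (n * (n + 1) * (c * (c + 1))) +
      a3\<^sup>2 * ?w * (n * (n + 1) * (m * (m + 1)))) +
      b\<^sup>2 * (n * (n + 1) * (m * (m + 1)) * (c * (c + 1))) \<approx> 0" (is "?S + ?T \<approx> 0")
  proof (rule level_two)
    show "hsym (cls k i) 1 \<approx> 0" by (rule hsym_1[OF g]) (simp add: mean)
    show "hsym (cls k j) 1 \<approx> 0" by (rule hsym_1[OF g'(1)]) (simp add: mean)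
    show "hsym (cls k l) 1 \<approx> 0" by (rule hsym_1[OF g'(2)]) (simp add: mean)
    show "cls k i \<noteq> {}" "cls k j \<noteq> {}" "cls k l \<noteq> {}" by (rule good_nonempty[OF g])+
    show "\<not> P dvd a1" "\<not> P dvd a2" "\<not> P dvd a3" by (rule good_coeffs[OF g])+
    show "\<not> P dvd a1 * x + a2 * y + a3 * z - b" if "x \<in> cls k i" "y \<in> cls k j" "z \<in> cls k l" for x y z
      using good_avoid[OF g that] .
  qed (use good_card[OF g] p3 in \<open>simp_all add: n_def m_def c_def\<close>)
  moreover have "P dvd ?S" using z by (simp add: eqm_0 dvd_add)
  ultimately have "P dvd ?T" unfolding eqm_0 using dvd_add_right_iff by blast
  moreover have "\<not> P dvd n" "\<not> P dvd n + 1" "\<not> P dvd m" "\<not> P dvd m + 1" "\<not> P dvd c" "\<not> P dvd c + 1"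
    using good_card_ge[OF g] good_card_lt[OF g] unfolding n_def m_def c_def
    by (intro not_dvd_small; linarith)+
  ultimately show ?thesis by (simp add: dvd_mult_P power2_eq_square)
qed

section \<open>Higher moments\<close>

lemma pochhammer_not_dvd:
  assumes "0 < x" "x + int n \<le> P"
  shows "\<not> P dvd pochhammer x n"
  using assms
proof (induction n)
  case 0
  then show ?case using prime_P by (auto simp: zdvd_not_zless)
next
  case (Suc n)
  have "\<not> P dvd x + int n" using Suc.prems by (intro not_dvd_small) auto
  moreover have "\<not> P dvd pochhammer x n" using Suc by simp
  ultimately show ?case unfolding pochhammer_Suc dvd_mult_P by simp
qed

text \<open>Divided by its three Pochhammer products this is a sum of terms a^r h_r / (size -
  index)_r, each depending on the index of its own class only. Varying the indices with fixed sum r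
  - 2 produces the linear system of level r.\<close>

lemma level_good:
  assumes g: "good a1 a2 a3 0 k i j l"
    and r: "r = i0 + j0 + k0 + 2" "r < p - 1"
    and le: "i0 < card (cls k i)" "j0 < card (cls k j)" "k0 < card (cls k l)"
    and abc: "a = int (card (cls k i))" "b = int (card (cls k j))" "c = int (card (cls k l))"
    and low: "\<And>s t u. s + t + u = r \<Longrightarrow> s < r \<Longrightarrow> t < r \<Longrightarrow> u < r \<Longrightarrow>
      hsym (cls k i) s \<approx> 0 \<or> hsym (cls k j) t \<approx> 0 \<or> hsym (cls k l) u \<approx> 0"
  shows "P dvd
    a1 ^ r * hsym (cls k i) r * (pochhammer (b - int j0) r * pochhammer (c - int k0) r) +
    a2 ^ r * hsym (cls k j) r * (pochhammer (a - int i0) r * pochhammer (c - int k0) r) +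
    a3 ^ r * hsym (cls k l) r * (pochhammer (a - int i0) r * pochhammer (b - int j0) r)"
proof -
  define \<alpha> \<beta> \<gamma> where "\<alpha> = card (cls k i) - 1 - i0" and "\<beta> = card (cls k j) - 1 - j0"
    and "\<gamma> = card (cls k l) - 1 - k0"
  have cA: "card (cls k i) = Suc \<alpha> + i0" and cB: "card (cls k j) = Suc \<beta> + j0" and cC: "card (cls k l) = Suc \<gamma> + k0"
    using le unfolding \<alpha>_def \<beta>_def \<gamma>_def by linarith+
  have eq: "int \<alpha> + 1 = a - int i0" "int \<beta> + 1 = b - int j0" "int \<gamma> + 1 = c - int k0"
    using cA cB cC abc by linarith+
  have "excess_sum (cls k i) (cls k j) (cls k l) a1 a2 a3 \<alpha> \<beta> \<gamma> r \<approx> 0"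
  proof (rule level_equation[OF cls_props(1,2) cA cls_props(1,2) cB cls_props(1,2) cC good_card[OF g] good_coeffs[OF g] _ r])
    fix x y z assume "x \<in> cls k i" "y \<in> cls k j" "z \<in> cls k l"
    from good_avoid[OF g this] show "\<not> P dvd a1 * x + a2 * y + a3 * z" by simp
  qed
  moreover have "excess_sum (cls k i) (cls k j) (cls k l) a1 a2 a3 \<alpha> \<beta> \<gamma> r \<approx>
    a1 ^ r * hsym (cls k i) r * (pochhammer (int \<beta> + 1) r * pochhammer (int \<gamma> + 1) r) +
    a2 ^ r * hsym (cls k j) r * (pochhammer (int \<alpha> + 1) r * pochhammer (int \<gamma> + 1) r) +
    a3 ^ r * hsym (cls k l) r * (pochhammer (int \<alpha> + 1) r * pochhammer (int \<beta> + 1) r)"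
    using r by (intro excess_sum_single cls_props good_nonempty[OF g] low) auto
  ultimately show ?thesis unfolding eq eqm_0[symmetric] using eqm_sym eqm_trans by blast
qed

text \<open>Level 3 with the index 1 on i and on j, the third unknown eliminated. The level yields
  no more than such ratios: unknowns proportional to (x - 1) x (x + 1) (x + 2), x the size, satisfy
  all its equations because a + b + c = p.\<close>

lemma third_moment_ratio:
  assumes g: "good a1 a2 a3 0 k i j l" and p5: "5 \<le> p"
    and low: "\<And>t s. t \<in> {i, j, l} \<Longrightarrow> 1 \<le> s \<Longrightarrow> s < 3 \<Longrightarrow> hsym (cls k t) s \<approx> 0"
    and ab: "a = int (card (cls k i))" "b = int (card (cls k j))"
  shows "a1 ^ 3 * hsym (cls k i) 3 * ((b - 1) * b * (b + 1) * (b + 2)) \<approx>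
    a2 ^ 3 * hsym (cls k j) 3 * ((a - 1) * a * (a + 1) * (a + 2))"
proof -
  define c where "c = int (card (cls k l))"
  define U V W where "U = a1 ^ 3 * hsym (cls k i) 3" and "V = a2 ^ 3 * hsym (cls k j) 3" and "W = a3 ^ 3 * hsym (cls k l) 3"
  note ge = good_card_ge[OF g] and lt = good_card_lt[OF g]
  have p6: "3 < p - 1" using good_card[OF g] ge by linarith
  have low': "hsym (cls k i) s \<approx> 0 \<or> hsym (cls k j) t \<approx> 0 \<or> hsym (cls k l) u \<approx> 0"
    if "s + t + u = 3" "s < 3" "t < 3" "u < 3" for s t u
  proof -
    have "1 \<le> s \<or> 1 \<le> t" using that by linarith
    then show ?thesis using low that by blast
  qed
  have po: "pochhammer x 3 = x * (x + 1) * (x + 2)" for x :: int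
    by (simp add: numeral_3_eq_3 pochhammer_Suc)
  define z where "z = c * (c + 1) * (c + 2)"
  have E1: "P dvd U * (b * (b + 1) * (b + 2) * z) + V * ((a - 1) * a * (a + 1) * z)
      + W * ((a - 1) * a * (a + 1) * (b * (b + 1) * (b + 2)))"
    using level_good[OF g, of 3 1 0 0 a b c, OF _ p6 _ _ _ ab c_def low'] ge
    unfolding po U_def V_def W_def z_def by (simp add: add_ac)
  have E2: "P dvd U * ((b - 1) * b * (b + 1) * z) + V * (a * (a + 1) * (a + 2) * z)
      + W * (a * (a + 1) * (a + 2) * ((b - 1) * b * (b + 1)))"
    using level_good[OF g, of 3 0 1 0 a b c, OF _ p6 _ _ _ ab c_def low'] ge
    unfolding po U_def V_def W_def z_def by (simp add: add_ac)
  have eq: "(a * (a + 1) * (a + 2)) * ((b - 1) * b * (b + 1)) *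
      (U * (b * (b + 1) * (b + 2) * z) + V * ((a - 1) * a * (a + 1) * z)
        + W * ((a - 1) * a * (a + 1) * (b * (b + 1) * (b + 2)))) -
      ((a - 1) * a * (a + 1)) * (b * (b + 1) * (b + 2)) *
      (U * ((b - 1) * b * (b + 1) * z) + V * (a * (a + 1) * (a + 2) * z)
        + W * (a * (a + 1) * (a + 2) * ((b - 1) * b * (b + 1)))) =
      3 * z * a * (a + 1) * b * (b + 1) *
      (U * ((b - 1) * b * (b + 1) * (b + 2)) - V * ((a - 1) * a * (a + 1) * (a + 2)))"
    by (simp add: algebra_simps)
  have d: "P dvd 3 * z * a * (a + 1) * b * (b + 1) *
      (U * ((b - 1) * b * (b + 1) * (b + 2)) - V * ((a - 1) * a * (a + 1) * (a + 2)))"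
    unfolding eq[symmetric] by (intro dvd_diff dvd_mult E1 E2)
  have "\<not> P dvd 3" "\<not> P dvd a" "\<not> P dvd a + 1" "\<not> P dvd b" "\<not> P dvd b + 1"
      "\<not> P dvd c" "\<not> P dvd c + 1" "\<not> P dvd c + 2"
    using ge lt p5 unfolding ab c_def by (intro not_dvd_small; linarith)+
  then have "\<not> P dvd 3 * z * a * (a + 1) * b * (b + 1)"
    unfolding z_def dvd_mult_P by blast
  then show ?thesis using d unfolding dvd_mult_P eqm_iff_dvd U_def V_def by blast
qed

text \<open>The indices 0, 1, 2 share the factor \<open>pochhammer x n\<close>, so only quadratic
  polynomials in the sizes remain in the system of \<open>high_moment_step\<close>.\<close>

lemma pochhammer_shift:
  fixes x :: int
  shows "pochhammer x (n + 2) = pochhammer x n * (x + int n) * (x + int n + 1)"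
    "pochhammer (x - 1) (n + 2) = (x - 1) * pochhammer x n * (x + int n)"
    "pochhammer (x - 2) (n + 2) = (x - 2) * (x - 1) * pochhammer x n"
proof -
  show "pochhammer x (n + 2) = pochhammer x n * (x + int n) * (x + int n + 1)"
    by (simp add: pochhammer_Suc algebra_simps)
  have 1: "pochhammer (y - 1) (Suc m) = (y - 1) * pochhammer y m" for y :: int and m
    by (simp add: pochhammer_rec)
  show "pochhammer (x - 1) (n + 2) = (x - 1) * pochhammer x n * (x + int n)"
    using 1[of x "Suc n"] by (simp add: pochhammer_Suc algebra_simps)
  have "pochhammer (x - 2) (n + 2) = (x - 2) * pochhammer (x - 1) (Suc n)"
    using 1[of "x - 1" "Suc n"] by simp
  then show "pochhammer (x - 2) (n + 2) = (x - 2) * (x - 1) * pochhammer x n"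
    using 1[of x n] by (simp add: mult.assoc)
qed

text \<open>Elimination of W; x, y and x', y' are the parts that change with the index, while e, h,
  z are common to both equations.\<close>

lemma eliminate_dvd:
  fixes d :: int
  assumes "d dvd U * (y * h * z) + V * (x * e * z) + W * (x * e * (y * h))"
    and "d dvd U * (y' * h * z) + V * (x' * e * z) + W * (x' * e * (y' * h))"
  shows "d dvd z * (U * h * (y * y' * (x' - x)) - V * e * (x * x' * (y - y')))"
proof -
  have "z * (U * h * (y * y' * (x' - x)) - V * e * (x * x' * (y - y'))) =
    x' * y' * (U * (y * h * z) + V * (x * e * z) + W * (x * e * (y * h))) -
    x * y * (U * (y' * h * z) + V * (x' * e * z) + W * (x' * e * (y' * h)))"
    by (simp add: algebra_simps)
  then show ?thesis using assms by (simp add: dvd_diff)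
qed

text \<open>Three equations of level n + 2: the index n - 2 is parked on class l and the remaining 2
  is split over i and j as 2 + 0, 1 + 1, 0 + 2. The first conclusion is an implication in disguise:
  if the moment of j vanishes, so does that of l; the one of j comes from exchanging i and
  j.\<close>

lemma high_moment_step:
  assumes g: "good a1 a2 a3 0 k i j l" and n: "2 \<le> n"
    and size: "3 \<le> card (cls k i)" "3 \<le> card (cls k j)" "n \<le> card (cls k l)"
      "card (cls k i) + n + 1 < p" "card (cls k j) + n + 1 < p"
    and low: "\<And>s t u. s + t + u = n + 2 \<Longrightarrow> s < n + 2 \<Longrightarrow> t < n + 2 \<Longrightarrow> u < n + 2 \<Longrightarrow>
      hsym (cls k i) s \<approx> 0 \<or> hsym (cls k j) t \<approx> 0 \<or> hsym (cls k l) u \<approx> 0"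
  shows "hsym (cls k i) (n + 2) \<approx> 0 \<and> hsym (cls k l) (n + 2) \<approx> 0 \<or> \<not> hsym (cls k j) (n + 2) \<approx> 0"
    "hsym (cls k i) (n + 2) \<approx> 0"
proof -
  define a b c where "a = int (card (cls k i))" and "b = int (card (cls k j))" and "c = int (card (cls k l))"
  define U V W where "U = a1 ^ (n + 2) * hsym (cls k i) (n + 2)" and "V = a2 ^ (n + 2) * hsym (cls k j) (n + 2)"
    and "W = a3 ^ (n + 2) * hsym (cls k l) (n + 2)"
  note ge = good_card_ge[OF g] and lt = good_card_lt[OF g]
  have sum: "a + b + c = P" using good_card[OF g] unfolding a_def b_def c_def by linarith
  have ints: "3 \<le> a" "3 \<le> b" "int n \<le> c" "a + int n + 1 < P" "b + int n + 1 < P" "c + 6 \<le> P" "2 \<le> int n"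
    using size sum n unfolding a_def b_def c_def by linarith+
  define z h e where "z = pochhammer (c - int (n - 2)) (n + 2)" and "h = pochhammer b n" and "e = pochhammer a n"
  define N where "N = int n"
  have r: "n + 2 < p - 1" "n - 2 < card (cls k l)" using size n ge by linarith+
  have L: "P dvd U * (pochhammer (b - int j0) (n + 2) * z) + V * (pochhammer (a - int i0) (n + 2) * z)
      + W * (pochhammer (a - int i0) (n + 2) * pochhammer (b - int j0) (n + 2))"
    if "n + 2 = i0 + j0 + (n - 2) + 2" "i0 < card (cls k i)" "j0 < card (cls k j)" for i0 j0
    unfolding U_def V_def W_def z_def
  proof (rule level_good[OF g that(1) r(1) that(2,3) r(2) a_def b_def c_def])
    fix s t u assume "s + t + u = n + 2" "s < n + 2" "t < n + 2" "u < n + 2"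
    then show "hsym (cls k i) s \<approx> 0 \<or> hsym (cls k j) t \<approx> 0 \<or> hsym (cls k l) u \<approx> 0" by (rule low)
  qed
  have pa: "pochhammer (a - int 0) (n + 2) = (a + N) * (a + N + 1) * e"
    "pochhammer (a - int 1) (n + 2) = (a - 1) * (a + N) * e"
    "pochhammer (a - int 2) (n + 2) = (a - 2) * (a - 1) * e"
    using pochhammer_shift[where x = a and n = n] unfolding e_def N_def by (simp_all only: of_nat_0 of_nat_1 of_nat_numeral diff_0_right mult_ac)
  have pb: "pochhammer (b - int 0) (n + 2) = (b + N) * (b + N + 1) * h"
    "pochhammer (b - int 1) (n + 2) = (b - 1) * (b + N) * h"
    "pochhammer (b - int 2) (n + 2) = (b - 2) * (b - 1) * h"
    using pochhammer_shift[where x = b and n = n] unfolding h_def N_def by (simp_all only: of_nat_0 of_nat_1 of_nat_numeral diff_0_right mult_ac)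
  note E20 = L[of 2 0, unfolded pa pb] and E11 = L[of 1 1, unfolded pa pb] and E02 = L[of 0 2, unfolded pa pb]
  have s: "n + 2 = 2 + 0 + (n - 2) + 2" "n + 2 = 1 + 1 + (n - 2) + 2" "n + 2 = 0 + 2 + (n - 2) + 2"
    "2 < card (cls k i)" "1 < card (cls k i)" "0 < card (cls k i)"
    "2 < card (cls k j)" "1 < card (cls k j)" "0 < card (cls k j)"
    using n size by arith+
  have intsN: "3 \<le> a" "3 \<le> b" "N \<le> c" "a + N + 1 < P" "b + N + 1 < P" "2 \<le> N"
    using ints by (simp_all add: N_def)
  have nd: "\<not> P dvd z" "\<not> P dvd h" "\<not> P dvd e"
    unfolding z_def h_def e_def using ints n by (intro pochhammer_not_dvd; linarith)+
  have nd': "\<not> P dvd N + 2" "\<not> P dvd a - 1" "\<not> P dvd a - 2" "\<not> P dvd b + N" "\<not> P dvd b + N + 1"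
    "\<not> P dvd a + N" "\<not> P dvd b - 1" "\<not> P dvd N + 3"
    by (rule not_dvd_small; use intsN in linarith)+
  \<comment> \<open>The splits 2 + 0 and 1 + 1 without W, divided by the common unit (N + 2) (a - 1)
    (b + N).\<close>
  have I: "P dvd U * h * ((b + N) * (b + N + 1) * (b - 1)) - V * e * ((a - 1) * (a + N) * (a - 2))"
  proof -
    have "(b + N) * (b + N + 1) * ((b - 1) * (b + N)) * ((a - 1) * (a + N) - (a - 2) * (a - 1)) =
        (N + 2) * (a - 1) * (b + N) * ((b + N) * (b + N + 1) * (b - 1))"
      "(a - 2) * (a - 1) * ((a - 1) * (a + N)) * ((b + N) * (b + N + 1) - (b - 1) * (b + N)) =
        (N + 2) * (a - 1) * (b + N) * ((a - 1) * (a + N) * (a - 2))"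
      by (simp_all add: algebra_simps)
    then have "P dvd z * (U * h * ((N + 2) * (a - 1) * (b + N) * ((b + N) * (b + N + 1) * (b - 1))) -
        V * e * ((N + 2) * (a - 1) * (b + N) * ((a - 1) * (a + N) * (a - 2))))"
      using eliminate_dvd[OF E20[OF s(1,4,9)] E11[OF s(2,5,8)]] by (simp only:)
    also have "z * (U * h * ((N + 2) * (a - 1) * (b + N) * ((b + N) * (b + N + 1) * (b - 1))) -
        V * e * ((N + 2) * (a - 1) * (b + N) * ((a - 1) * (a + N) * (a - 2)))) =
      z * ((N + 2) * (a - 1) * (b + N)) *
        (U * h * ((b + N) * (b + N + 1) * (b - 1)) - V * e * ((a - 1) * (a + N) * (a - 2)))"
      by (simp only: right_diff_distrib mult_ac)
    finally have "P dvd z * ((N + 2) * (a - 1) * (b + N)) *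
        (U * h * ((b + N) * (b + N + 1) * (b - 1)) - V * e * ((a - 1) * (a + N) * (a - 2)))" .
    then show ?thesis using nd nd' unfolding dvd_mult_P by blast
  qed
  have II: "P dvd U * h * ((b - 1) * (b + N) * (b - 2)) - V * e * ((a + N) * (a + N + 1) * (a - 1))"
  proof -
    have "(b - 1) * (b + N) * ((b - 2) * (b - 1)) * ((a + N) * (a + N + 1) - (a - 1) * (a + N)) =
        (N + 2) * (a + N) * (b - 1) * ((b - 1) * (b + N) * (b - 2))"
      "(a - 1) * (a + N) * ((a + N) * (a + N + 1)) * ((b - 1) * (b + N) - (b - 2) * (b - 1)) =
        (N + 2) * (a + N) * (b - 1) * ((a + N) * (a + N + 1) * (a - 1))"
      by (simp_all add: algebra_simps)
    then have "P dvd z * (U * h * ((N + 2) * (a + N) * (b - 1) * ((b - 1) * (b + N) * (b - 2))) -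
        V * e * ((N + 2) * (a + N) * (b - 1) * ((a + N) * (a + N + 1) * (a - 1))))"
      using eliminate_dvd[OF E11[OF s(2,5,8)] E02[OF s(3,6,7)]] by (simp only:)
    also have "z * (U * h * ((N + 2) * (a + N) * (b - 1) * ((b - 1) * (b + N) * (b - 2))) -
        V * e * ((N + 2) * (a + N) * (b - 1) * ((a + N) * (a + N + 1) * (a - 1)))) =
      z * ((N + 2) * (a + N) * (b - 1)) *
        (U * h * ((b - 1) * (b + N) * (b - 2)) - V * e * ((a + N) * (a + N + 1) * (a - 1)))"
      by (simp only: right_diff_distrib mult_ac)
    finally have "P dvd z * ((N + 2) * (a + N) * (b - 1)) *
        (U * h * ((b - 1) * (b + N) * (b - 2)) - V * e * ((a + N) * (a + N + 1) * (a - 1)))" .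
    then show ?thesis using nd nd' unfolding dvd_mult_P by blast
  qed
  \<comment> \<open>Absorbing the factors common to \<open>I\<close> and \<open>II\<close> leaves a
    2 x 2 system in Q and R with determinant (N + 3) (a + b + N - 1), up to sign.\<close>
  define Q R where "Q = U * h * ((b + N) * (b - 1))" and "R = V * e * ((a - 1) * (a + N))"
  have q: "P dvd Q * (b + N + 1) - R * (a - 2)" "P dvd Q * (b - 2) - R * (a + N + 1)"
    using I II unfolding Q_def R_def by (simp_all only: mult_ac)
  have "P dvd (a + N + 1) * (Q * (b + N + 1) - R * (a - 2)) - (a - 2) * (Q * (b - 2) - R * (a + N + 1))"
    by (rule dvd_diff[OF dvd_mult[OF q(1)] dvd_mult[OF q(2)]])
  moreover have "(a + N + 1) * (Q * (b + N + 1) - R * (a - 2)) - (a - 2) * (Q * (b - 2) - R * (a + N + 1)) =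
      Q * ((N + 3) * (a + b + N - 1))"
    by (simp add: algebra_simps)
  ultimately have "P dvd Q * ((N + 3) * (a + b + N - 1))" by (simp only:)
  \<comment> \<open>Modulo p this is -(c - N + 1), and the size c of class l is at least N.\<close>
  moreover have "\<not> P dvd a + b + N - 1"
  proof
    assume "P dvd a + b + N - 1"
    then have "P dvd P - (a + b + N - 1)" by (rule dvd_diff[OF dvd_refl])
    then show False using not_dvd_small[of "P - (a + b + N - 1)"] sum ints unfolding N_def by linarith
  qed
  ultimately have U0: "P dvd U" using nd nd' unfolding Q_def dvd_mult_P by blast
  have cz: "\<not> P dvd x ^ m" if "\<not> P dvd x" for x m
    using that prime_P prime_dvd_power by blast
  show A: "hsym (cls k i) (n + 2) \<approx> 0"
    using U0 cz[OF good_coeffs(1)[OF g]] unfolding U_def dvd_mult_P eqm_0 by blast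
  show "hsym (cls k i) (n + 2) \<approx> 0 \<and> hsym (cls k l) (n + 2) \<approx> 0 \<or> \<not> hsym (cls k j) (n + 2) \<approx> 0"
  proof (cases "hsym (cls k j) (n + 2) \<approx> 0")
    case True
    then have "P dvd V" unfolding V_def eqm_0 by (rule dvd_mult)
    then have "P dvd U * ((b + N) * (b + N + 1) * h * z) + V * ((a - 2) * (a - 1) * e * z)"
      using U0 by (intro dvd_add dvd_mult2)
    then have "P dvd W * ((a - 2) * (a - 1) * e * ((b + N) * (b + N + 1) * h))"
      using E20[OF s(1,4,9)] dvd_add_right_iff by blast
    then have "P dvd W" using nd nd' unfolding dvd_mult_P by blast
    then have "hsym (cls k l) (n + 2) \<approx> 0"
      using cz[OF good_coeffs(3)[OF g]] unfolding W_def dvd_mult_P eqm_0 by blast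
    then show ?thesis using A by blast
  qed blast
qed

lemma high_moments_zero:
  assumes g: "good a1 a2 a3 0 k i j l" and n: "2 \<le> n"
    and size: "3 \<le> card (cls k i)" "3 \<le> card (cls k j)" "n \<le> card (cls k l)"
      "card (cls k i) + n + 1 < p" "card (cls k j) + n + 1 < p"
    and low: "\<And>s t u. s + t + u = n + 2 \<Longrightarrow> s < n + 2 \<Longrightarrow> t < n + 2 \<Longrightarrow> u < n + 2 \<Longrightarrow>
      hsym (cls k i) s \<approx> 0 \<or> hsym (cls k j) t \<approx> 0 \<or> hsym (cls k l) u \<approx> 0"
    and t: "t \<in> {i, j, l}"
  shows "hsym (cls k t) (n + 2) \<approx> 0"
proof -
  have low': "hsym (cls k j) s \<approx> 0 \<or> hsym (cls k i) t \<approx> 0 \<or> hsym (cls k l) u \<approx> 0"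
    if "s + t + u = n + 2" "s < n + 2" "t < n + 2" "u < n + 2" for s t u
    using low[of t s u] that by auto
  have "hsym (cls k i) (n + 2) \<approx> 0" by (rule high_moment_step(2)[OF g n size low])
  moreover have "hsym (cls k j) (n + 2) \<approx> 0"
    by (rule high_moment_step(2)[OF good_swap(3)[OF g] n size(2,1,3,5,4) low'])
  moreover have "hsym (cls k i) (n + 2) \<approx> 0 \<and> hsym (cls k l) (n + 2) \<approx> 0 \<or> \<not> hsym (cls k j) (n + 2) \<approx> 0"
    by (rule high_moment_step(1)[OF g n size low])
  ultimately show ?thesis using t by blast
qed

section \<open>Level 6 and the third moments\<close>

lemma inverse_quotient:
  assumes "X6 * i \<approx> 1" "X3 * j \<approx> 1" "X6 = X3 * X"
  shows "X * i \<approx> j"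
proof -
  have "X3 * (X * i) = X6 * i" using assms(3) by (simp only: mult.assoc)
  also have "\<dots> \<approx> 1" by (rule assms(1))
  also have "1 \<approx> X3 * j" by (rule eqm_sym[OF assms(2)])
  finally have *: "X3 * (X * i) \<approx> X3 * j" .
  have "\<not> P dvd X3"
  proof
    assume "P dvd X3"
    then have "P dvd X3 * j - (X3 * j - 1)"
      using assms(2) unfolding eqm_iff_dvd by (rule dvd_diff[OF dvd_mult2])
    then have "P dvd 1" by simp
    then show False using prime_P not_prime_unit by blast
  qed
  then show ?thesis using * eqm_mult_cancel by blast
qed

text \<open>The contribution of one class to a level equation after division by the rising
  factorials; it involves the index of that class only.\<close>

definition ratio3 :: "int \<Rightarrow> int set \<Rightarrow> nat \<Rightarrow> int"
  where "ratio3 e A i = e ^ 3 * hsym A 3 * inv_mod (pochhammer (int (card A) - int i) 3)"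

definition ratio6 :: "int \<Rightarrow> int set \<Rightarrow> nat \<Rightarrow> int"
  where "ratio6 e A i = e ^ 6 * hsym A 6 * inv_mod (pochhammer (int (card A) - int i) 6)"

text \<open>With the moments 1, 2, 4, 5 gone, the excess 6 splits only as 6 + 0 + 0 or 3 + 3 + 0.
  The products of two third moments are what can detect the parameter left free at level 3.\<close>

lemma level_six:
  assumes g: "good a1 a2 a3 0 k i j l"
    and size: "\<And>t. t \<in> {i, j, l} \<Longrightarrow> 3 \<le> card (cls k t)" "7 < p"
    and le: "i0 < card (cls k i)" "j0 < card (cls k j)" "k0 < card (cls k l)" and r: "i0 + j0 + k0 = 4"
    and low: "\<And>t s. t \<in> {i, j, l} \<Longrightarrow> s \<in> {1, 2, 4, 5} \<Longrightarrow> hsym (cls k t) s \<approx> 0"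
  shows "ratio6 a1 (cls k i) i0 + ratio6 a2 (cls k j) j0 + ratio6 a3 (cls k l) k0 +
    (ratio3 a1 (cls k i) i0 * ratio3 a2 (cls k j) j0 + ratio3 a1 (cls k i) i0 * ratio3 a3 (cls k l) k0 +
     ratio3 a2 (cls k j) j0 * ratio3 a3 (cls k l) k0) \<approx> 0"
proof -
  let ?A = "cls k i" and ?B = "cls k j" and ?C = "cls k l"
  define \<alpha> \<beta> \<gamma> where "\<alpha> = card ?A - 1 - i0" and "\<beta> = card ?B - 1 - j0" and "\<gamma> = card ?C - 1 - k0"
  have cA: "card ?A = Suc \<alpha> + i0" and cB: "card ?B = Suc \<beta> + j0" and cC: "card ?C = Suc \<gamma> + k0"
    using le unfolding \<alpha>_def \<beta>_def \<gamma>_def by linarith+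
  define x y z where "x = int (card ?A) - int i0" and "y = int (card ?B) - int j0" and "z = int (card ?C) - int k0"
  have eq: "int \<alpha> + 1 = x" "int \<beta> + 1 = y" "int \<gamma> + 1 = z"
    using cA cB cC unfolding x_def y_def z_def by linarith+
  have r': "6 = i0 + j0 + k0 + 2" "6 < p - 1" using r size(2) by linarith+
  have E: "excess_sum ?A ?B ?C a1 a2 a3 \<alpha> \<beta> \<gamma> 6 \<approx> 0"
  proof (rule level_equation[OF cls_props(1,2) cA cls_props(1,2) cB cls_props(1,2) cC good_card[OF g] good_coeffs[OF g] _ r'])
    fix x y z assume "x \<in> ?A" "y \<in> ?B" "z \<in> ?C"
    from good_avoid[OF g this] show "\<not> P dvd a1 * x + a2 * y + a3 * z" by simp
  qed
  let ?S = "SIGMA s:{..6::nat}. {..6 - s}"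
  let ?f = "\<lambda>(s, t). (a1 ^ s * pochhammer (int (\<alpha> + s) + 1) (6 - s) * hsym ?A s) *
      (a2 ^ t * pochhammer (int (\<beta> + t) + 1) (6 - t) * hsym ?B t) *
      (a3 ^ (6 - s - t) * pochhammer (int (\<gamma> + (6 - s - t)) + 1) (6 - (6 - s - t)) * hsym ?C (6 - s - t))"
  let ?T = "{(6, 0), (0, 6), (0, 0), (3, 3), (3, 0), (0, 3)} :: (nat \<times> nat) set"
  have "sum ?f ?S \<approx> sum ?f ?T"
  proof (rule eqm_sum_subset)
    fix v assume v: "v \<in> ?S - ?T"
    obtain s t where st: "v = (s, t)" by force
    define u where "u = 6 - s - t"
    have sum: "s + t + u = 6" using v st u_def by auto
    have "s \<in> {1, 2, 4, 5} \<or> t \<in> {1, 2, 4, 5} \<or> u \<in> {1, 2, 4, 5}"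
    proof (rule ccontr)
      assume n: "\<not> (s \<in> {1, 2, 4, 5} \<or> t \<in> {1, 2, 4, 5} \<or> u \<in> {1, 2, 4, 5})"
      have m: "w = 0 \<or> w = 3 \<or> w = 6" if "w \<le> 6" "w \<notin> {1, 2, 4, 5}" for w :: nat
        using that by auto
      have "s = 0 \<or> s = 3 \<or> s = 6" "t = 0 \<or> t = 3 \<or> t = 6" using m n sum by simp_all
      then show False using v st sum by auto
    qed
    moreover have "i \<in> {i, j, l}" "j \<in> {i, j, l}" "l \<in> {i, j, l}" by simp_all
    ultimately have "hsym ?A s \<approx> 0 \<or> hsym ?B t \<approx> 0 \<or> hsym ?C u \<approx> 0"
      using low[of i s] low[of j t] low[of l u] by argo
    then have "hsym ?A s \<approx> 0 \<or> hsym ?B t \<approx> 0 \<or> hsym ?C (6 - s - t) \<approx> 0" unfolding u_def .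
    then show "?f v \<approx> 0" unfolding st case_prod_conv by (simp only: eqm_mult_0) blast
  qed auto
  then have 0: "sum ?f ?T \<approx> 0" using E unfolding excess_sum_def using eqm_sym eqm_trans by blast
  define X6 Y6 Z6 where "X6 = pochhammer x 6" and "Y6 = pochhammer y 6" and "Z6 = pochhammer z 6"
  define X3 Y3 Z3 where "X3 = pochhammer (x + 3) 3" and "Y3 = pochhammer (y + 3) 3" and "Z3 = pochhammer (z + 3) 3"
  define UA UB UC where "UA = a1 ^ 6 * hsym ?A 6" and "UB = a2 ^ 6 * hsym ?B 6" and "UC = a3 ^ 6 * hsym ?C 6"
  define VA VB VC where "VA = a1 ^ 3 * hsym ?A 3" and "VB = a2 ^ 3 * hsym ?B 3" and "VC = a3 ^ 3 * hsym ?C 3"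
  have p6: "pochhammer (int (\<alpha> + 0) + 1) 6 = X6" "pochhammer (int (\<beta> + 0) + 1) 6 = Y6" "pochhammer (int (\<gamma> + 0) + 1) 6 = Z6"
    unfolding X6_def Y6_def Z6_def by (simp_all add: eq)
  have p3: "pochhammer (int (\<alpha> + 3) + 1) 3 = X3" "pochhammer (int (\<beta> + 3) + 1) 3 = Y3" "pochhammer (int (\<gamma> + 3) + 1) 3 = Z3"
    unfolding X3_def Y3_def Z3_def eq[symmetric] by (simp_all add: add_ac)
  have ar: "6 - (0::nat) = 6" "6 - (6::nat) = 0" "6 - (3::nat) = 3" "3 - (3::nat) = 0" "0 - (6::nat) = 0" "3 - 0 = (3::nat)" "0 - 0 = (0::nat)"
    by simp_all
  have sumT: "sum f ?T = f (6, 0) + (f (0, 6) + (f (0, 0) + (f (3, 3) + (f (3, 0) + f (0, 3)))))"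
    for f :: "nat \<times> nat \<Rightarrow> int" by simp
  have "sum ?f ?T = ?f (6, 0) + (?f (0, 6) + (?f (0, 0) + (?f (3, 3) + (?f (3, 0) + ?f (0, 3)))))"
    by (rule sumT)
  also have "\<dots> = UA * (Y6 * hsym ?B 0) * (Z6 * hsym ?C 0) + (UB * (X6 * hsym ?A 0) * (Z6 * hsym ?C 0) +
      (UC * (X6 * hsym ?A 0) * (Y6 * hsym ?B 0) +
      ((VA * X3) * (VB * Y3) * (Z6 * hsym ?C 0) + ((VA * X3) * (VC * Z3) * (Y6 * hsym ?B 0) +
       (VB * Y3) * (VC * Z3) * (X6 * hsym ?A 0)))))"
    unfolding case_prod_conv ar p6 p3 UA_def UB_def UC_def VA_def VB_def VC_def pochhammer_0 power_0
    by (simp only: mult_1_left mult_1_right mult_ac)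
  finally have S: "UA * (Y6 * hsym ?B 0) * (Z6 * hsym ?C 0) + (UB * (X6 * hsym ?A 0) * (Z6 * hsym ?C 0) +
      (UC * (X6 * hsym ?A 0) * (Y6 * hsym ?B 0) +
      ((VA * X3) * (VB * Y3) * (Z6 * hsym ?C 0) + ((VA * X3) * (VC * Z3) * (Y6 * hsym ?B 0) +
       (VB * Y3) * (VC * Z3) * (X6 * hsym ?A 0))))) \<approx> 0" (is "?W \<approx> 0") using 0 by (simp only:)
  define iX iY iZ where "iX = inv_mod X6" and "iY = inv_mod Y6" and "iZ = inv_mod Z6"
  have size': "card ?A + 6 \<le> p" "card ?B + 6 \<le> p" "card ?C + 6 \<le> p"
    using size(1)[of i] size(1)[of j] size(1)[of l] good_card[OF g] by simp_all
  \<comment> \<open>From (w)_6 = (w)_3 (w + 3)_3: the factor (w + 3)_3 attached to a third moment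
    cancels and leaves the denominator (w)_3 of \<open>ratio3\<close>.\<close>
  have inv6: "w6 * inv_mod w6 \<approx> 1" "pochhammer (w + 3) 3 * inv_mod w6 \<approx> inv_mod (pochhammer w 3)"
    if w: "w = int n - int m" "m < n" "n + 6 \<le> p" "w6 = pochhammer w 6" for w w6 and n m :: nat
  proof -
    have "\<not> P dvd pochhammer w 6" "\<not> P dvd pochhammer w 3"
      using w by (intro pochhammer_not_dvd; linarith)+
    then have 1: "pochhammer w 6 * inv_mod (pochhammer w 6) \<approx> 1" "pochhammer w 3 * inv_mod (pochhammer w 3) \<approx> 1"
      using inv_mod by blast+
    have 2: "pochhammer w 6 = pochhammer w 3 * pochhammer (w + 3) 3"
      using pochhammer_product'[of w 3 3] by simp
    show "w6 * inv_mod w6 \<approx> 1" using 1(1) w(4) by simp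
    show "pochhammer (w + 3) 3 * inv_mod w6 \<approx> inv_mod (pochhammer w 3)"
      using inverse_quotient[OF 1 2] w(4) by simp
  qed
  note xs = inv6[OF x_def le(1) size'(1) X6_def] and ys = inv6[OF y_def le(2) size'(2) Y6_def]
    and zs = inv6[OF z_def le(3) size'(3) Z6_def]
  have h0: "hsym ?A 0 \<approx> 1" "hsym ?B 0 \<approx> 1" "hsym ?C 0 \<approx> 1"
    by (rule hsym_0; use good_nonempty[OF g] in simp)+
  have one: "w * h * iw \<approx> 1" if "w * iw \<approx> 1" "h \<approx> 1" for w h iw
    using eqm_mult[OF that] by (simp add: mult_ac)
  have oX: "X6 * hsym ?A 0 * iX \<approx> 1" and oY: "Y6 * hsym ?B 0 * iY \<approx> 1" and oZ: "Z6 * hsym ?C 0 * iZ \<approx> 1"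
    unfolding iX_def iY_def iZ_def by (rule one[OF xs(1) h0(1)] one[OF ys(1) h0(2)] one[OF zs(1) h0(3)])+
  have fX: "VA * X3 * iX \<approx> ratio3 a1 ?A i0" and fY: "VB * Y3 * iY \<approx> ratio3 a2 ?B j0"
    and fZ: "VC * Z3 * iZ \<approx> ratio3 a3 ?C k0"
    unfolding ratio3_def VA_def VB_def VC_def X3_def Y3_def Z3_def iX_def iY_def iZ_def
      x_def[symmetric] y_def[symmetric] z_def[symmetric]
    unfolding mult.assoc[of _ "pochhammer _ _" "inv_mod _"]
    by (rule eqm_scalar_left xs(2) ys(2) zs(2))+
  have gX: "UA * iX = ratio6 a1 ?A i0" and gY: "UB * iY = ratio6 a2 ?B j0" and gZ: "UC * iZ = ratio6 a3 ?C k0"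
    unfolding ratio6_def UA_def UB_def UC_def iX_def iY_def iZ_def X6_def Y6_def Z6_def x_def y_def z_def by simp_all
  have "0 \<approx> ?W * (iX * iY * iZ)" using S unfolding eqm_mult_0[symmetric] by (metis eqm_mult_0 eqm_sym)
  also have "?W * (iX * iY * iZ) =
     UA * iX * (Y6 * hsym ?B 0 * iY) * (Z6 * hsym ?C 0 * iZ) + (UB * iY * (X6 * hsym ?A 0 * iX) * (Z6 * hsym ?C 0 * iZ) +
      (UC * iZ * (X6 * hsym ?A 0 * iX) * (Y6 * hsym ?B 0 * iY) +
      ((VA * X3 * iX) * (VB * Y3 * iY) * (Z6 * hsym ?C 0 * iZ) + ((VA * X3 * iX) * (VC * Z3 * iZ) * (Y6 * hsym ?B 0 * iY) +
       (VB * Y3 * iY) * (VC * Z3 * iZ) * (X6 * hsym ?A 0 * iX)))))"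
    by (simp only: distrib_right) (simp only: mult_ac)
  also have "\<dots> \<approx> UA * iX * 1 * 1 + (UB * iY * 1 * 1 + (UC * iZ * 1 * 1 +
      (ratio3 a1 ?A i0 * ratio3 a2 ?B j0 * 1 + (ratio3 a1 ?A i0 * ratio3 a3 ?C k0 * 1 +
       ratio3 a2 ?B j0 * ratio3 a3 ?C k0 * 1))))"
    by (intro eqm_add eqm_mult oX oY oZ fX fY fZ eqm_refl)
  finally show ?thesis unfolding gX gY gZ by (simp add: eqm_sym_eq add_ac)
qed

text \<open>The hypothesis puts the class on the solution line of level 3. For the indices 0 and 1
  the division leaves a polynomial in x; for index 2 a denominator x - 2 remains, and this is what
  makes the hexagon informative.\<close>

lemma ratio3_value:
  assumes V: "e ^ 3 * hsym A 3 \<approx> \<tau> * ((x - 1) * x * (x + 1) * (x + 2))"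
    and x: "x = int (card A)" "3 \<le> x" "x + 6 \<le> P"
  shows "ratio3 e A 0 \<approx> \<tau> * (x - 1)" "ratio3 e A 1 \<approx> \<tau> * (x + 2)"
    "(x - 2) * ratio3 e A 2 \<approx> \<tau> * ((x + 1) * (x + 2))"
proof -
  have po: "pochhammer y 3 = y * (y + 1) * (y + 2)" for y :: int
    by (simp add: numeral_3_eq_3 pochhammer_Suc)
  have inv: "pochhammer (x - int m) 3 * inv_mod (pochhammer (x - int m) 3) \<approx> 1" if "m \<le> 2" for m
    using x that by (intro inv_mod pochhammer_not_dvd) auto
  have gen: "c * ratio3 e A m \<approx> \<tau> * d"
    if m: "m \<le> 2" "c * ((x - 1) * x * (x + 1) * (x + 2)) = d * pochhammer (x - int m) 3" for c d m
  proof -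
    define I where "I = inv_mod (pochhammer (x - int m) 3)"
    have "c * ratio3 e A m = (c * I) * (e ^ 3 * hsym A 3)"
      unfolding ratio3_def I_def x(1) by (simp only: mult_ac)
    also have "\<dots> \<approx> (c * I) * (\<tau> * ((x - 1) * x * (x + 1) * (x + 2)))" by (rule eqm_scalar_left[OF V])
    also have "(c * I) * (\<tau> * ((x - 1) * x * (x + 1) * (x + 2))) = (\<tau> * I) * (c * ((x - 1) * x * (x + 1) * (x + 2)))"
      by (simp only: mult_ac)
    also have "\<dots> = (\<tau> * d) * (pochhammer (x - int m) 3 * I)" unfolding m(2) by (simp only: mult_ac)
    also have "\<dots> \<approx> (\<tau> * d) * 1" unfolding I_def by (rule eqm_scalar_left[OF inv[OF m(1)]])
    finally show ?thesis by simp
  qed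
  show "ratio3 e A 0 \<approx> \<tau> * (x - 1)" using gen[of 0 1 "x - 1"] unfolding po by simp
  show "ratio3 e A 1 \<approx> \<tau> * (x + 2)" using gen[of 1 1 "x + 2"] unfolding po by (simp add: algebra_simps)
  have "(x - 2) * ((x - 1) * x * (x + 1) * (x + 2)) = (x + 1) * (x + 2) * pochhammer (x - int 2) 3"
    unfolding po by (simp add: algebra_simps)
  from gen[OF _ this] show "(x - 2) * ratio3 e A 2 \<approx> \<tau> * ((x + 1) * (x + 2))" by simp
qed

lemma hexagon_sum:
  fixes FA FB FC A B C :: "nat \<Rightarrow> int"
  defines "E \<equiv> \<lambda>i j k. FA i + FB j + FC k + (A i * B j + A i * C k + B j * C k)"
  shows "E 2 0 2 - E 2 1 1 + E 1 2 1 - E 0 2 2 + E 0 1 3 - E 1 0 3 =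
    A 2 * (B 0 - B 1 + C 2 - C 1) + B 2 * (A 1 - A 0 + C 1 - C 2) + (A 0 * B 1 - A 1 * B 0) +
    (B 0 * C 2 - B 1 * C 1 + A 1 * C 1 - A 0 * C 2) + C 3 * (B 1 - B 0 + A 0 - A 1)"
  unfolding E_def by (simp add: algebra_simps)

text \<open>The six values of the level 6 equation around \<open>(1, 1, 2)\<close>, taken with alternating signs:
  every term depending on a single index cancels, so the sixth moments disappear.\<close>

lemma hexagon:
  assumes g: "good a1 a2 a3 0 k i j l"
    and size: "\<And>t. t \<in> {i, j, l} \<Longrightarrow> 3 \<le> card (cls k t)" "4 \<le> card (cls k l)"
    and low: "\<And>t s. t \<in> {i, j, l} \<Longrightarrow> s \<in> {1, 2} \<Longrightarrow> hsym (cls k t) s \<approx> 0"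
    and nz: "\<not> hsym (cls k i) 3 \<approx> 0"
  shows "card (cls k i) = card (cls k j)"
proof -
  let ?A = "cls k i" and ?B = "cls k j" and ?C = "cls k l"
  define a b c where "a = int (card ?A)" and "b = int (card ?B)" and "c = int (card ?C)"
  have sz: "3 \<le> card ?A" "3 \<le> card ?B" using size(1) by auto
  have sum: "a + b + c = P" using good_card[OF g] unfolding a_def b_def c_def by linarith
  have ints: "3 \<le> a" "3 \<le> b" "4 \<le> c" "a + 6 \<le> P" "b + 6 \<le> P" "c + 6 \<le> P" "10 \<le> P"
    using sz size(2) sum unfolding a_def b_def c_def by linarith+
  have p7: "7 < p" using ints by linarith
  have h4: "hsym (cls k t) 4 \<approx> 0" if "t \<in> {i, j, l}" for t
  proof -
    have "hsym (cls k t) (2 + 2) \<approx> 0"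
    proof (rule high_moments_zero[OF g _ sz _ _ _ _ that])
      fix s t u :: nat assume s: "s + t + u = 2 + 2" "s < 2 + 2" "t < 2 + 2" "u < 2 + 2"
      then have "s \<in> {1, 2} \<or> t \<in> {1, 2} \<or> u \<in> {1, 2}" by auto
      then show "hsym ?A s \<approx> 0 \<or> hsym ?B t \<approx> 0 \<or> hsym ?C u \<approx> 0" using low by blast
    qed (use size(2) ints a_def b_def in linarith)+
    then show ?thesis by simp
  qed
  have h5: "hsym (cls k t) 5 \<approx> 0" if "t \<in> {i, j, l}" for t
  proof -
    have "hsym (cls k t) (3 + 2) \<approx> 0"
    proof (rule high_moments_zero[OF g _ sz _ _ _ _ that])
      fix s t u :: nat assume s: "s + t + u = 3 + 2" "s < 3 + 2" "t < 3 + 2" "u < 3 + 2"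
      then have "s \<in> {1, 2, 4} \<or> t \<in> {1, 2, 4} \<or> u \<in> {1, 2, 4}" by auto
      then show "hsym ?A s \<approx> 0 \<or> hsym ?B t \<approx> 0 \<or> hsym ?C u \<approx> 0" using low h4 by blast
    qed (use size(2) ints a_def b_def in linarith)+
    then show ?thesis by simp
  qed
  have low6: "hsym (cls k t) s \<approx> 0" if "t \<in> {i, j, l}" "s \<in> {1, 2, 4, 5}" for t s
    using that low h4 h5 by blast
  define V where "V e A = e ^ 3 * hsym A 3" for e A
  define Q where "Q x = (x - 1) * x * (x + 1) * (x + 2)" for x :: int
  have low3: "hsym (cls k t) s \<approx> 0" if "t \<in> {i, j, l}" "1 \<le> s" "s < 3" for t s
  proof -
    have "s = 1 \<or> s = 2" using that(2,3) by linarith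
    then show ?thesis using low[OF that(1)] by blast
  qed
  have p5: "5 \<le> p" using p7 by linarith
  have rB: "V a1 ?A * Q b \<approx> V a2 ?B * Q a"
    unfolding V_def Q_def by (rule third_moment_ratio[OF g p5 low3 a_def b_def])
  have rC: "V a1 ?A * Q c \<approx> V a3 ?C * Q a"
    unfolding V_def Q_def
    by (rule third_moment_ratio[OF good_swap(4)[OF good_swap(2)[OF g]] p5 low3 a_def c_def]) auto
  have Qa: "\<not> P dvd Q a"
    unfolding Q_def dvd_mult_P using ints not_dvd_small[of "a - 1"] not_dvd_small[of a]
      not_dvd_small[of "a + 1"] not_dvd_small[of "a + 2"] by linarith
  \<comment> \<open>The common parameter of the level 3 solution line.\<close>
  define \<tau> where "\<tau> = V a1 ?A * inv_mod (Q a)"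
  have tau: "v \<approx> \<tau> * q" if "V a1 ?A * q \<approx> v * Q a" for v q
  proof -
    have "v = v * 1" by simp
    also have "\<dots> \<approx> v * (Q a * inv_mod (Q a))" by (rule eqm_scalar_left[OF eqm_sym[OF inv_mod[OF Qa]]])
    also have "v * (Q a * inv_mod (Q a)) = inv_mod (Q a) * (v * Q a)" by (simp only: mult_ac)
    also have "\<dots> \<approx> inv_mod (Q a) * (V a1 ?A * q)" by (rule eqm_scalar_left[OF eqm_sym[OF that]])
    also have "inv_mod (Q a) * (V a1 ?A * q) = \<tau> * q" unfolding \<tau>_def by (simp only: mult_ac)
    finally show ?thesis .
  qed
  have tA: "V a1 ?A \<approx> \<tau> * Q a" and tB: "V a2 ?B \<approx> \<tau> * Q b" and tC: "V a3 ?C \<approx> \<tau> * Q c"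
    using tau[of "Q a" "V a1 ?A"] tau[OF rB] tau[OF rC] by auto
  have ntau: "\<not> P dvd \<tau>"
  proof
    assume "P dvd \<tau>"
    then have "\<tau> * Q a \<approx> 0" by (simp add: eqm_0)
    then have "V a1 ?A \<approx> 0" using tA eqm_trans by blast
    then have "P dvd a1 ^ 3" using nz unfolding V_def eqm_0 dvd_mult_P by blast
    then show False using good_coeffs(1)[OF g] prime_P prime_dvd_power by blast
  qed
  note vA = ratio3_value[OF tA[unfolded V_def Q_def] a_def ints(1,4)]
  note vB = ratio3_value[OF tB[unfolded V_def Q_def] b_def ints(2,5)]
  have c3: "3 \<le> c" using ints by linarith
  note vC = ratio3_value[OF tC[unfolded V_def Q_def] c_def c3 ints(6)]
  define A B C where "A = ratio3 a1 ?A" and "B = ratio3 a2 ?B" and "C = ratio3 a3 ?C"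
  define H where "H = A 2 * (B 0 - B 1 + C 2 - C 1) + B 2 * (A 1 - A 0 + C 1 - C 2) + (A 0 * B 1 - A 1 * B 0) +
    (B 0 * C 2 - B 1 * C 1 + A 1 * C 1 - A 0 * C 2) + C 3 * (B 1 - B 0 + A 0 - A 1)"
  define E where "E i0 j0 k0 = ratio6 a1 ?A i0 + ratio6 a2 ?B j0 + ratio6 a3 ?C k0 +
    (A i0 * B j0 + A i0 * C k0 + B j0 * C k0)" for i0 j0 k0
  have E0: "P dvd E i0 j0 k0" if "i0 \<le> 2" "j0 \<le> 2" "k0 \<le> 3" "i0 + j0 + k0 = 4" for i0 j0 k0
    unfolding E_def A_def B_def C_def eqm_0[symmetric]
    by (rule level_six[OF g size(1) p7 _ _ _ that(4) low6]) (use that sz size(2) in linarith)+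
  have "P dvd E 2 0 2 - E 2 1 1 + E 1 2 1 - E 0 2 2 + E 0 1 3 - E 1 0 3"
    by (intro dvd_diff dvd_add E0) simp_all
  then have H: "P dvd H" unfolding E_def hexagon_sum H_def .
  \<comment> \<open>Passing from index 0 to index 1 adds 3 \<tau> to the ratio of every class, so
    the coefficient of \<open>C 3\<close> in H vanishes and that ratio is never evaluated. The rest
    of H then factors through D.\<close>
  define D where "D = C 2 - \<tau> * (c + 2) - 3 * \<tau>"
  have "H \<approx> A 2 * (\<tau> * (b - 1) - \<tau> * (b + 2) + C 2 - \<tau> * (c + 2)) +
    B 2 * (\<tau> * (a + 2) - \<tau> * (a - 1) + \<tau> * (c + 2) - C 2) +
    (\<tau> * (a - 1) * (\<tau> * (b + 2)) - \<tau> * (a + 2) * (\<tau> * (b - 1))) +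
    (\<tau> * (b - 1) * C 2 - \<tau> * (b + 2) * (\<tau> * (c + 2)) + \<tau> * (a + 2) * (\<tau> * (c + 2)) - \<tau> * (a - 1) * C 2) +
    C 3 * (\<tau> * (b + 2) - \<tau> * (b - 1) + \<tau> * (a - 1) - \<tau> * (a + 2))"
    unfolding H_def A_def B_def C_def
    by (intro eqm_add eqm_diff eqm_mult vA(1,2) vB(1,2) vC(1,2) eqm_refl)
  also have "\<dots> = D * ((A 2 - \<tau> * a) - (B 2 - \<tau> * b))"
    unfolding D_def by (simp add: algebra_simps)
  finally have HD: "P dvd D * ((A 2 - \<tau> * a) - (B 2 - \<tau> * b))"
    using H unfolding eqm_0[symmetric] using eqm_sym eqm_trans by blast
  \<comment> \<open>Indeed (c - 2) D = 12 \<tau>, since (c + 1) (c + 2) - (c + 5) (c - 2) =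
    12.\<close>
  have "\<not> P dvd D"
  proof
    assume "P dvd D"
    have "(c - 2) * D = (c - 2) * C 2 - \<tau> * ((c + 5) * (c - 2))" unfolding D_def by (simp add: algebra_simps)
    also have "\<dots> \<approx> \<tau> * ((c + 1) * (c + 2)) - \<tau> * ((c + 5) * (c - 2))"
      unfolding C_def by (intro eqm_diff vC(3) eqm_refl)
    also have "\<dots> = 12 * \<tau>" by (simp add: algebra_simps)
    finally have "(c - 2) * D \<approx> 12 * \<tau>" .
    moreover have "(c - 2) * D \<approx> 0" using \<open>P dvd D\<close> by (simp add: eqm_0)
    ultimately have "12 * \<tau> \<approx> 0" using eqm_sym eqm_trans by blast
    then have "2 * (2 * 3) * \<tau> \<approx> 0" by simp
    moreover have "\<not> P dvd 2" "\<not> P dvd 3" using ints by (intro not_dvd_small; linarith)+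
    ultimately show False using ntau unfolding eqm_0 dvd_mult_P by blast
  qed
  then have "A 2 - \<tau> * a \<approx> B 2 - \<tau> * b" using HD unfolding dvd_mult_P eqm_iff_dvd by blast
  then have 1: "(a - 2) * (b - 2) * (A 2 - \<tau> * a) \<approx> (a - 2) * (b - 2) * (B 2 - \<tau> * b)"
    by (rule eqm_scalar_left)
  \<comment> \<open>Here \<open>A 2 - \<tau> * a\<close> is \<tau> (5 a + 2) / (a - 2), a Moebius
    function of the size. It is injective: cross-multiplying the values for a and b leaves 12 \<tau>
    (b - a).\<close>
  have "(b - 2) * (\<tau> * ((a + 1) * (a + 2)) - \<tau> * (a * (a - 2))) \<approx> (b - 2) * ((a - 2) * A 2 - \<tau> * (a * (a - 2)))"
    unfolding A_def by (intro eqm_scalar_left eqm_diff eqm_refl eqm_sym[OF vA(3)])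
  also have "\<dots> = (a - 2) * (b - 2) * (A 2 - \<tau> * a)" by (simp add: algebra_simps)
  also note 1
  also have "(a - 2) * (b - 2) * (B 2 - \<tau> * b) = (a - 2) * ((b - 2) * B 2 - \<tau> * (b * (b - 2)))"
    by (simp add: algebra_simps)
  also have "\<dots> \<approx> (a - 2) * (\<tau> * ((b + 1) * (b + 2)) - \<tau> * (b * (b - 2)))"
    unfolding B_def by (intro eqm_scalar_left eqm_diff eqm_refl vB(3))
  finally have "P dvd (b - 2) * (\<tau> * ((a + 1) * (a + 2)) - \<tau> * (a * (a - 2))) -
      (a - 2) * (\<tau> * ((b + 1) * (b + 2)) - \<tau> * (b * (b - 2)))"
    by (simp add: eqm_iff_dvd)
  also have "(b - 2) * (\<tau> * ((a + 1) * (a + 2)) - \<tau> * (a * (a - 2))) -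
      (a - 2) * (\<tau> * ((b + 1) * (b + 2)) - \<tau> * (b * (b - 2))) = 2 * 2 * 3 * \<tau> * (b - a)"
    by (simp add: algebra_simps)
  finally have "P dvd 2 * 2 * 3 * \<tau> * (b - a)" .
  moreover have "\<not> P dvd 2" "\<not> P dvd 3" using ints by (intro not_dvd_small; linarith)+
  ultimately have "P dvd b - a" using ntau unfolding dvd_mult_P by blast
  moreover have "\<bar>b - a\<bar> < P" using ints sum by linarith
  ultimately have "b - a = 0" by (rule dvd_small)
  then show ?thesis unfolding a_def b_def by linarith
qed

end

lemma sum_cubes: "4 * (\<Sum>x\<in>{0..<int n}. x ^ 3) = (int n * (int n - 1))\<^sup>2"
proof (induction n)
  case (Suc n)
  have "{0..<int (Suc n)} = insert (int n) {0..<int n}" by auto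
  then have "(\<Sum>x\<in>{0..<int (Suc n)}. x ^ 3) = int n ^ 3 + (\<Sum>x\<in>{0..<int n}. x ^ 3)" by simp
  then have "4 * (\<Sum>x\<in>{0..<int (Suc n)}. x ^ 3) = 4 * int n ^ 3 + (int n * (int n - 1))\<^sup>2"
    using Suc by simp
  also have "\<dots> = (int (Suc n) * (int (Suc n) - 1))\<^sup>2"
    by (simp add: power2_eq_square power3_eq_cube algebra_simps)
  finally show ?case .
qed simp

context prime_modulus
begin

lemma third_moment_nonzero:
  assumes g: "good a1 a2 a3 0 k i j l" and p5: "5 \<le> p"
    and low: "\<And>t s. t \<in> {i, j, l} \<Longrightarrow> 1 \<le> s \<Longrightarrow> s < 3 \<Longrightarrow> hsym (cls k t) s \<approx> 0"
    and size: "3 \<le> card (cls k i)" "3 \<le> card (cls k j)" "3 \<le> card (cls k l)"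
    and nz: "\<not> hsym (cls k i) 3 \<approx> 0"
  shows "\<not> hsym (cls k j) 3 \<approx> 0"
proof
  assume "hsym (cls k j) 3 \<approx> 0"
  define a b where "a = int (card (cls k i))" and "b = int (card (cls k j))"
  have "a1 ^ 3 * hsym (cls k i) 3 * ((b - 1) * b * (b + 1) * (b + 2)) \<approx>
    a2 ^ 3 * hsym (cls k j) 3 * ((a - 1) * a * (a + 1) * (a + 2))"
    by (rule third_moment_ratio[OF g p5 low a_def b_def])
  moreover have "a2 ^ 3 * hsym (cls k j) 3 * ((a - 1) * a * (a + 1) * (a + 2)) \<approx> 0"
    using \<open>hsym (cls k j) 3 \<approx> 0\<close> by (simp add: eqm_0)
  ultimately have "P dvd a1 ^ 3 * hsym (cls k i) 3 * ((b - 1) * b * (b + 1) * (b + 2))"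
    using eqm_trans unfolding eqm_0[symmetric] by blast
  moreover have "\<not> P dvd b - 1" "\<not> P dvd b" "\<not> P dvd b + 1" "\<not> P dvd b + 2"
    using good_card[OF g] size unfolding b_def by (intro not_dvd_small; linarith)+
  moreover have "\<not> P dvd a1 ^ 3" using good_coeffs(1)[OF g] prime_P prime_dvd_power by blast
  ultimately show False using nz unfolding eqm_0 dvd_mult_P by blast
qed

text \<open>The hexagon puts index 3 on a class of size at least 4, so here it could only compare
  the two equal classes. Instead, (x - 1) x (x + 1) (x + 2) is 120 at x = 3 and 840 at x = p - 6, so
  the third moments are in proportion 1 : 1 : 7. By Newton's identity the vanishing sum of all cubes
  is three times their sum.\<close>

lemma three_three:
  assumes g: "good a1 a2 a3 0 k i j l" and p7: "7 < p"
    and low: "\<And>t s. t \<in> {i, j, l} \<Longrightarrow> 1 \<le> s \<Longrightarrow> s < 3 \<Longrightarrow> hsym (cls k t) s \<approx> 0"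
    and size: "card (cls k i) = 3" "card (cls k j) = 3" "3 \<le> card (cls k l)"
  shows "hsym (cls k i) 3 \<approx> 0"
proof (rule ccontr)
  assume nz: "\<not> hsym (cls k i) 3 \<approx> 0"
  let ?x = "hsym (cls k i) 3" and ?y = "hsym (cls k j) 3" and ?z = "hsym (cls k l) 3"
  have p5: "5 \<le> p" using p7 by simp
  have ny: "\<not> P dvd ?y"
    using third_moment_nonzero[OF g p5 low] size nz unfolding eqm_0 by simp
  have nd: "\<not> P dvd 2" "\<not> P dvd 3" "\<not> P dvd 5" using p7 by (intro not_dvd_small; linarith)+
  have n120: "\<not> P dvd 120" 
  proof -
    have "(120::int) = 2 * 2 * 2 * 3 * 5" by simp
    then show ?thesis using nd by (simp only: dvd_mult_P) simp
  qed
  have i3: "(3::int) = int (card (cls k i))" "(3::int) = int (card (cls k j))" using size by simp_all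
  have ij: "e1 ^ 3 * ?x \<approx> e2 ^ 3 * ?y" if h: "good e1 e2 e3 0 k i j l" for e1 e2 e3
  proof -
    have "e1 ^ 3 * ?x * ((3 - 1) * 3 * (3 + 1) * (3 + 2)) \<approx> e2 ^ 3 * ?y * ((3 - 1) * 3 * (3 + 1) * (3 + 2))"
      by (rule third_moment_ratio[OF h p5 low i3])
    then have "120 * (e1 ^ 3 * ?x) \<approx> 120 * (e2 ^ 3 * ?y)" by (simp add: mult_ac)
    then show ?thesis using eqm_mult_cancel[OF n120] by blast
  qed
  have cancel: "c \<approx> d" if "v \<approx> c * ?y" "v \<approx> d * ?y" for c d v
  proof -
    have "c * ?y \<approx> d * ?y" by (rule eqm_trans[OF eqm_sym[OF that(1)] that(2)])
    then have "?y * c \<approx> ?y * d" by (simp only: mult.commute)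
    then show ?thesis using eqm_mult_cancel[OF ny] by blast
  qed
  \<comment> \<open>Two orders of the coefficients give the same left-hand side in
    \<open>ij\<close>, so the cubes of the coefficients agree.\<close>
  have c23: "a2 ^ 3 \<approx> a3 ^ 3" by (rule cancel[OF ij[OF g] ij[OF good_perm(2)[OF g]]])
  have c13: "a1 ^ 3 \<approx> a3 ^ 3" by (rule cancel[OF ij[OF good_perm(1)[OF g]] ij[OF good_perm(3)[OF g]]])
  have n1: "\<not> P dvd a3 ^ 3" using good_coeffs(3)[OF g] prime_P prime_dvd_power by blast
  have xy: "?x \<approx> ?y"
  proof -
    have "a3 ^ 3 * ?x \<approx> a1 ^ 3 * ?x" by (rule eqm_scalar_right[OF eqm_sym[OF c13]])
    also have "\<dots> \<approx> a2 ^ 3 * ?y" by (rule ij[OF g])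
    also have "\<dots> \<approx> a3 ^ 3 * ?y" by (rule eqm_scalar_right[OF c23])
    finally show ?thesis using eqm_mult_cancel[OF n1] by blast
  qed
  define c where "c = int (card (cls k l))"
  have c: "c = P - 6" using good_card[OF g] size unfolding c_def by linarith
  have xz: "?x * 840 \<approx> 120 * ?z"
  proof -
    have g': "good a1 a3 a2 0 k i l j" using good_swap(4)[OF good_swap(2)[OF g]] .
    have "a1 ^ 3 * ?x * ((c - 1) * c * (c + 1) * (c + 2)) \<approx> a3 ^ 3 * ?z * ((3 - 1) * 3 * (3 + 1) * (3 + 2))"
      by (rule third_moment_ratio[OF g' p5 low i3(1) c_def]) auto
    moreover have "(c - 1) * c * (c + 1) * (c + 2) \<approx> 840"
    proof -
      have "(c - 1) * c * (c + 1) * (c + 2) - 840 = P * (P ^ 3 - 22 * P\<^sup>2 + 179 * P - 638)"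
        unfolding c by (simp add: power2_eq_square power3_eq_cube algebra_simps)
      then show ?thesis unfolding eqm_iff_dvd by simp
    qed
    then have "a3 ^ 3 * ?x * 840 \<approx> a1 ^ 3 * ?x * ((c - 1) * c * (c + 1) * (c + 2))"
      by (intro eqm_mult eqm_sym[OF c13] eqm_refl) (rule eqm_sym)
    ultimately have "a3 ^ 3 * ?x * 840 \<approx> a3 ^ 3 * ?z * ((3 - 1) * 3 * (3 + 1) * (3 + 2))"
      using eqm_trans by blast
    then have "a3 ^ 3 * (?x * 840) \<approx> a3 ^ 3 * (120 * ?z)" by (simp add: mult_ac)
    then show ?thesis using eqm_mult_cancel[OF n1] by blast
  qed
  have newton: "(\<Sum>x\<in>cls k t. x ^ 3) \<approx> int 3 * hsym (cls k t) 3" if "t \<in> {i, j, l}" for t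
    using that size by (intro newton_first low cls_props(1,2)) auto
  have "4 * (\<Sum>x\<in>{0..<P}. x ^ 3) \<approx> 0"
    unfolding sum_cubes by (simp add: eqm_0 power2_eq_square)
  then have "2 * 2 * (\<Sum>x\<in>{0..<P}. x ^ 3) \<approx> 0" by simp
  then have S: "(\<Sum>x\<in>{0..<P}. x ^ 3) \<approx> 0" using nd unfolding eqm_0 dvd_mult_P by blast
  have kk: "\<And>x. k x \<in> {i, j, l}" "i \<noteq> j" "i \<noteq> l" "j \<noteq> l" using g unfolding good_def by blast+
  have "3 * (?x + ?y + ?z) = int 3 * ?x + int 3 * ?y + int 3 * ?z" by simp
  also have "\<dots> \<approx> (\<Sum>x\<in>cls k i. x ^ 3) + (\<Sum>x\<in>cls k j. x ^ 3) + (\<Sum>x\<in>cls k l. x ^ 3)"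
    by (intro eqm_add eqm_sym[OF newton]) auto
  also have "\<dots> = (\<Sum>x\<in>{0..<P}. x ^ 3)" by (rule sum_cls[OF kk, symmetric])
  also note S
  finally have T: "?x + ?y + ?z \<approx> 0" using nd unfolding eqm_0 dvd_mult_P by blast
  have "1080 * ?x = 120 * ?x + 120 * ?x + ?x * 840" by simp
  also have "\<dots> \<approx> 120 * ?x + 120 * ?y + 120 * ?z"
    by (intro eqm_add eqm_scalar_left xy xz eqm_refl)
  also have "\<dots> = 120 * (?x + ?y + ?z)" by simp
  also have "\<dots> \<approx> 120 * 0" by (rule eqm_scalar_left[OF T])
  finally have "1080 * ?x \<approx> 0" by simp
  then have "2 * 2 * 2 * 3 * 3 * 3 * 5 * ?x \<approx> 0" by simp
  then show False using nd nz unfolding eqm_0 dvd_mult_P by blast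
qed

text \<open>A class of size at least 4 makes the other two equal in size (\<open>hexagon\<close>),
  and two classes of size 3 are excluded by \<open>three_three\<close>; so all sizes coincide, which
  a prime above 3 does not allow.\<close>

lemma third_moment_zero:
  assumes g: "good a1 a2 a3 0 k i j l"
    and low: "\<And>t s. t \<in> {i, j, l} \<Longrightarrow> 1 \<le> s \<Longrightarrow> s < 3 \<Longrightarrow> hsym (cls k t) s \<approx> 0"
    and size: "3 \<le> card (cls k i)" "3 \<le> card (cls k j)" "3 \<le> card (cls k l)"
  shows "hsym (cls k i) 3 \<approx> 0"
proof (rule ccontr)
  assume nz: "\<not> hsym (cls k i) 3 \<approx> 0"
  note cards = good_card[OF g]
  have p7: "7 < p" "5 \<le> p" using cards size by linarith+
  have no3: "p \<noteq> 3 * m" for m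
  proof
    assume "p = 3 * m"
    then have "3 dvd p" by simp
    then have "3 = (1::nat) \<or> 3 = p" using prime_p unfolding prime_nat_iff by blast
    then show False using p7 by linarith
  qed
  have gs: "good a1 a2 a3 0 k j i l" "good a1 a2 a3 0 k i l j" "good a1 a2 a3 0 k j l i"
    using good_swap(3,4) g by blast+
  have nzj: "\<not> hsym (cls k j) 3 \<approx> 0" by (rule third_moment_nonzero[OF g p7(2) low size nz])
  have low1: "hsym (cls k t) s \<approx> 0" if "t \<in> {i, j, l}" "s \<in> {1, 2}" for t s
    using low[OF that(1), of s] that(2) by auto
  have low2: "hsym (cls k t) s \<approx> 0" if "t \<in> {i, l, j}" "s \<in> {1, 2}" for t s
    using low1 that by blast
  have low3: "hsym (cls k t) s \<approx> 0" if "t \<in> {j, l, i}" "s \<in> {1, 2}" for t s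
    using low1 that by blast
  have A: "card (cls k i) = card (cls k j)" if "4 \<le> card (cls k l)"
    by (rule hexagon[OF g _ that low1 nz]) (use size in auto)
  have B: "card (cls k i) = card (cls k l)" if "4 \<le> card (cls k j)"
    by (rule hexagon[OF gs(2) _ that low2 nz]) (use size in auto)
  have C: "card (cls k j) = card (cls k l)" if "4 \<le> card (cls k i)"
    by (rule hexagon[OF gs(3) _ that low3 nzj]) (use size in auto)
  have low4: "hsym (cls k t) s \<approx> 0" if "t \<in> {i, l, j}" "1 \<le> s" "s < 3" for t s
    using low that by blast
  have low5: "hsym (cls k t) s \<approx> 0" if "t \<in> {j, l, i}" "1 \<le> s" "s < 3" for t s
    using low that by blast
  have D: "card (cls k i) \<noteq> 3 \<or> card (cls k j) \<noteq> 3"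
    using three_three[OF g p7(1) low _ _ size(3)] nz by blast
  have E: "card (cls k i) \<noteq> 3 \<or> card (cls k l) \<noteq> 3"
    using three_three[OF gs(2) p7(1) low4 _ _ size(2)] nz by blast
  have F: "card (cls k j) \<noteq> 3 \<or> card (cls k l) \<noteq> 3"
    using three_three[OF gs(3) p7(1) low5 _ _ size(1)] nzj by blast
  have "card (cls k i) = card (cls k j) \<and> card (cls k i) = card (cls k l)"
    using A B C D E F size by linarith
  then have "p = 3 * card (cls k i)" using cards by linarith
  then show False using no3 by blast
qed

text \<open>Sorting by size gives every level up to the smallest size the room it needs: class l can
  carry the index r - 4, and no rising factorial reaches p. Levels 1, 2 and 3 have arguments of
  their own; from 4 on the linear system is uniform.\<close>

lemma no_good_sorted:
  assumes g: "good a1 a2 a3 0 k i j l" and p3: "p > 3"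
    and ne: "\<not> (a1\<^sup>2 \<approx> a2\<^sup>2 \<and> a2\<^sup>2 \<approx> a3\<^sup>2)"
    and mean: "\<And>t. t \<in> {i, j, l} \<Longrightarrow> \<Sum>(cls k t) \<approx> 0"
    and le: "card (cls k i) \<le> card (cls k j)" "card (cls k j) \<le> card (cls k l)"
  shows False
proof -
  note cards = good_card[OF g]
  have gs: "good a1 a2 a3 0 k j i l" "good a1 a2 a3 0 k l i j"
    using good_swap(3,4) g by blast+
  have sw: "{i, j, l} = {j, i, l}" "{i, j, l} = {l, i, j}" by auto
  have zero: "\<forall>t\<in>{i, j, l}. hsym (cls k t) r \<approx> 0" if "1 \<le> r" "r \<le> card (cls k i)" for r
    using that
  proof (induction r rule: less_induct)
    case (less r)
    consider "r = 1" | "r = 2" | "r = 3" | "4 \<le> r" using less.prems by linarith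
    then show ?case
    proof cases
      case 1
      then show ?thesis using hsym_1[OF g] hsym_1[OF gs(1)] hsym_1[OF gs(2)] mean by auto
    next
      case 2
      have "hsym (cls k i) 2 \<approx> 0" by (rule second_moment_zero[OF g p3 ne mean])
      moreover have "hsym (cls k j) 2 \<approx> 0"
        by (rule second_moment_zero[OF gs(1) p3 ne mean[unfolded sw(1)]])
      moreover have "hsym (cls k l) 2 \<approx> 0"
        by (rule second_moment_zero[OF gs(2) p3 ne mean[unfolded sw(2)]])
      ultimately show ?thesis using 2 by blast
    next
      case 3
      have low: "hsym (cls k t) s \<approx> 0" if "t \<in> {i, j, l}" "1 \<le> s" "s < 3" for t s
        using less.IH[of s] less.prems that 3 by (meson less_or_eq_imp_le order_trans)
      have size: "3 \<le> card (cls k i)" "3 \<le> card (cls k j)" "3 \<le> card (cls k l)"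
        using less.prems le 3 by linarith+
      have "hsym (cls k i) 3 \<approx> 0" by (rule third_moment_zero[OF g low size])
      moreover have "hsym (cls k j) 3 \<approx> 0"
        by (rule third_moment_zero[OF gs(1) low[unfolded sw(1)] size(2,1,3)])
      moreover have "hsym (cls k l) 3 \<approx> 0"
        by (rule third_moment_zero[OF gs(2) low[unfolded sw(2)] size(3,1,2)])
      ultimately show ?thesis using 3 by blast
    next
      case 4
      define n where "n = r - 2"
      have n: "r = n + 2" "2 \<le> n" using 4 unfolding n_def by linarith+
      have low: "hsym (cls k t) s \<approx> 0" if "t \<in> {i, j, l}" "1 \<le> s" "s < r" for t s
        using less.IH[of s] less.prems that by (meson less_or_eq_imp_le order_trans)
      have "hsym (cls k t) (n + 2) \<approx> 0" if t: "t \<in> {i, j, l}" for t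
      proof (rule high_moments_zero[OF g n(2) _ _ _ _ _ _ t])
        show "3 \<le> card (cls k i)" "3 \<le> card (cls k j)" "n \<le> card (cls k l)"
          "card (cls k i) + n + 1 < p" "card (cls k j) + n + 1 < p"
          using less.prems le 4 cards n by linarith+
        fix s t u :: nat assume s: "s + t + u = n + 2" "s < n + 2" "t < n + 2" "u < n + 2"
        then have "1 \<le> s \<or> 1 \<le> t" by linarith
        then show "hsym (cls k i) s \<approx> 0 \<or> hsym (cls k j) t \<approx> 0 \<or> hsym (cls k l) u \<approx> 0"
          using low[of i s] low[of j t] s n by blast
      qed
      then show ?thesis unfolding n(1) by blast
    qed
  qed
  have "x = 0" if x: "x \<in> cls k i" for x
  proof -
    have "P dvd x"
      by (rule hsym_zero_imp_zero[OF cls_props(1,2) _ x]) (use zero in blast)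
    moreover have "\<bar>x\<bar> < P" using cls_props(3) x by fastforce
    ultimately show ?thesis by (rule dvd_small)
  qed
  then have "cls k i \<subseteq> {0}" by blast
  then have "card (cls k i) \<le> 1" using card_mono[of "{0::int}" "cls k i"] by simp
  then show False using good_card_ge(1)[OF g] by linarith
qed

lemma no_good:
  assumes g: "good a1 a2 a3 b k i j l" and p3: "p > 3"
    and ne: "\<not> (a1\<^sup>2 \<approx> a2\<^sup>2 \<and> a2\<^sup>2 \<approx> a3\<^sup>2)"
  shows False
proof -
  have ne': "\<not> (a1 \<approx> a2 \<and> a2 \<approx> a3)" using ne eqm_pow by blast
  obtain m where mean: "\<And>t. t \<in> {i, j, l} \<Longrightarrow> \<Sum>(cls (\<lambda>x. k (x + m)) t) \<approx> 0"
    and g1: "good a1 a2 a3 (b - m * (a1 + a2 + a3)) (\<lambda>x. k (x + m)) i j l"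
    using center[OF g ne'] by blast
  define k' where "k' = (\<lambda>x. k (x + m))"
  have mean': "\<And>t. t \<in> {i, j, l} \<Longrightarrow> \<Sum>(cls k' t) \<approx> 0" using mean unfolding k'_def .
  have g2: "good a1 a2 a3 0 k' i j l"
    using good_shift_b[OF g1[folded k'_def] inhomogeneity_zero[OF g1[folded k'_def] p3 ne mean']] .
  have *: False if h: "good a1 a2 a3 0 k' x y z" and s: "{x, y, z} = {i, j, l}"
    and le: "card (cls k' x) \<le> card (cls k' y)" "card (cls k' y) \<le> card (cls k' z)" for x y z
    using no_good_sorted[OF h p3 ne _ le] mean' s by blast
  have gs: "good a1 a2 a3 0 k' j i l" "good a1 a2 a3 0 k' i l j" "good a1 a2 a3 0 k' j l i"
    "good a1 a2 a3 0 k' l i j" "good a1 a2 a3 0 k' l j i"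
    using good_swap(3,4) g2 by blast+
  have s: "{j, i, l} = {i, j, l}" "{i, l, j} = {i, j, l}" "{j, l, i} = {i, j, l}" "{l, i, j} = {i, j, l}" "{l, j, i} = {i, j, l}"
    by auto
  show False
    using *[OF g2 refl] *[OF gs(1) s(1)] *[OF gs(2) s(2)] *[OF gs(3) s(3)] *[OF gs(4) s(4)] *[OF gs(5) s(5)]
    by linarith
qed

end

section \<open>Two coefficients equal up to sign: Gallai colourings\<close>

text \<open>Gallai's theorem, with connectedness phrased through cuts. In the step a vertex \<open>v\<close> is
  removed: the components of the disconnected colour \<open>c\<close> see each other uniformly, and \<open>v\<close> is
  joined to each of them by an edge of colour \<open>c\<close>.\<close>

lemma gallai_disconnected_color:
  fixes f :: "'v \<Rightarrow> 'v \<Rightarrow> 'c"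
  assumes "finite V" "2 \<le> card V"
    and sym: "\<And>u v. f u v = f v u"
    and ij: "i \<noteq> j" "i \<noteq> l" "j \<noteq> l"
    and gallai: "\<And>u v w. u \<noteq> v \<Longrightarrow> v \<noteq> w \<Longrightarrow> u \<noteq> w \<Longrightarrow> f u v = f v w \<or> f v w = f u w \<or> f u v = f u w"
  shows "\<exists>c\<in>{i, j, l}. \<exists>S. S \<noteq> {} \<and> S \<subset> V \<and> (\<forall>u\<in>S. \<forall>v\<in>V - S. f u v \<noteq> c)"
  using assms(1,2)
proof (induction V rule: finite_induct)
  case empty
  then show ?case by simp
next
  case (insert v W)
  show ?case
  proof (cases "card W \<le> 1")
    case True
    then have "card W = 1" using insert by simp
    then obtain w where W: "W = {w}" using card_1_singletonE by blast
    obtain c where c: "c \<in> {i, j, l}" "f v w \<noteq> c" using ij by blast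
    have "{v} \<noteq> {} \<and> {v} \<subset> insert v W \<and> (\<forall>u\<in>{v}. \<forall>x\<in>insert v W - {v}. f u x \<noteq> c)"
      using W c insert by auto
    then show ?thesis using c by blast
  next
    case False
    then have "2 \<le> card W" by simp
    from insert.IH[OF this] obtain c S where c: "c \<in> {i, j, l}"
      and S': "S \<noteq> {} \<and> S \<subset> W \<and> (\<forall>u\<in>S. \<forall>v\<in>W - S. f u v \<noteq> c)"
      by blast
    have S: "S \<noteq> {}" "S \<subset> W" "\<And>u v. u \<in> S \<Longrightarrow> v \<in> W - S \<Longrightarrow> f u v \<noteq> c" using S' by blast+
    show ?thesis
    proof (rule ccontr)
      assume n: "\<not> ?thesis"
      have conn: "\<exists>x\<in>T. \<exists>y\<in>insert v W - T. f x y = d"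
        if d: "d \<in> {i, j, l}" and T: "T \<noteq> {}" "T \<subset> insert v W" for d T
      proof (rule ccontr)
        assume "\<not> (\<exists>x\<in>T. \<exists>y\<in>insert v W - T. f x y = d)"
        then have "\<forall>x\<in>T. \<forall>y\<in>insert v W - T. f x y \<noteq> d" by blast
        then have "\<exists>S. S \<noteq> {} \<and> S \<subset> insert v W \<and> (\<forall>u\<in>S. \<forall>v\<in>insert v W - S. f u v \<noteq> d)"
          using T by (intro exI[of _ T]) (intro conjI)
        then show False by (rule notE[OF n bexI[OF _ d]])
      qed
      \<comment> \<open>The components of colour c in W are the classes of the reflexive transitive
        closure of E.\<close>
      define E where "E = {(x, y). x \<in> W \<and> y \<in> W \<and> x \<noteq> y \<and> f x y = c}"
      have "sym E" unfolding E_def sym_def using sym by auto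
      then have symE: "(y, x) \<in> E\<^sup>*" if "(x, y) \<in> E\<^sup>*" for x y
        using that sym_rtrancl unfolding sym_def by blast
      have inW: "y \<in> W" if "(x, y) \<in> E\<^sup>*" "x \<in> W" for x y
        using that by (induction rule: rtrancl_induct) (auto simp: E_def)
      have notc: "f x y \<noteq> c" if "(x, y) \<notin> E\<^sup>*" "x \<in> W" "y \<in> W" for x y
        using that unfolding E_def by blast
      have uniform: "f u x = f u y" if "(x, y) \<in> E\<^sup>*" "(x, u) \<notin> E\<^sup>*" "x \<in> W" "u \<in> W" for x y u
        using that(1)
      proof (induction rule: rtrancl_induct)
        case (step y z)
        have yz: "y \<in> W" "z \<in> W" "y \<noteq> z" "f y z = c" using step(2) unfolding E_def by auto
        have n: "(y, u) \<notin> E\<^sup>*" "(z, u) \<notin> E\<^sup>*"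
          using that(2) step(1,2) by (meson rtrancl_trans r_into_rtrancl)+
        then have "f y u \<noteq> c" "f z u \<noteq> c" "y \<noteq> u" "z \<noteq> u" using notc yz that(4) by auto
        then have "f u y = f u z" using gallai[of u y z] yz sym by metis
        then show ?case using step.IH by simp
      qed simp
      have hub: "\<exists>x. (u, x) \<in> E\<^sup>* \<and> f v x = c" if u: "u \<in> W" for u
      proof -
        define T where "T = {x. (u, x) \<in> E\<^sup>*}"
        have T: "T \<subseteq> W" "u \<in> T" unfolding T_def using inW u by auto
        then obtain x y where xy: "x \<in> T" "y \<in> insert v W - T" "f x y = c"
          using conn[OF c, of T] insert.hyps(2) by blast
        have "y = v"
        proof (rule ccontr)
          assume "y \<noteq> v"
          then have "(x, y) \<in> E" using xy T unfolding E_def by auto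
          then have "y \<in> T" using xy(1) unfolding T_def by (simp add: rtrancl.rtrancl_into_rtrancl)
          then show False using xy(2) by blast
        qed
        then show ?thesis using xy sym unfolding T_def by auto
      qed
      \<comment> \<open>The component of u contains a hub x that v sees in colour c, so the triangle
        v, x, w forces the colour d on x w; uniformity carries it from x to u.\<close>
      have spread: "f u w = d" if w: "w \<in> W" "f v w = d" "d \<noteq> c" and u: "u \<in> W" "(u, w) \<notin> E\<^sup>*" for u w d
      proof -
        obtain x where x: "(u, x) \<in> E\<^sup>*" "f v x = c" using hub[OF u(1)] by blast
        have xW: "x \<in> W" using inW x u by blast
        have xw: "(x, w) \<notin> E\<^sup>*" using u(2) x(1) rtrancl_trans by metis
        then have "f x w \<noteq> c" "x \<noteq> w" using notc xW w by auto
        moreover have "x \<noteq> v" "w \<noteq> v" using xW w insert.hyps(2) by auto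
        ultimately have "f x w = d" using gallai[of v x w] w x by metis
        moreover have "f w x = f w u" by (rule uniform[OF symE[OF x(1)] xw xW w(1)])
        ultimately show ?thesis using sym by metis
      qed
      have ex: "\<exists>w\<in>W. f v w = d" if "d \<in> {i, j, l}" for d
      proof -
        have "W \<noteq> {}" using S by blast
        then have "{v} \<subset> insert v W" using insert.hyps(2) by auto
        then show ?thesis using conn[OF that, of "{v}"] by auto
      qed
      \<comment> \<open>Both colours other than c occur at v. If their endpoints lie in different
        components, the edge between these gets two colours; if in the same one, an outside vertex
        would see it in two colours.\<close>
      obtain d e where de: "d \<in> {i, j, l}" "e \<in> {i, j, l}" "d \<noteq> c" "e \<noteq> c" "d \<noteq> e" using c ij by blast
      obtain w w' where w: "w \<in> W" "f v w = d" "w' \<in> W" "f v w' = e" using ex de by blast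
      show False
      proof (cases "(w, w') \<in> E\<^sup>*")
        case False
        then have "f w' w = d" "f w w' = e" using spread w de symE by blast+
        then show False using sym de by metis
      next
        case True
        \<comment> \<open>The cut S from the induction hypothesis guarantees a second
          component.\<close>
        have "\<exists>u\<in>W. (u, w) \<notin> E\<^sup>*"
        proof (rule ccontr)
          assume "\<not> ?thesis"
          then have all: "(w, u) \<in> E\<^sup>*" if "u \<in> W" for u using that symE by blast
          obtain a where a: "a \<in> S" using S by blast
          have closed: "x \<in> S" if "(a, x) \<in> E\<^sup>*" for x
            using that by (induction rule: rtrancl_induct) (use a S(3) in \<open>auto simp: E_def\<close>)
          obtain b where b: "b \<in> W" "b \<notin> S" using S by blast
          have "a \<in> W" using a S by blast
          then have "(a, b) \<in> E\<^sup>*" using all symE b rtrancl_trans by metis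
          then show False using closed b by blast
        qed
        then obtain u where u: "u \<in> W" "(u, w) \<notin> E\<^sup>*" by blast
        then have u': "(u, w') \<notin> E\<^sup>*" using True symE rtrancl_trans by metis
        have "f u w = f u w'" by (rule uniform[OF True _ w(1) u(1)]) (use u symE in blast)
        then show False using spread[OF w(1,2) de(3) u] spread[OF w(3,4) de(4) u(1) u'] de(5) by simp
      qed
    qed
  qed
qed

context prime_modulus
begin

section \<open>Schur colourings modulo p\<close>

lemma periodic_eqm: "periodic k \<Longrightarrow> x \<approx> y \<Longrightarrow> k x = k y"
  unfolding periodic_def eqm_def cong_def by metis

text \<open>A nonzero residue generates the additive group modulo p, so a property stable under
  adding it spreads everywhere.\<close>

lemma orbit_all:
  assumes step: "\<And>z. Q z \<Longrightarrow> Q (z + x)" and base: "Q z" and x: "\<not> P dvd x"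
    and per: "\<And>u v. u \<approx> v \<Longrightarrow> Q u \<Longrightarrow> Q v"
  shows "Q w"
proof -
  have n: "Q (z + int n * x)" for n
  proof (induction n)
    case (Suc n)
    have "z + int (Suc n) * x = (z + int n * x) + x" by (simp add: algebra_simps)
    then show ?case using step[OF Suc] by (simp only:)
  qed (use base in simp)
  obtain e where e: "x * e \<approx> 1" using ex_inverse x by blast
  define n where "n = nat (((w - z) * e) mod P)"
  have "int n = ((w - z) * e) mod P" unfolding n_def using P_pos by simp
  then have "int n \<approx> (w - z) * e" by (simp add: eqm_def cong_def)
  then have "z + x * int n \<approx> z + x * ((w - z) * e)" by (intro eqm_add eqm_scalar_left eqm_refl)
  also have "z + x * ((w - z) * e) = z + (w - z) * (x * e)" by simp
  also have "\<dots> \<approx> z + (w - z) * 1" by (intro eqm_add eqm_scalar_left e eqm_refl)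
  finally have "z + int n * x \<approx> w" by (simp add: mult.commute)
  then show ?thesis using n per by blast
qed

text \<open>Colouring the edge u v by \<open>k (u - v)\<close> turns Schur triples into triangles.
  Gallai's theorem supplies a cut avoiding some colour c, but a nonzero x of colour c lets one walk
  from S to every residue without leaving S.\<close>

lemma no_schur_coloring:
  assumes per: "periodic k"
    and k: "\<And>x. k x \<in> {i, j, l}" "i \<noteq> j" "i \<noteq> l" "j \<noteq> l"
    and schur: "\<And>x y. k x = k y \<or> k y = k (x + y) \<or> k x = k (x + y)"
    and ex: "\<And>c. c \<in> {i, j, l} \<Longrightarrow> \<exists>x. \<not> P dvd x \<and> k x = c"
  shows False
proof -
  have symm: "k (- x) = k x" for x
  proof (rule ccontr)
    assume ne: "k (- x) \<noteq> k x"
    obtain c where c: "c \<in> {i, j, l}" "c \<noteq> k x" "c \<noteq> k (- x)"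
      using k(2-4) by (metis insertCI)
    obtain z where z: "k z = c" using ex c by blast
    have "\<not> P dvd x"
    proof
      assume "P dvd x"
      then have "P dvd - x - x" by (metis dvd_diff dvd_minus_iff)
      then show False using ne periodic_eqm[OF per] unfolding eqm_iff_dvd by blast
    qed
    \<comment> \<open>The sum x + w = (w + x) allows only c or \<open>k x\<close>, and (- x) + (w +
      x) = w allows only c or \<open>k (- x)\<close>; these two differ.\<close>
    moreover have "k (w + x) = c" if "k w = c" for w
      using schur[of x w] schur[of "- x" "w + x"] that c ne by (simp add: add.commute) metis
    ultimately have "k x = c"
      using orbit_all[of "\<lambda>w. k w = c" x z x] z periodic_eqm[OF per] by simp
    then show False using c by simp
  qed
  let ?V = "{0..<P}" and ?f = "\<lambda>u v. k (u - v)"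
  have "\<exists>c\<in>{i, j, l}. \<exists>S. S \<noteq> {} \<and> S \<subset> ?V \<and> (\<forall>u\<in>S. \<forall>v\<in>?V - S. ?f u v \<noteq> c)"
  proof (rule gallai_disconnected_color)
    show "2 \<le> card ?V" using prime_ge_2_nat[OF prime_p] by simp
    show "k (u - v) = k (v - u)" for u v using symm[of "u - v"] by simp
    show "k (u - v) = k (v - w) \<or> k (v - w) = k (u - w) \<or> k (u - v) = k (u - w)" for u v w
      using schur[of "u - v" "v - w"] by simp
  qed (use k in auto)
  then obtain c S where c: "c \<in> {i, j, l}" and S: "S \<noteq> {}" "S \<subset> ?V"
    and cut: "\<And>u v. u \<in> S \<Longrightarrow> v \<in> ?V - S \<Longrightarrow> k (u - v) \<noteq> c" by blast
  obtain x where x: "\<not> P dvd x" "k x = c" using ex c by blast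
  obtain z where z: "z \<in> S" using S by blast
  have "w mod P \<in> S" for w
  proof (rule orbit_all[of "\<lambda>w. w mod P \<in> S" x z])
    fix y assume y: "y mod P \<in> S"
    have "y mod P - (y + x) mod P \<approx> y - (y + x)"
      by (intro eqm_diff) (simp_all add: eqm_def cong_def)
    then have "k (y mod P - (y + x) mod P) = k (- x)" using periodic_eqm[OF per] by simp
    then have "k (y mod P - (y + x) mod P) = c" using symm x by simp
    then have "(y + x) mod P \<notin> ?V - S" using cut[OF y] by blast
    then show "(y + x) mod P \<in> S" using P_pos by simp
  qed (use z S x in \<open>auto simp: eqm_def cong_def\<close>)
  then have "?V \<subseteq> S" by (metis atLeastLessThan_iff mod_pos_pos_trivial subsetI)
  then show False using S by blast
qed

lemma rainbow_free_cong:
  assumes "rainbow_free a1 a2 a3 b k" "a1 \<approx> c1" "a2 \<approx> c2" "a3 \<approx> c3" "b \<approx> d"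
  shows "rainbow_free c1 c2 c3 d k"
  unfolding rainbow_free_def
proof (intro allI impI)
  fix x y z assume "P dvd c1 * x + c2 * y + c3 * z - d"
  then have "c1 * x + c2 * y + c3 * z - d \<approx> 0" by (simp add: eqm_0)
  moreover have "a1 * x + a2 * y + a3 * z - b \<approx> c1 * x + c2 * y + c3 * z - d"
    by (intro eqm_add eqm_diff eqm_scalar_right assms)
  ultimately have "a1 * x + a2 * y + a3 * z - b \<approx> 0" using eqm_trans by blast
  then show "k x = k y \<or> k y = k z \<or> k x = k z"
    using assms(1) unfolding rainbow_free_def eqm_0 by blast
qed

lemma no_good_schur:
  assumes g: "good a1 a2 a3 b k i j l" and eq: "a1 \<approx> a2" "a3 \<approx> - a1"
  shows False
proof -
  have a1: "\<not> P dvd a1" by (rule good_coeffs(1)[OF g])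
  have per: "periodic k" using g unfolding good_def by blast
  obtain e where e: "a1 * e \<approx> 1" using ex_inverse a1 by blast
  \<comment> \<open>The coefficients sum to a1 here, so translating by b / a1 removes the right-hand
    side.\<close>
  define m where "m = e * b"
  have m: "m * a1 \<approx> b"
  proof -
    have "m * a1 = (a1 * e) * b" unfolding m_def by simp
    also have "\<dots> \<approx> 1 * b" by (rule eqm_scalar_right[OF e])
    finally show ?thesis by simp
  qed
  have rf0: "rainbow_free a1 a2 a3 b k" using g unfolding good_def by blast
  have "rainbow_free a1 a1 (- a1) (m * a1) k"
    by (rule rainbow_free_cong[OF rf0 eqm_refl eqm_sym[OF eq(1)] eq(2) eqm_sym[OF m]])
  from translate_rainbow_free[OF this, of m]
  have rf: "rainbow_free a1 a1 (- a1) 0 (\<lambda>x. k (x + m))" by simp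
  let ?k = "\<lambda>x. k (x + m)"
  show False
  proof (rule no_schur_coloring[of ?k i j l])
    show "periodic ?k" by (rule translate_periodic[OF per])
    show "?k x \<in> {i, j, l}" for x using g unfolding good_def by blast
    show "i \<noteq> j" "i \<noteq> l" "j \<noteq> l" using g unfolding good_def by blast+
    show "?k x = ?k y \<or> ?k y = ?k (x + y) \<or> ?k x = ?k (x + y)" for x y
    proof -
      have "P dvd a1 * x + a1 * y + - a1 * (x + y) - 0" by (simp add: algebra_simps)
      then show ?thesis using rf unfolding rainbow_free_def by blast
    qed
    fix c assume "c \<in> {i, j, l}"
    then have "2 \<le> card (cls k c)" using good_card_ge[OF g] by auto
    then have 2: "2 \<le> card (cls ?k c)" using translate_card[OF per] by simp
    have "\<not> cls ?k c \<subseteq> {0}" using 2 card_mono[of "{0::int}" "cls ?k c"] by auto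
    then obtain x where x: "x \<in> cls ?k c" "x \<noteq> 0" by blast
    then have "\<not> P dvd x" unfolding cls_def by (intro not_dvd_small) auto
    then show "\<exists>x. \<not> P dvd x \<and> ?k x = c" using x unfolding cls_def by blast
  qed
qed

theorem no_large_classes:
  assumes g: "good a1 a2 a3 b k i j l" and p3: "p > 3" and ne: "\<not> (a1 \<approx> a2 \<and> a2 \<approx> a3)"
  shows False
proof (cases "a1\<^sup>2 \<approx> a2\<^sup>2 \<and> a2\<^sup>2 \<approx> a3\<^sup>2")
  case False
  then show ?thesis using no_good[OF g p3] by blast
next
  case True
  have pm: "x \<approx> y \<or> x \<approx> - y" if "x\<^sup>2 \<approx> y\<^sup>2" for x y
  proof -
    have "P dvd (x - y) * (x - (- y))"
      using that unfolding eqm_iff_dvd by (simp add: power2_eq_square algebra_simps)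
    then show ?thesis unfolding eqm_iff_dvd dvd_mult_P .
  qed
  have neg: "x \<approx> - y" if "y \<approx> - x" for x y
    using that unfolding eqm_iff_dvd by (simp add: add.commute)
  have nn: "x \<approx> z" if "x \<approx> - y" "z \<approx> - y" for x y z
    using that eqm_sym eqm_trans by blast
  \<comment> \<open>In each remaining sign pattern two coefficients agree and the third is their
    negative.\<close>
  consider "a1 \<approx> a2" "a2 \<approx> - a3" | "a1 \<approx> - a2" "a2 \<approx> a3" | "a1 \<approx> - a2" "a2 \<approx> - a3"
    using pm True ne by blast
  then show ?thesis
  proof cases
    case 1
    have "a3 \<approx> - a1" by (rule neg[OF eqm_trans[OF 1]])
    then show ?thesis using no_good_schur[OF g] 1 by blast
  next
    case 2
    then show ?thesis using no_good_schur[OF good_perm(3)[OF g]] by blast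
  next
    case 3
    have "a1 \<approx> a3" by (rule nn[OF 3(1) neg[OF 3(2)]])
    then show ?thesis using no_good_schur[OF good_perm(2)[OF g]] neg[OF 3(1)] by blast
  qed
qed

section \<open>Singleton colour classes\<close>

lemma rainbow_free_perm:
  assumes "rainbow_free a1 a2 a3 b k"
  shows "rainbow_free a2 a1 a3 b k" "rainbow_free a1 a3 a2 b k" "rainbow_free a2 a3 a1 b k"
    "rainbow_free a3 a1 a2 b k" "rainbow_free a3 a2 a1 b k"
  using rainbow_free_swap12 rainbow_free_swap23 assms by blast+

text \<open>The colour i occurs at 0 only, so a solution with 0 in the first place cannot be rainbow
  unless its other entries differ in colour.\<close>

lemma pair_same:
  assumes rf: "rainbow_free a1 a2 a3 b k" and zero: "\<And>x. k x = i \<longleftrightarrow> P dvd x"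
    and "\<not> P dvd x" "\<not> P dvd y" "a2 * x + a3 * y \<approx> b"
  shows "k x = k y"
proof -
  have "P dvd a1 * 0 + a2 * x + a3 * y - b" using assms(5) by (simp add: eqm_iff_dvd)
  then have "k 0 = k x \<or> k x = k y \<or> k 0 = k y" using rf unfolding rainbow_free_def by blast
  moreover have "k 0 = i" "k x \<noteq> i" "k y \<noteq> i" using zero assms(3,4) by auto
  ultimately show ?thesis by metis
qed

text \<open>Off the origin the colouring is invariant under multiplication by \<open>a2 / a1\<close>; the one
  missing step \<open>x \<mapsto> (a2 / a1) * x\<close> of this multiplication is bridged by the rest of its cycle.
  Combined with the reflections of \<open>pair_same\<close> this makes it invariant under a translation.\<close>

lemma singleton_origin_aux:
  assumes rf: "rainbow_free a1 a2 a3 b k" and per: "periodic k"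
    and zero: "\<And>x. k x = i \<longleftrightarrow> P dvd x"
    and coeffs: "\<not> P dvd a1" "\<not> P dvd a2" "\<not> P dvd a3" and ne: "\<not> a1 \<approx> a2" and b: "\<not> P dvd b"
    and u: "\<not> P dvd u" and v: "\<not> P dvd v"
  shows "k u = k v"
proof -
  obtain e1 e2 e3 where e: "a1 * e1 \<approx> 1" "a2 * e2 \<approx> 1" "a3 * e3 \<approx> 1"
    using ex_inverse coeffs by metis
  have inv: "a * (c * w) \<approx> w" if "a * c \<approx> 1" for a c w
    using eqm_scalar_right[OF that, of w] by (simp add: mult.assoc)
  have unit: "\<not> P dvd w" if "c * w \<approx> d" "\<not> P dvd d" for c w d
  proof
    assume "P dvd w"
    then have "c * w \<approx> 0" by (simp add: eqm_0)
    then have "d \<approx> 0" using that(1) eqm_sym eqm_trans by blast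
    then show False using that(2) by (simp add: eqm_0)
  qed
  define t s where "t = e1 * a2" and "s = e2 * a1"
  have t: "a1 * t \<approx> a2" unfolding t_def by (rule inv[OF e(1)])
  have t0: "\<not> P dvd t" by (rule unit[OF t coeffs(2)])
  have ts: "t * s \<approx> 1"
  proof -
    have "t * s = (a1 * e1) * (a2 * e2)" unfolding t_def s_def by simp
    also have "\<dots> \<approx> 1 * 1" by (rule eqm_mult[OF e(1,2)])
    finally show ?thesis by simp
  qed
  note F1 = pair_same[OF rf zero] and F2 = pair_same[OF rainbow_free_perm(1)[OF rf] zero]
  \<comment> \<open>The same z is the partner of x with 0 in the first place and of
    \<open>t * x\<close> with 0 in the second. It is 0 itself exactly when a2 x = b.\<close>
  have step: "k (t * x) = k x" if x: "\<not> P dvd x" "\<not> a2 * x \<approx> b" for x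
  proof -
    define z where "z = e3 * (b - a2 * x)"
    have z: "a3 * z \<approx> b - a2 * x" unfolding z_def by (rule inv[OF e(3)])
    have "\<not> P dvd - (a2 * x - b)" using x(2) unfolding eqm_iff_dvd by (simp only: dvd_minus_iff) simp
    then have z0: "\<not> P dvd z" by (intro unit[OF z]) simp
    have tx: "\<not> P dvd t * x" using t0 x(1) unfolding dvd_mult_P by blast
    have "a2 * x + a3 * z \<approx> a2 * x + (b - a2 * x)" by (intro eqm_add z eqm_refl)
    then have 1: "k x = k z" by (intro F1[OF x(1) z0]) simp
    have "a1 * (t * x) + a3 * z = (a1 * t) * x + a3 * z" by simp
    also have "\<dots> \<approx> a2 * x + (b - a2 * x)" by (intro eqm_add z eqm_scalar_right t)
    finally have "k (t * x) = k z" by (intro F2[OF tx z0]) simp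
    then show ?thesis using 1 by simp
  qed
  have tinv: "k (t * x) = k x" if x: "\<not> P dvd x" for x
  proof (cases "a2 * x \<approx> b")
    case False
    then show ?thesis using step x by blast
  next
    case True
    \<comment> \<open>An early return of the walk to x, when the order of t is below p - 1, falls
      under the left disjunct.\<close>
    have "k x = k (t * x) \<or> k (t ^ n * (t * x)) = k (t * x)" for n
    proof (induction n)
      case (Suc n)
      show ?case
      proof (cases "k x = k (t * x)")
        case ne: False
        define w where "w = t ^ n * (t * x)"
        have w: "k w = k (t * x)" using Suc ne unfolding w_def by blast
        have "\<not> P dvd t ^ n" using t0 prime_P prime_dvd_power by blast
        then have w0: "\<not> P dvd w" unfolding w_def dvd_mult_P using t0 x by blast
        have "\<not> a2 * w \<approx> b"
        proof
          assume "a2 * w \<approx> b"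
          then have "a2 * w \<approx> a2 * x" using True eqm_sym eqm_trans by blast
          then have "w \<approx> x" using eqm_mult_cancel coeffs(2) by blast
          then have "k w = k x" by (rule periodic_eqm[OF per])
          then show False using w ne by simp
        qed
        then have "k (t * w) = k w" using step w0 by blast
        moreover have "t ^ Suc n * (t * x) = t * w" unfolding w_def by simp
        ultimately show ?thesis using w by (intro disjI2) (simp only:)
      qed simp
    qed simp
    then have *: "k x = k (t * x) \<or> k (t ^ (p - 2) * (t * x)) = k (t * x)" .
    have "Suc (p - 2) = p - 1" using prime_ge_2_nat[OF prime_p] by simp
    then have "t ^ (p - 2) * (t * x) = t ^ (p - 1) * x" by (metis mult.assoc mult.commute power_Suc)
    also have "\<dots> \<approx> 1 * x" using fermat_int[OF prime_p t0] unfolding eqm_def by (rule cong_scalar_right)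
    finally have "k (t ^ (p - 2) * (t * x)) = k x" using periodic_eqm[OF per] by simp
    then show ?thesis using * by simp
  qed
  \<comment> \<open>Two reflections compose to a translation: z = w / t goes to y by a2 y + a3 z =
    b, and \<open>t * y\<close> goes to w - h by a2 (t y) + a3 (w - h) = b. Solving for h gives a3 h
    = (t - 1) b.\<close>
  define h where "h = e3 * ((t - 1) * b)"
  have h: "a3 * h \<approx> (t - 1) * b" unfolding h_def by (rule inv[OF e(3)])
  have "\<not> P dvd t - 1"
  proof
    assume "P dvd t - 1"
    then have "t \<approx> 1" by (simp add: eqm_iff_dvd)
    then have "a1 * t \<approx> a1 * 1" by (rule eqm_scalar_left)
    then have "a1 \<approx> a2" using eqm_trans[OF eqm_sym t] by simp
    then show False using ne by blast
  qed
  then have h0: "\<not> P dvd h" by (intro unit[OF h]) (simp add: dvd_mult_P b)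
  have shift: "k w = k (w - h)" if w: "\<not> P dvd w" "\<not> P dvd w - h" for w
  proof -
    define z where "z = s * w"
    have tz: "t * z \<approx> w" unfolding z_def by (rule inv[OF ts])
    have z0: "\<not> P dvd z" by (rule unit[OF tz w(1)])
    have kz: "k w = k z" using periodic_eqm[OF per tz] tinv[OF z0] by simp
    define y where "y = e2 * (b - a3 * z)"
    have y: "a2 * y \<approx> b - a3 * z" unfolding y_def by (rule inv[OF e(2)])
    have wh: "a3 * (w - h) \<approx> t * (a3 * z) - (t - 1) * b"
    proof -
      have "a3 * (w - h) = a3 * w - a3 * h" by (simp add: algebra_simps)
      also have "\<dots> \<approx> a3 * (t * z) - (t - 1) * b"
        by (intro eqm_diff eqm_scalar_left eqm_sym[OF tz] h)
      also have "\<dots> = t * (a3 * z) - (t - 1) * b" by simp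
      finally show ?thesis .
    qed
    show ?thesis
    proof (cases "P dvd y")
      case False
      have "a2 * y + a3 * z \<approx> b - a3 * z + a3 * z" by (intro eqm_add y eqm_refl)
      then have yz: "k y = k z" by (intro F1[OF False z0]) simp
      have ty: "\<not> P dvd t * y" using t0 False unfolding dvd_mult_P by blast
      have "a2 * (t * y) + a3 * (w - h) = t * (a2 * y) + a3 * (w - h)" by simp
      also have "\<dots> \<approx> t * (b - a3 * z) + (t * (a3 * z) - (t - 1) * b)"
        by (intro eqm_add eqm_scalar_left y wh)
      also have "\<dots> = b" by (simp add: algebra_simps)
      finally have "k (t * y) = k (w - h)" by (intro F1[OF ty w(2)])
      then show ?thesis using yz kz tinv[OF False] by simp
    next
      \<comment> \<open>For y = 0 the reflection says nothing, but then a3 z = b and w - h is z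
        itself.\<close>
      case True
      then have "a2 * y \<approx> 0" by (simp add: eqm_0)
      then have "b - a3 * z \<approx> 0" using y eqm_sym eqm_trans by blast
      then have bz: "a3 * z \<approx> b" unfolding eqm_iff_dvd by (metis diff_0_right dvd_minus_iff minus_diff_eq)
      have "a3 * (w - h) \<approx> t * b - (t - 1) * b"
        by (rule eqm_trans[OF wh]) (intro eqm_diff eqm_scalar_left bz eqm_refl)
      also have "t * b - (t - 1) * b = b" by (simp add: algebra_simps)
      also have "b \<approx> a3 * z" by (rule eqm_sym[OF bz])
      finally have "w - h \<approx> z" using eqm_mult_cancel[OF coeffs(3)] by blast
      then show ?thesis using periodic_eqm[OF per] kz by simp
    qed
  qed
  \<comment> \<open>The walk h, 2 h, ..., (p - 1) h avoids 0 and meets every nonzero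
    residue.\<close>
  have mult: "k (int n * h) = k h" if "1 \<le> n" "n < p" for n
    using that
  proof (induction n rule: nat_induct_at_least)
    case (Suc n)
    have "\<not> P dvd int (Suc n)" "\<not> P dvd int n" using Suc by (intro not_dvd_small; linarith)+
    then have "\<not> P dvd int (Suc n) * h" "\<not> P dvd int n * h" using h0 unfolding dvd_mult_P by blast+
    moreover have "int (Suc n) * h - h = int n * h" by (simp add: algebra_simps)
    ultimately have "k (int (Suc n) * h) = k (int n * h)" using shift[of "int (Suc n) * h"] by simp
    then show ?case using Suc by simp
  qed simp
  have "k w = k h" if w: "\<not> P dvd w" for w
  proof -
    obtain f where f: "h * f \<approx> 1" using ex_inverse h0 by blast
    define n where "n = nat ((f * w) mod P)"
    have n: "int n = (f * w) mod P" unfolding n_def using P_pos by simp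
    then have "int n \<approx> f * w" by (simp add: eqm_def cong_def)
    then have "h * int n \<approx> h * (f * w)" by (rule eqm_scalar_left)
    also have "\<dots> \<approx> w" by (rule inv[OF f])
    finally have hn: "int n * h \<approx> w" by (simp only: mult.commute)
    have "\<not> P dvd int n"
      using unit[of h "int n" w] hn w by (simp add: mult.commute)
    then have "n \<noteq> 0" by (cases "n = 0") simp_all
    moreover have "int n < P" using n P_pos by simp
    ultimately have "k (int n * h) = k h" by (intro mult) linarith+
    then show ?thesis using periodic_eqm[OF per hn] by simp
  qed
  then show ?thesis using u v by simp
qed

lemma singleton_origin:
  assumes rf: "rainbow_free a1 a2 a3 b k" and per: "periodic k"
    and zero: "\<And>x. k x = i \<longleftrightarrow> P dvd x"
    and coeffs: "\<not> P dvd a1" "\<not> P dvd a2" "\<not> P dvd a3" and ne: "\<not> (a1 \<approx> a2 \<and> a2 \<approx> a3)"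
    and uv: "\<not> P dvd u" "\<not> P dvd v" "k u \<noteq> k v"
  shows "P dvd b"
proof (rule ccontr)
  assume b: "\<not> P dvd b"
  consider "\<not> a1 \<approx> a2" | "\<not> a2 \<approx> a3" using ne by blast
  then show False
  proof cases
    case 1
    then show False using singleton_origin_aux[OF rf per zero coeffs 1 b uv(1,2)] uv(3) by blast
  next
    case 2
    then show False
      using singleton_origin_aux[OF rainbow_free_perm(3)[OF rf] per zero coeffs(2,3,1) 2 b uv(1,2)] uv(3)
      by blast
  qed
qed

text \<open>With s moved to the origin, \<open>singleton_origin\<close> says that the shifted
  right-hand side is zero. This is the second claim, and \<open>pair_same\<close> for right-hand
  side 0 is then the third.\<close>

lemma singleton_class:
  assumes rf: "rainbow_free a1 a2 a3 b k" and per: "periodic k"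
    and s: "cls k i = {s}"
    and coeffs: "\<not> P dvd a1" "\<not> P dvd a2" "\<not> P dvd a3" and ne: "\<not> (a1 \<approx> a2 \<and> a2 \<approx> a3)"
    and uv: "k u \<noteq> i" "k v \<noteq> i" "k u \<noteq> k v"
  shows "k x = i \<longleftrightarrow> x \<approx> s"
    "s * (a1 + a2 + a3) \<approx> b"
    "\<not> P dvd x \<Longrightarrow> a2 * x + a3 * y \<approx> 0 \<Longrightarrow> k (x + s) = k (y + s)"
proof -
  have cls: "k x = i \<longleftrightarrow> x \<approx> s" for x
  proof -
    have "x mod P \<in> {0..<P}" using P_pos by simp
    then have "x mod P \<in> cls k i \<longleftrightarrow> k x = i" using per unfolding cls_def periodic_def by simp
    moreover have "s mod P = s" using s unfolding cls_def by (metis (no_types, lifting) atLeastLessThan_iff insertI1 mem_Collect_eq mod_pos_pos_trivial)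
    ultimately show ?thesis unfolding s eqm_def cong_def by auto
  qed
  then show "k x = i \<longleftrightarrow> x \<approx> s" .
  define k' where "k' = (\<lambda>x. k (x + s))"
  have rf': "rainbow_free a1 a2 a3 (b - s * (a1 + a2 + a3)) k'"
    unfolding k'_def by (rule translate_rainbow_free[OF rf])
  have per': "periodic k'" unfolding k'_def by (rule translate_periodic[OF per])
  have zero: "k' x = i \<longleftrightarrow> P dvd x" for x
    unfolding k'_def cls eqm_iff_dvd by simp
  have "P dvd b - s * (a1 + a2 + a3)"
  proof (rule singleton_origin[OF rf' per' zero coeffs ne])
    show "\<not> P dvd u - s" "\<not> P dvd v - s" using uv cls unfolding eqm_iff_dvd by auto
    show "k' (u - s) \<noteq> k' (v - s)" using uv unfolding k'_def by simp
  qed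
  then show sb: "s * (a1 + a2 + a3) \<approx> b" using eqm_sym unfolding eqm_iff_dvd[of b] by (simp add: eqm_sym eqm_iff_dvd[of b])
  have rf0: "rainbow_free a1 a2 a3 0 k'"
    by (rule rainbow_free_cong[OF rf']) (auto simp: eqm_iff_dvd \<open>P dvd b - s * (a1 + a2 + a3)\<close>)
  show "k (x + s) = k (y + s)" if "\<not> P dvd x" "a2 * x + a3 * y \<approx> 0"
  proof -
    have "\<not> P dvd y"
    proof
      assume "P dvd y"
      then have "P dvd a2 * x + a3 * y - a3 * y" using that(2) unfolding eqm_0 by (rule_tac dvd_diff) auto
      then show False using that(1) coeffs(2) by (simp add: dvd_mult_P)
    qed
    then show ?thesis using pair_same[OF rf0 zero that(1) _ that(2)] unfolding k'_def by blast
  qed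
qed

section \<open>Number of singleton classes\<close>

lemma three_colors_singleton:
  assumes rf: "rainbow_free a1 a2 a3 b k" and per: "periodic k" and p3: "p > 3"
    and k: "\<And>x. k x \<in> {i, j, l}" "i \<noteq> j" "i \<noteq> l" "j \<noteq> l"
    and nonempty: "cls k i \<noteq> {}" "cls k j \<noteq> {}" "cls k l \<noteq> {}"
    and coeffs: "\<not> P dvd a1" "\<not> P dvd a2" "\<not> P dvd a3" and ne: "\<not> (a1 \<approx> a2 \<and> a2 \<approx> a3)"
  shows "card (cls k i) = 1 \<or> card (cls k j) = 1 \<or> card (cls k l) = 1"
proof (rule ccontr)
  assume n: "\<not> ?thesis"
  have pos: "0 < card (cls k i)" "0 < card (cls k j)" "0 < card (cls k l)"
    using nonempty by (simp_all add: card_gt_0_iff)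
  then have "2 \<le> card (cls k i)" "2 \<le> card (cls k j)" "2 \<le> card (cls k l)"
    using n by linarith+
  then have "good a1 a2 a3 b k i j l" unfolding good_def using rf per k coeffs by blast
  then show False using no_large_classes p3 ne by blast
qed

text \<open>Seen from s, the other singleton must be fixed by multiplication by every ratio - e2 /
  e3, so any two coefficients are opposite; three pairwise opposite ones give 2 a1 = 0.\<close>

lemma no_two_singletons:
  assumes rf: "rainbow_free a1 a2 a3 b k" and per: "periodic k" and p3: "p > 3"
    and ij: "i \<noteq> j" "card (cls k i) = 1" "card (cls k j) = 1" and w: "k w \<noteq> i" "k w \<noteq> j"
    and coeffs: "\<not> P dvd a1" "\<not> P dvd a2" "\<not> P dvd a3" and ne: "\<not> (a1 \<approx> a2 \<and> a2 \<approx> a3)"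
  shows False
proof -
  obtain s where s: "cls k i = {s}" using ij(2) card_1_singletonE by blast
  obtain r where r: "cls k j = {r}" using ij(3) card_1_singletonE by blast
  have kr: "k r = j" and ks: "k s = i" using r s unfolding cls_def by blast+
  define x where "x = r - s"
  have uvw: "k r \<noteq> i" "k w \<noteq> i" "k r \<noteq> k w" "k s \<noteq> j" "k w \<noteq> j" "k s \<noteq> k w" using kr ks ij w by auto
  have x: "\<not> P dvd x"
    unfolding x_def eqm_iff_dvd[symmetric] using periodic_eqm[OF per, of r s] kr ks ij(1) by auto
  have opposite: "e2 \<approx> - e3"
    if f: "rainbow_free e1 e2 e3 b k" "\<not> P dvd e1" "\<not> P dvd e2" "\<not> P dvd e3" "\<not> (e1 \<approx> e2 \<and> e2 \<approx> e3)" for e1 e2 e3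
  proof -
    obtain c where c: "e3 * c \<approx> 1" using ex_inverse f(4) by blast
    define y where "y = c * (- (e2 * x))"
    have "e3 * y = (e3 * c) * (- (e2 * x))" unfolding y_def by simp
    also have "\<dots> \<approx> 1 * (- (e2 * x))" by (rule eqm_scalar_right[OF c])
    finally have y: "e3 * y \<approx> - (e2 * x)" by simp
    have "e2 * x + e3 * y \<approx> e2 * x + - (e2 * x)" by (intro eqm_add eqm_refl y)
    then have xy: "e2 * x + e3 * y \<approx> 0" by simp
    have "k (x + s) = k (y + s)"
      by (rule singleton_class(3)[OF f(1) per s f(2-5) uvw(1-3) x xy])
    then have "k (y + s) = j" using kr unfolding x_def by simp
    moreover have "k (y + s) = j \<longleftrightarrow> y + s \<approx> r"
      by (rule singleton_class(1)[OF f(1) per r f(2-5) uvw(4-6)])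
    ultimately have "y \<approx> x" unfolding x_def eqm_iff_dvd by (simp add: algebra_simps)
    then have "e2 * x + e3 * y \<approx> e2 * x + e3 * x" by (intro eqm_add eqm_refl eqm_scalar_left)
    then have "(e2 + e3) * x \<approx> 0" using xy eqm_sym eqm_trans by (metis distrib_right)
    then have "P dvd e2 + e3" using x unfolding eqm_0 dvd_mult_P by blast
    then show ?thesis unfolding eqm_iff_dvd by simp
  qed
  have ne': "\<not> (a2 \<approx> a1 \<and> a1 \<approx> a3)" "\<not> (a3 \<approx> a1 \<and> a1 \<approx> a2)" using ne eqm_sym eqm_trans by blast+
  have o: "a2 \<approx> - a3" "a1 \<approx> - a3" "a1 \<approx> - a2"
    using opposite[OF rf coeffs ne] opposite[OF rainbow_free_perm(1)[OF rf] coeffs(2,1,3) ne'(1)]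
      opposite[OF rainbow_free_perm(4)[OF rf] coeffs(3,1,2) ne'(2)] by blast+
  have "P dvd (a1 - - a3) + (a1 - - a2) - (a2 - - a3)"
    by (rule dvd_diff[OF dvd_add[OF o(2)[unfolded eqm_iff_dvd] o(3)[unfolded eqm_iff_dvd]] o(1)[unfolded eqm_iff_dvd]])
  then have "P dvd 2 * a1" by simp
  moreover have "\<not> P dvd 2" using p3 by (intro not_dvd_small) auto
  ultimately show False using coeffs(1) unfolding dvd_mult_P by blast
qed

lemma rainbow_free_merge:
  "rainbow_free a1 a2 a3 b k \<Longrightarrow> rainbow_free a1 a2 a3 b (\<lambda>x. f (k x))"
  unfolding rainbow_free_def by metis

text \<open>Merging c3 and c4 leaves three colours, and the merged class is too large to be the
  singleton that must exist.\<close>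

lemma four_colors_pair:
  assumes rf: "rainbow_free a1 a2 a3 b k" and per: "periodic k" and p3: "p > 3"
    and k: "\<And>x. k x \<in> {c1, c2, c3, c4}" and dist: "distinct [c1, c2, c3, c4]"
    and nonempty: "\<And>c. c \<in> {c1, c2, c3, c4} \<Longrightarrow> cls k c \<noteq> {}"
    and coeffs: "\<not> P dvd a1" "\<not> P dvd a2" "\<not> P dvd a3" and ne: "\<not> (a1 \<approx> a2 \<and> a2 \<approx> a3)"
  shows "card (cls k c1) = 1 \<longleftrightarrow> card (cls k c2) \<noteq> 1"
proof -
  define k' where "k' = (\<lambda>x. if k x = c3 then c4 else k x)"
  have rf': "rainbow_free a1 a2 a3 b k'" unfolding k'_def by (rule rainbow_free_merge[OF rf])
  have per': "periodic k'" using per unfolding k'_def periodic_def by simp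
  have same: "cls k' c1 = cls k c1" "cls k' c2 = cls k c2"
    using dist unfolding cls_def k'_def by auto
  have merged: "cls k' c4 = cls k c3 \<union> cls k c4" unfolding cls_def k'_def by auto
  have k': "k' x \<in> {c1, c2, c4}" for x using k[of x] unfolding k'_def by auto
  have ne3: "cls k c3 \<noteq> {}" "cls k c4 \<noteq> {}" using nonempty by auto
  have "card (cls k' c4) = card (cls k c3) + card (cls k c4)"
  proof -
    have "cls k c3 \<inter> cls k c4 = {}" using dist unfolding cls_def by auto
    then show ?thesis unfolding merged by (intro card_Un_disjoint cls_props)
  qed
  moreover have "0 < card (cls k c3)" "0 < card (cls k c4)" using ne3 by (simp_all add: card_gt_0_iff)
  ultimately have big: "card (cls k' c4) \<noteq> 1" by linarith
  obtain w where w: "k w = c4" using ne3 unfolding cls_def by blast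
  have "k' w \<noteq> c1" "k' w \<noteq> c2" using w dist unfolding k'_def by auto
  then have "\<not> (card (cls k' c1) = 1 \<and> card (cls k' c2) = 1)"
    using no_two_singletons[OF rf' per' p3 _ _ _ _ _ coeffs ne, of c1 c2 w] dist by auto
  moreover have "card (cls k' c1) = 1 \<or> card (cls k' c2) = 1 \<or> card (cls k' c4) = 1"
    using dist nonempty by (intro three_colors_singleton[OF rf' per' p3 k' _ _ _ _ _ _ coeffs ne]) (auto simp: same merged)
  ultimately show ?thesis using big unfolding same by blast
qed

text \<open>Being a singleton would be a truth value that differs between any two of c1, c2,
  c3.\<close>

lemma no_four_coloring:
  assumes rf: "rainbow_free a1 a2 a3 b k" and per: "periodic k" and p3: "p > 3"
    and k: "\<And>x. k x \<in> {c1, c2, c3, c4}" and dist: "distinct [c1, c2, c3, c4]"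
    and nonempty: "\<And>c. c \<in> {c1, c2, c3, c4} \<Longrightarrow> cls k c \<noteq> {}"
    and coeffs: "\<not> P dvd a1" "\<not> P dvd a2" "\<not> P dvd a3" and ne: "\<not> (a1 \<approx> a2 \<and> a2 \<approx> a3)"
  shows False
proof -
  have s: "{c1, c2, c3, c4} = {c1, c3, c2, c4}" "{c1, c2, c3, c4} = {c2, c3, c1, c4}" by auto
  have d: "distinct [c1, c3, c2, c4]" "distinct [c2, c3, c1, c4]" using dist by auto
  have "card (cls k c1) = 1 \<longleftrightarrow> card (cls k c2) \<noteq> 1"
    by (rule four_colors_pair[OF rf per p3 k dist nonempty coeffs ne])
  moreover have "card (cls k c1) = 1 \<longleftrightarrow> card (cls k c3) \<noteq> 1"
    by (rule four_colors_pair[OF rf per p3 k[unfolded s(1)] d(1) nonempty[unfolded s(1)] coeffs ne])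
  moreover have "card (cls k c2) = 1 \<longleftrightarrow> card (cls k c3) \<noteq> 1"
    by (rule four_colors_pair[OF rf per p3 k[unfolded s(2)] d(2) nonempty[unfolded s(2)] coeffs ne])
  ultimately show False by blast
qed

end

section \<open>Rainbow numbers\<close>

lemma card_three: "card {x, y, z :: nat} = 3 \<longleftrightarrow> x \<noteq> y \<and> y \<noteq> z \<and> x \<noteq> z"
  by (auto simp: card_insert_if)

context prime_modulus
begin

section \<open>Transfer to the residue ring and its unit group\<close>

lemma mod_eqm: "x mod P \<approx> x"
  by (simp add: eqm_def cong_def)

lemma carrier_Zmod: "carrier (Zmod p) = {0..<P}"
proof -
  interpret R: residues_prime p "Zmod p"
    by unfold_locales (use prime_p in simp_all)
  show ?thesis
    unfolding R.res_carrier_eq using atLeastLessThanPlusOne_atLeastAtMost_int[of 0 "P - 1"] by simp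
qed

text \<open>All six orders of the coefficients are applied to the same singleton s; u and v record
  that the colouring is not constant off s.\<close>

lemma three_coloring_structure:
  assumes rf: "rainbow_free a1 a2 a3 b k" and per: "periodic k" and p3: "p > 3"
    and k: "\<And>x. k x \<in> {i, j, l}" "i \<noteq> j" "i \<noteq> l" "j \<noteq> l"
    and nonempty: "cls k i \<noteq> {}" "cls k j \<noteq> {}" "cls k l \<noteq> {}"
    and coeffs: "\<not> P dvd a1" "\<not> P dvd a2" "\<not> P dvd a3" and ne: "\<not> (a1 \<approx> a2 \<and> a2 \<approx> a3)"
  obtains s u v where "s * (a1 + a2 + a3) \<approx> b" "\<not> u \<approx> s" "\<not> v \<approx> s" "k u \<noteq> k v"
    "\<And>x y e f. (e, f) \<in> {(a2, a3), (a3, a2), (a1, a3), (a3, a1), (a1, a2), (a2, a1)} \<Longrightarrow>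
      \<not> P dvd x \<Longrightarrow> e * x + f * y \<approx> 0 \<Longrightarrow> k (x + s) = k (y + s)"
proof -
  obtain xi xj xl where w: "k xi = i" "k xj = j" "k xl = l" using nonempty unfolding cls_def by blast
  have "\<exists>t u v. card (cls k t) = 1 \<and> k u \<noteq> t \<and> k v \<noteq> t \<and> k u \<noteq> k v"
    using three_colors_singleton[OF rf per p3 k nonempty coeffs ne] w k(2-4) by metis
  then obtain t u v where t: "card (cls k t) = 1" and uv: "k u \<noteq> t" "k v \<noteq> t" "k u \<noteq> k v" by blast
  obtain s where s: "cls k t = {s}" using t card_1_singletonE by blast
  note sc = singleton_class[OF _ per s]
  have ne': "\<not> (a2 \<approx> a1 \<and> a1 \<approx> a3)" "\<not> (a3 \<approx> a1 \<and> a1 \<approx> a2)" "\<not> (a1 \<approx> a3 \<and> a3 \<approx> a2)"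
    "\<not> (a2 \<approx> a3 \<and> a3 \<approx> a1)" "\<not> (a3 \<approx> a2 \<and> a2 \<approx> a1)"
    using ne eqm_sym eqm_trans by blast+
  note rp = rainbow_free_perm[OF rf]
  have inv: "k (x + s) = k (y + s)"
    if "(e, f) \<in> {(a2, a3), (a3, a2), (a1, a3), (a3, a1), (a1, a2), (a2, a1)}"
      "\<not> P dvd x" "e * x + f * y \<approx> 0" for x y e f
    using that sc(3)[OF rf coeffs ne uv, of x y] sc(3)[OF rp(2) coeffs(1,3,2) ne'(3) uv, of x y]
      sc(3)[OF rp(1) coeffs(2,1,3) ne'(1) uv, of x y] sc(3)[OF rp(3) coeffs(2,3,1) ne'(4) uv, of x y]
      sc(3)[OF rp(4) coeffs(3,1,2) ne'(2) uv, of x y] sc(3)[OF rp(5) coeffs(3,2,1) ne'(5) uv, of x y]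
    by auto
  show ?thesis
  proof (rule that)
    show "s * (a1 + a2 + a3) \<approx> b" by (rule sc(2)[OF rf coeffs ne uv])
    show "\<not> u \<approx> s" "\<not> v \<approx> s" using sc(1)[OF rf coeffs ne uv] uv by blast+
  qed (use uv inv in blast)+
qed

text \<open>Induction on the generation of g. For an inverse, the invariance under the generator h
  is used at the point h' x with h h' = 1.\<close>

lemma orbit_invariant:
  assumes per: "periodic k"
    and D: "D \<subseteq> Units (Zmod p)"
    and inv: "\<And>d x. d \<in> D \<Longrightarrow> \<not> P dvd x \<Longrightarrow> k (d * x + s) = k (x + s)"
    and g: "g \<in> generate (units_of (Zmod p)) D" and x: "\<not> P dvd x"
  shows "k (g * x + s) = k (x + s)"
proof -
  interpret R: residues_prime p "Zmod p"
    by unfold_locales (use prime_p in simp_all)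
  interpret U: group "units_of (Zmod p)" by (rule R.units_group)
  have unit: "\<not> P dvd h" if "h \<in> Units (Zmod p)" for h
    using that unfolding R.res_units_eq by (intro not_dvd_small) auto
  have modk: "k ((y mod P) * z + s) = k (y * z + s)" for y z
    by (rule periodic_eqm[OF per]) (intro eqm_add eqm_scalar_right mod_eqm eqm_refl)
  show ?thesis
    using g x
  proof (induction arbitrary: x rule: generate.induct)
    case one
    then show ?case by (simp add: units_of_one R.res_one_eq)
  next
    case (incl h)
    then show ?case using inv by blast
  next
    case (inv h)
    have h: "h \<in> Units (Zmod p)" using inv D by blast
    define h' where "h' = inv\<^bsub>units_of (Zmod p)\<^esub> h"
    have hc: "h \<in> carrier (units_of (Zmod p))" using h by (simp add: units_of_carrier)
    have h'c: "h' \<in> Units (Zmod p)" using U.inv_closed[OF hc] unfolding h'_def by (simp add: units_of_carrier)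
    have "h \<otimes>\<^bsub>Zmod p\<^esub> h' = \<one>\<^bsub>Zmod p\<^esub>"
      using U.r_inv[OF hc] unfolding h'_def by (simp add: units_of_mult units_of_one)
    then have hh: "h * h' \<approx> 1" unfolding R.res_mult_eq R.res_one_eq eqm_def cong_def
      using R.m_gt_one by simp
    have "\<not> P dvd h' * x" using unit[OF h'c] inv(2) unfolding dvd_mult_P by blast
    then have "k (h * (h' * x) + s) = k (h' * x + s)" using assms(3) inv(1) by blast
    moreover have "h * (h' * x) + s \<approx> 1 * x + s"
      unfolding mult.assoc[symmetric] by (intro eqm_add eqm_scalar_right hh eqm_refl)
    then have "k (h * (h' * x) + s) = k (x + s)" using periodic_eqm[OF per] by simp
    ultimately show ?case unfolding h'_def by simp
  next
    case (eng h1 h2)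
    have sub: "generate (units_of (Zmod p)) D \<subseteq> Units (Zmod p)"
      using U.generate_incl[of D] D by (simp add: units_of_carrier)
    have "h2 \<in> Units (Zmod p)" using sub eng.hyps(2) by (rule subsetD)
    from unit[OF this] have h2x: "\<not> P dvd h2 * x" using eng.prems unfolding dvd_mult_P by blast
    have "k (h1 * (h2 * x) + s) = k (h2 * x + s)" by (rule eng.IH(1)[OF h2x])
    also have "\<dots> = k (x + s)" by (rule eng.IH(2)[OF eng.prems])
    finally have "k (((h1 * h2) mod P) * x + s) = k (x + s)" unfolding modk mult.assoc .
    moreover have "h1 \<otimes>\<^bsub>units_of (Zmod p)\<^esub> h2 = (h1 * h2) mod P"
      unfolding units_of_mult by (rule R.res_mult_eq)
    ultimately show ?case by (simp only:)
  qed
qed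

lemma units_card: "Units (Zmod p) = {1..<P}" "card (Units (Zmod p)) = p - 1"
proof -
  interpret R: residues_prime p "Zmod p"
    by unfold_locales (use prime_p in simp_all)
  have "{1..P - 1} = {1..<P}" 
    using atLeastLessThanPlusOne_atLeastAtMost_int[of 1 "P - 1"] by simp
  moreover have "int (p - 1) = P - 1" using P_pos by linarith
  ultimately show *: "Units (Zmod p) = {1..<P}" unfolding R.res_prime_units_eq by (simp only:)
  show "card (Units (Zmod p)) = p - 1" unfolding * by simp
qed

lemma generate_mult_iff:
  assumes D: "D \<subseteq> Units (Zmod p)" and d: "d \<in> D" and x: "\<not> P dvd x"
  shows "(d * x) mod P \<in> generate (units_of (Zmod p)) D \<longleftrightarrow> x mod P \<in> generate (units_of (Zmod p)) D"
proof -
  interpret R: residues_prime p "Zmod p"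
    by unfold_locales (use prime_p in simp_all)
  interpret U: group "units_of (Zmod p)" by (rule R.units_group)
  let ?G = "generate (units_of (Zmod p)) D"
  have sub: "subgroup ?G (units_of (Zmod p))"
    using D by (intro U.generate_is_subgroup) (simp add: units_of_carrier)
  have dG: "d \<in> ?G" using d by (rule generate.incl)
  have xU: "x mod P \<in> carrier (units_of (Zmod p))"
  proof -
    have "x mod P \<noteq> 0" using x unfolding dvd_eq_mod_eq_0 .
    moreover have "0 \<le> x mod P" "x mod P < P" by (rule pos_mod_sign[OF P_pos], rule pos_mod_bound[OF P_pos])
    ultimately show ?thesis unfolding units_of_carrier units_card atLeastLessThan_iff by linarith
  qed
  have m: "d \<otimes>\<^bsub>units_of (Zmod p)\<^esub> (x mod P) = (d * x) mod P"
    unfolding units_of_mult R.res_mult_eq by (rule mod_mult_right_eq)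
  show ?thesis
  proof
    assume "x mod P \<in> ?G"
    then show "(d * x) mod P \<in> ?G" using subgroup.m_closed[OF sub dG] m by metis
  next
    assume "(d * x) mod P \<in> ?G"
    then have "inv\<^bsub>units_of (Zmod p)\<^esub> d \<otimes>\<^bsub>units_of (Zmod p)\<^esub> (d \<otimes>\<^bsub>units_of (Zmod p)\<^esub> (x mod P)) \<in> ?G"
      unfolding m using subgroup.m_closed[OF sub] subgroup.m_inv_closed[OF sub dG] by blast
    moreover have "d \<in> carrier (units_of (Zmod p))" using subgroup.mem_carrier[OF sub dG] .
    ultimately show "x mod P \<in> ?G" using xU by (simp add: U.m_assoc[symmetric])
  qed
qed

lemma lin_eq_iff:
  assumes "b \<in> carrier (Zmod p)"
  shows "(x, y, z) \<in> lin_eq p a1 a2 a3 b \<longleftrightarrow>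
    x \<in> {0..<P} \<and> y \<in> {0..<P} \<and> z \<in> {0..<P} \<and> a1 * x + a2 * y + a3 * z \<approx> b"
proof -
  interpret R: residues_prime p "Zmod p"
    by unfold_locales (use prime_p in simp_all)
  note carrier_Zmod
  moreover have "a1 \<otimes>\<^bsub>Zmod p\<^esub> x \<oplus>\<^bsub>Zmod p\<^esub> a2 \<otimes>\<^bsub>Zmod p\<^esub> y \<oplus>\<^bsub>Zmod p\<^esub> a3 \<otimes>\<^bsub>Zmod p\<^esub> z =
      (a1 * x + a2 * y + a3 * z) mod P"
    unfolding R.res_mult_eq R.res_add_eq mod_add_eq ..
  moreover have "b mod P = b" using assms calculation(1) by simp
  ultimately show ?thesis unfolding lin_eq_def eqm_def cong_def by (simp only: mem_Collect_eq case_prod_conv)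
qed

lemma coloring_rainbow_free:
  assumes b: "b \<in> carrier (Zmod p)" and c: "\<not> has_rainbow_solution (lin_eq p a1 a2 a3 b) c"
  shows "rainbow_free a1 a2 a3 b (\<lambda>x. c (x mod P))"
  unfolding rainbow_free_def
proof (intro allI impI)
  fix x y z assume "P dvd a1 * x + a2 * y + a3 * z - b"
  then have 1: "a1 * x + a2 * y + a3 * z \<approx> b" by (simp add: eqm_iff_dvd)
  have "a1 * (x mod P) + a2 * (y mod P) + a3 * (z mod P) \<approx> a1 * x + a2 * y + a3 * z"
    by (intro eqm_add eqm_scalar_left mod_eqm)
  then have "(x mod P, y mod P, z mod P) \<in> lin_eq p a1 a2 a3 b"
    unfolding lin_eq_iff[OF b] using P_pos eqm_trans[OF _ 1] by simp
  then have "card {c (x mod P), c (y mod P), c (z mod P)} \<noteq> 3"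
    using c unfolding has_rainbow_solution_def by blast
  then show "c (x mod P) = c (y mod P) \<or> c (y mod P) = c (z mod P) \<or> c (x mod P) = c (z mod P)"
    unfolding card_three by blast
qed

lemma coloring_cls:
  assumes "exact_coloring p r c"
  shows "periodic (\<lambda>x. c (x mod P))" "c (x mod P) \<in> {1..r}"
    "i \<in> {1..r} \<Longrightarrow> cls (\<lambda>x. c (x mod P)) i \<noteq> {}"
proof -
  have c: "c ` {0..<P} = {1..r}" using assms unfolding exact_coloring_def carrier_Zmod .
  show "periodic (\<lambda>x. c (x mod P))" by (simp add: periodic_def)
  have "x mod P \<in> {0..<P}" using P_pos by simp
  then have "c (x mod P) \<in> c ` {0..<P}" by (rule imageI)
  then show "c (x mod P) \<in> {1..r}" unfolding c .
  assume "i \<in> {1..r}"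
  then have "i \<in> c ` {0..<P}" unfolding c .
  then obtain y where "y \<in> {0..<P}" "c y = i" by blast
  then have "y \<in> cls (\<lambda>x. c (x mod P)) i" unfolding cls_def by simp
  then show "cls (\<lambda>x. c (x mod P)) i \<noteq> {}" by blast
qed

end

text \<open>The bound r <= n also excludes the first branch of \<open>rb\<close>:
  \<open>min (c x) r\<close> collapses an exact n-colouring to an exact r-colouring, and a rainbow
  solution of the latter is rainbow for c.\<close>

lemma rb_eqI:
  assumes r: "0 < r" "r \<le> n" and all: "\<And>c. exact_coloring n r c \<Longrightarrow> has_rainbow_solution S c"
    and less: "\<And>q. 0 < q \<Longrightarrow> q < r \<Longrightarrow> \<exists>c. exact_coloring n q c \<and> \<not> has_rainbow_solution S c"
  shows "rb n S = r"
proof -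
  have "has_rainbow_solution S c" if c: "exact_coloring n n c" for c
  proof -
    have "(\<lambda>x. min (c x) r) ` carrier (Zmod n) = (\<lambda>y. min y r) ` (c ` carrier (Zmod n))"
      unfolding image_image ..
    also have "\<dots> = (\<lambda>y. min y r) ` {1..n}" using c unfolding exact_coloring_def by (simp only:)
    also have "\<dots> = {1..r}"
    proof
      show "(\<lambda>y. min y r) ` {1..n} \<subseteq> {1..r}" using r by auto
      show "{1..r} \<subseteq> (\<lambda>y. min y r) ` {1..n}"
      proof
        fix y assume "y \<in> {1..r}"
        then have "y = min y r" "y \<in> {1..n}" using r by auto
        then show "y \<in> (\<lambda>y. min y r) ` {1..n}" by (rule image_eqI)
      qed
    qed
    finally have "exact_coloring n r (\<lambda>x. min (c x) r)" unfolding exact_coloring_def .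
    from all[OF this] obtain x y z where "(x, y, z) \<in> S" "card {min (c x) r, min (c y) r, min (c z) r} = 3"
      unfolding has_rainbow_solution_def by blast
    then have "card {c x, c y, c z} = 3" unfolding card_three by metis
    then show ?thesis using \<open>(x, y, z) \<in> S\<close> unfolding has_rainbow_solution_def by blast
  qed
  then have "rb n S = (LEAST r. 0 < r \<and> (\<forall>c. exact_coloring n r c \<longrightarrow> has_rainbow_solution S c))"
    unfolding rb_def by auto
  also have "\<dots> = r"
  proof (rule Least_equality)
    fix q assume "0 < q \<and> (\<forall>c. exact_coloring n q c \<longrightarrow> has_rainbow_solution S c)"
    then show "r \<le> q" using less not_le by blast
  qed (use r all in blast)
  finally show ?thesis .
qed

section \<open>The two values of the rainbow number\<close>

context prime_modulus
begin

text \<open>Each condition for the value 3 is refuted by such a colouring: multipliers generating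
  all units would leave a single colour off s, and s (a1 + a2 + a3) = b makes b vanish with the
  coefficient sum.\<close>

lemma upper_three:
  assumes c: "exact_coloring p 3 c" "\<not> has_rainbow_solution (lin_eq p a1 a2 a3 b) c"
    and b: "b \<in> carrier (Zmod p)" and p3: "p > 3"
    and coeffs: "\<not> P dvd a1" "\<not> P dvd a2" "\<not> P dvd a3" and ne: "\<not> (a1 \<approx> a2 \<and> a2 \<approx> a3)"
    and D: "D \<subseteq> Units (Zmod p)"
    and ratio: "\<And>d. d \<in> D \<Longrightarrow> \<exists>(e, f) \<in> {(a2, a3), (a3, a2), (a1, a3), (a3, a1), (a1, a2), (a2, a1)}. f * d \<approx> - e"
  shows "card (generate (units_of (Zmod p)) D) \<noteq> p - 1" "a1 + a2 + a3 \<approx> 0 \<Longrightarrow> b \<approx> 0"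
proof -
  interpret R: residues_prime p "Zmod p"
    by unfold_locales (use prime_p in simp_all)
  interpret U: group "units_of (Zmod p)" by (rule R.units_group)
  define k where "k = (\<lambda>x. c (x mod P))"
  have rf: "rainbow_free a1 a2 a3 b k" unfolding k_def by (rule coloring_rainbow_free[OF b c(2)])
  have per: "periodic k" unfolding k_def by (rule coloring_cls(1)[OF c(1)])
  have k: "k x \<in> {1, 2, 3}" for x
  proof -
    have "k x \<in> {1..3}" unfolding k_def by (rule coloring_cls(2)[OF c(1)])
    then show ?thesis by auto
  qed
  have ex: "cls k 1 \<noteq> {}" "cls k 2 \<noteq> {}" "cls k 3 \<noteq> {}"
    unfolding k_def by (rule coloring_cls(3)[OF c(1)]; simp)+
  obtain s u v where s: "s * (a1 + a2 + a3) \<approx> b" and uv: "\<not> u \<approx> s" "\<not> v \<approx> s" "k u \<noteq> k v"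
    and inv: "\<And>x y e f. (e, f) \<in> {(a2, a3), (a3, a2), (a1, a3), (a3, a1), (a1, a2), (a2, a1)} \<Longrightarrow>
      \<not> P dvd x \<Longrightarrow> e * x + f * y \<approx> 0 \<Longrightarrow> k (x + s) = k (y + s)"
    using three_coloring_structure[OF rf per p3 k _ _ _ ex coeffs ne] by auto
  show "b \<approx> 0" if "a1 + a2 + a3 \<approx> 0"
  proof -
    have "s * (a1 + a2 + a3) \<approx> s * 0" by (rule eqm_scalar_left[OF that])
    then show ?thesis using eqm_trans[OF eqm_sym[OF s]] by simp
  qed
  have invD: "k (d * x + s) = k (x + s)" if d: "d \<in> D" and x: "\<not> P dvd x" for d x
  proof -
    obtain e f where ef: "(e, f) \<in> {(a2, a3), (a3, a2), (a1, a3), (a3, a1), (a1, a2), (a2, a1)}" "f * d \<approx> - e"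
      using ratio[OF d] by blast
    have "e * x + f * (d * x) = e * x + (f * d) * x" by (simp only: mult.assoc)
    also have "\<dots> \<approx> e * x + (- e) * x" by (intro eqm_add eqm_scalar_right ef(2) eqm_refl)
    finally have "e * x + f * (d * x) \<approx> 0" by simp
    from inv[OF ef(1) x this] show ?thesis by simp
  qed
  show "card (generate (units_of (Zmod p)) D) \<noteq> p - 1"
  proof
    assume card: "card (generate (units_of (Zmod p)) D) = p - 1"
    have "D \<subseteq> carrier (units_of (Zmod p))" using D unfolding units_of_carrier .
    from U.generate_incl[OF this]
    have sub: "generate (units_of (Zmod p)) D \<subseteq> Units (Zmod p)" unfolding units_of_carrier .
    have "finite (Units (Zmod p))" unfolding units_card(1) by simp
    from card_subset_eq[OF this sub] have G: "generate (units_of (Zmod p)) D = Units (Zmod p)"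
      using card units_card(2) by (simp only:)
    have n1: "\<not> P dvd 1" using prime_P not_prime_unit by blast
    have "k w = k (1 + s)" if w: "\<not> w \<approx> s" for w
    proof -
      define g where "g = (w - s) mod P"
      have "g \<noteq> 0" using w unfolding g_def eqm_iff_dvd dvd_eq_mod_eq_0 .
      moreover have "0 \<le> g" "g < P" unfolding g_def by (rule pos_mod_sign[OF P_pos], rule pos_mod_bound[OF P_pos])
      ultimately have "g \<in> generate (units_of (Zmod p)) D"
        unfolding G units_card(1) atLeastLessThan_iff by linarith
      from orbit_invariant[OF per D invD this n1] have "k (g * 1 + s) = k (1 + s)" by simp
      moreover have "g * 1 + s \<approx> (w - s) + s" unfolding g_def by (intro eqm_add eqm_refl) (simp add: mod_eqm)
      ultimately show ?thesis using periodic_eqm[OF per] by simp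
    qed
    then show False using uv by metis
  qed
qed

text \<open>Subtracting s makes the equation homogeneous. A rainbow solution would contain the
  residue 0, the only one of colour 1, and then its other two entries differ by a factor in D, which
  preserves membership in the subgroup.\<close>

lemma lower_three:
  assumes b: "b \<in> carrier (Zmod p)" and s: "s * (a1 + a2 + a3) \<approx> b"
    and coeffs: "\<not> P dvd a1" "\<not> P dvd a2" "\<not> P dvd a3"
    and D: "D \<subseteq> Units (Zmod p)"
    and ratios: "d23 \<in> D" "a3 * d23 \<approx> - a2" "d13 \<in> D" "a3 * d13 \<approx> - a1" "d12 \<in> D" "a2 * d12 \<approx> - a1"
    and card: "card (generate (units_of (Zmod p)) D) \<noteq> p - 1"
  shows "\<exists>c. exact_coloring p 3 c \<and> \<not> has_rainbow_solution (lin_eq p a1 a2 a3 b) c"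
proof -
  interpret R: residues_prime p "Zmod p"
    by unfold_locales (use prime_p in simp_all)
  interpret U: group "units_of (Zmod p)" by (rule R.units_group)
  let ?G = "generate (units_of (Zmod p)) D"
  have "D \<subseteq> carrier (units_of (Zmod p))" using D unfolding units_of_carrier .
  from U.generate_incl[OF this] have sub: "?G \<subseteq> Units (Zmod p)" unfolding units_of_carrier .
  have "\<one>\<^bsub>units_of (Zmod p)\<^esub> = 1" unfolding units_of_one by (rule R.res_one_eq)
  then have one: "1 \<in> ?G" using generate.one[of "units_of (Zmod p)" D] by (simp only:)
  have "?G \<noteq> Units (Zmod p)" using card units_card(2) by metis
  then obtain w where w: "w \<in> Units (Zmod p)" "w \<notin> ?G" using sub by blast
  define \<gamma> where "\<gamma> y = (if P dvd y then 1 else if y mod P \<in> ?G then 2 else (3::nat))" for y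
  have gcong: "\<gamma> x = \<gamma> y" if "x \<approx> y" for x y
  proof -
    have m: "x mod P = y mod P" using that unfolding eqm_def cong_def .
    have "P dvd x \<longleftrightarrow> P dvd y" unfolding dvd_eq_mod_eq_0 m ..
    then show ?thesis unfolding \<gamma>_def m by (simp only:)
  qed
  have gmult: "\<gamma> (d * y) = \<gamma> y" if d: "d \<in> D" for d y
  proof (cases "P dvd y")
    case True
    then show ?thesis unfolding \<gamma>_def by (simp only: dvd_mult if_True)
  next
    case False
    have "d \<in> {1..<P}" using D d units_card(1) by blast
    then have "\<not> P dvd d" by (intro not_dvd_small) (simp_all only: atLeastLessThan_iff, linarith+)
    then have "\<not> P dvd d * y" using False unfolding dvd_mult_P by blast
    then show ?thesis using generate_mult_iff[OF D d False] False unfolding \<gamma>_def by (simp only: if_False)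
  qed
  have gratio: "\<gamma> x = \<gamma> y"
    if d: "d \<in> D" "f * d \<approx> - e" and f: "\<not> P dvd f" and xy: "e * x + f * y \<approx> 0" for d e f x y
  proof -
    have "f * (d * x) = (f * d) * x" by (simp only: mult.assoc)
    also have "\<dots> \<approx> (- e) * x" by (rule eqm_scalar_right[OF d(2)])
    also have "- e * x = 0 - e * x" by simp
    also have "\<dots> \<approx> (e * x + f * y) - e * x" by (intro eqm_diff eqm_sym[OF xy] eqm_refl)
    also have "\<dots> = f * y" by simp
    finally have "d * x \<approx> y" using eqm_mult_cancel[OF f] by blast
    from gcong[OF this] show ?thesis using gmult[OF d(1), of x] by simp
  qed
  define c where "c x = \<gamma> (x - s)" for x
  have c: "c ((y + s) mod P) = \<gamma> y" for y
  proof -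
    have "(y + s) mod P - s \<approx> (y + s) - s" by (intro eqm_diff mod_eqm eqm_refl)
    from gcong[OF this] show ?thesis unfolding c_def by simp
  qed
  have ran: "\<gamma> y = 1 \<or> \<gamma> y = 2 \<or> \<gamma> y = 3" for y unfolding \<gamma>_def by simp
  have gval: "\<gamma> 0 = 1" "\<gamma> 1 = 2" "\<gamma> w = 3"
  proof -
    have "2 \<le> P" using prime_ge_2_nat[OF prime_p] by linarith
    then have "\<not> P dvd 1" "1 mod P = 1" by (intro not_dvd_small, simp_all)
    moreover have "0 < w" "w < P" using w(1) unfolding units_card(1) atLeastLessThan_iff by linarith+
    moreover from this have "\<not> P dvd w" "w mod P = w" by (rule not_dvd_small, simp)
    ultimately show "\<gamma> 0 = 1" "\<gamma> 1 = 2" "\<gamma> w = 3" using one w(2) unfolding \<gamma>_def by simp_all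
  qed
  have "c ` carrier (Zmod p) = {1..3}"
  proof
    show "c ` carrier (Zmod p) \<subseteq> {1..3}"
    proof
      fix t assume "t \<in> c ` carrier (Zmod p)"
      then obtain x where "t = \<gamma> (x - s)" unfolding c_def by blast
      then show "t \<in> {1..3}" using ran[of "x - s"] by auto
    qed
    show "{1..3} \<subseteq> c ` carrier (Zmod p)"
    proof
      fix t :: nat assume "t \<in> {1..3}"
      then have "t = 1 \<or> t = 2 \<or> t = 3" by auto
      then obtain y where "t = \<gamma> y" using gval by metis
      then have "t = c ((y + s) mod P)" using c by simp
      moreover have "(y + s) mod P \<in> carrier (Zmod p)" unfolding carrier_Zmod using P_pos by simp
      ultimately show "t \<in> c ` carrier (Zmod p)" by (rule image_eqI)
    qed
  qed
  moreover have "\<not> has_rainbow_solution (lin_eq p a1 a2 a3 b) c"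
  proof
    assume "has_rainbow_solution (lin_eq p a1 a2 a3 b) c"
    then obtain x y z where xyz: "(x, y, z) \<in> lin_eq p a1 a2 a3 b" "card {c x, c y, c z} = 3"
      unfolding has_rainbow_solution_def by blast
    define X Y Z where "X = x - s" and "Y = y - s" and "Z = z - s"
    have dist: "\<gamma> X \<noteq> \<gamma> Y" "\<gamma> Y \<noteq> \<gamma> Z" "\<gamma> X \<noteq> \<gamma> Z"
      using xyz(2) unfolding card_three c_def X_def Y_def Z_def by blast+
    have "a1 * x + a2 * y + a3 * z \<approx> b" using xyz(1) unfolding lin_eq_iff[OF b] by blast
    from eqm_diff[OF this s]
    have sum: "a1 * X + a2 * Y + a3 * Z \<approx> 0"
      unfolding X_def Y_def Z_def by (simp add: algebra_simps)
    have dvd1: "P dvd v" if "\<gamma> v = 1" for v using that unfolding \<gamma>_def by (simp split: if_splits)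
    consider "\<gamma> X = 1" | "\<gamma> Y = 1" | "\<gamma> Z = 1" using dist ran[of X] ran[of Y] ran[of Z] by metis
    then show False
    proof cases
      case 1
      have "a1 * X \<approx> 0" using dvd1[OF 1] by (simp add: eqm_0)
      from eqm_diff[OF sum this] have "a2 * Y + a3 * Z \<approx> 0" by simp
      from gratio[OF ratios(1,2) coeffs(3) this] show ?thesis using dist by blast
    next
      case 2
      have "a2 * Y \<approx> 0" using dvd1[OF 2] by (simp add: eqm_0)
      from eqm_diff[OF sum this] have "a1 * X + a3 * Z \<approx> 0" by (simp add: algebra_simps)
      from gratio[OF ratios(3,4) coeffs(3) this] show ?thesis using dist by blast
    next
      case 3
      have "a3 * Z \<approx> 0" using dvd1[OF 3] by (simp add: eqm_0)
      from eqm_diff[OF sum this] have "a1 * X + a2 * Y \<approx> 0" by simp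
      from gratio[OF ratios(5,6) coeffs(2) this] show ?thesis using dist by blast
    qed
  qed
  ultimately show ?thesis unfolding exact_coloring_def by blast
qed

lemma two_colors:
  assumes "q = 1 \<or> q = 2"
  shows "\<exists>c. exact_coloring p q c \<and> \<not> has_rainbow_solution S c"
proof -
  define c :: "int \<Rightarrow> nat" where "c x = (if x = 0 then 1 else q)" for x
  have "c ` {0..<P} = {1..q}"
  proof
    show "c ` {0..<P} \<subseteq> {1..q}" using assms unfolding c_def by auto
    have "2 \<le> P" using prime_ge_2_nat[OF prime_p] by linarith
    then have "0 \<in> {0..<P}" "1 \<in> {0..<P}" by simp_all
    then have "c 0 \<in> c ` {0..<P}" "c 1 \<in> c ` {0..<P}" by (blast intro: imageI)+
    moreover have "c 0 = 1" "c 1 = q" unfolding c_def by simp_all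
    moreover have "{1..q} \<subseteq> {1, q}" using assms by auto
    ultimately show "{1..q} \<subseteq> c ` {0..<P}" by auto
  qed
  then have "exact_coloring p q c" unfolding exact_coloring_def carrier_Zmod .
  moreover have "\<not> has_rainbow_solution S c"
    unfolding has_rainbow_solution_def card_three c_def by auto
  ultimately show ?thesis by blast
qed

lemma quotient_unit:
  assumes e: "e \<in> Units (Zmod p)" and f: "f \<in> Units (Zmod p)"
  shows "\<ominus>\<^bsub>Zmod p\<^esub> e \<otimes>\<^bsub>Zmod p\<^esub> inv\<^bsub>Zmod p\<^esub> f \<in> Units (Zmod p)"
    "f * (\<ominus>\<^bsub>Zmod p\<^esub> e \<otimes>\<^bsub>Zmod p\<^esub> inv\<^bsub>Zmod p\<^esub> f) \<approx> - e"
proof -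
  interpret R: residues_prime p "Zmod p"
    by unfold_locales (use prime_p in simp_all)
  let ?d = "\<ominus>\<^bsub>Zmod p\<^esub> e \<otimes>\<^bsub>Zmod p\<^esub> inv\<^bsub>Zmod p\<^esub> f"
  define g where "g = inv\<^bsub>Zmod p\<^esub> f"
  have d: "?d = (((- e) mod P) * g) mod P"
    unfolding R.res_neg_eq R.res_mult_eq g_def ..
  have "f \<otimes>\<^bsub>Zmod p\<^esub> g = \<one>\<^bsub>Zmod p\<^esub>" unfolding g_def by (rule R.Units_r_inv[OF f])
  then have fg: "f * g \<approx> 1"
    unfolding R.res_mult_eq R.res_one_eq using eqm_sym[OF mod_eqm[of "f * g"]] by simp
  have "f * ?d \<approx> f * ((- e) * g)"
    unfolding d by (intro eqm_scalar_left eqm_trans[OF mod_eqm] eqm_scalar_right mod_eqm)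
  also have "f * ((- e) * g) = (- e) * (f * g)" by simp
  also have "\<dots> \<approx> (- e) * 1" by (rule eqm_scalar_left[OF fg])
  finally show *: "f * ?d \<approx> - e" by simp
  have "\<not> P dvd ?d"
  proof
    assume "P dvd ?d"
    then have "f * ?d \<approx> 0" unfolding eqm_0 by (rule dvd_mult)
    then have "- e \<approx> 0" using eqm_trans[OF eqm_sym[OF *]] by blast
    then have "P dvd e" by (simp add: eqm_0)
    moreover have "0 < e" "e < P" using e unfolding units_card(1) atLeastLessThan_iff by linarith+
    ultimately show False using not_dvd_small by blast
  qed
  then have "?d \<noteq> 0" by (metis dvd_0_right)
  moreover have "0 \<le> ?d" "?d < P" unfolding d by (rule pos_mod_sign[OF P_pos], rule pos_mod_bound[OF P_pos])
  ultimately show "?d \<in> Units (Zmod p)" unfolding units_card(1) atLeastLessThan_iff by linarith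
qed

end

theorem theorem2p3:
  fixes p :: nat and a1 a2 a3 b d1 d2 d3 d4 d5 d6 :: int and R (structure)
  defines "R \<equiv> Zmod p"
  assumes "prime p" and "p \<ge> 5"
    and "a1 \<in> carrier R" and "a2 \<in> carrier R" and "a3 \<in> carrier R" and "b \<in> carrier R"
    and "a1 \<noteq> a2 \<or> a1 \<noteq> a3 \<or> a2 \<noteq> a3"
    and "a1 \<otimes> a2 \<otimes> a3 \<in> Units R"
    and "d1 = \<ominus> a3 \<otimes> inv a1" and "d2 = \<ominus> a2 \<otimes> inv a1" and "d3 = \<ominus> a1 \<otimes> inv a2"
    and "d4 = \<ominus> a3 \<otimes> inv a2" and "d5 = \<ominus> a1 \<otimes> inv a3" and "d6 = \<ominus> a2 \<otimes> inv a3"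
  shows "rb p (lin_eq p a1 a2 a3 b) =
    (if card (generate (units_of R) {d1, d2, d3, d4, d5, d6}) = p - 1
        \<or> a1 \<oplus> a2 \<oplus> a3 = \<zero> \<and> \<zero> \<noteq> b
     then 3 else 4)"
proof -
  interpret prime_modulus p by (rule prime_modulus.intro) (rule assms(2))
  interpret R: residues_prime p "Zmod p"
    by unfold_locales (use prime_p in simp_all)
  have p3: "p > 3" using assms(3) by linarith
  have car: "a1 \<in> {0..<P}" "a2 \<in> {0..<P}" "a3 \<in> {0..<P}" "b \<in> {0..<P}"
    using assms(4-7) unfolding R_def carrier_Zmod .
  have bc: "b \<in> carrier (Zmod p)" using assms(7) unfolding R_def .
  have prod: "a1 \<otimes>\<^bsub>Zmod p\<^esub> a2 \<otimes>\<^bsub>Zmod p\<^esub> a3 = (a1 * a2 * a3) mod P"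
    unfolding R.res_mult_eq mod_mult_left_eq ..
  have "(a1 * a2 * a3) mod P \<noteq> 0"
    using assms(9) unfolding R_def prod units_card(1) atLeastLessThan_iff by linarith
  then have "\<not> P dvd a1 * a2 * a3" unfolding dvd_eq_mod_eq_0 .
  then have coeffs: "\<not> P dvd a1" "\<not> P dvd a2" "\<not> P dvd a3" unfolding dvd_mult_P by blast+
  have unit: "a \<in> Units (Zmod p)" if "a \<in> {0..<P}" "\<not> P dvd a" for a
  proof -
    have "a \<noteq> 0" using that(2) by (metis dvd_0_right)
    then show ?thesis using that(1) unfolding units_card(1) atLeastLessThan_iff by linarith
  qed
  have u: "a1 \<in> Units (Zmod p)" "a2 \<in> Units (Zmod p)" "a3 \<in> Units (Zmod p)"
    using unit car coeffs by blast+
  have inj: "x = y" if "x \<approx> y" "x \<in> {0..<P}" "y \<in> {0..<P}" for x y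
    using that unfolding eqm_def cong_def by simp
  have ne: "\<not> (a1 \<approx> a2 \<and> a2 \<approx> a3)" using assms(8) inj car by blast
  let ?D = "{d1, d2, d3, d4, d5, d6}"
  note dd = assms(10-15)[unfolded R_def]
  have D: "?D \<subseteq> Units (Zmod p)" unfolding dd using quotient_unit(1) u by blast
  have q: "a1 * d1 \<approx> - a3" "a1 * d2 \<approx> - a2" "a2 * d3 \<approx> - a1" "a2 * d4 \<approx> - a3" "a3 * d5 \<approx> - a1" "a3 * d6 \<approx> - a2"
    unfolding dd by (rule quotient_unit(2)[OF u(3) u(1)] quotient_unit(2)[OF u(2) u(1)] quotient_unit(2)[OF u(1) u(2)]
      quotient_unit(2)[OF u(3) u(2)] quotient_unit(2)[OF u(1) u(3)] quotient_unit(2)[OF u(2) u(3)])+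
  have ratio: "\<exists>(e, f) \<in> {(a2, a3), (a3, a2), (a1, a3), (a3, a1), (a1, a2), (a2, a1)}. f * d \<approx> - e"
    if "d \<in> ?D" for d
    using that q by blast
  have sum0: "a1 \<oplus>\<^bsub>Zmod p\<^esub> a2 \<oplus>\<^bsub>Zmod p\<^esub> a3 = \<zero>\<^bsub>Zmod p\<^esub> \<longleftrightarrow> a1 + a2 + a3 \<approx> 0"
    unfolding R.res_add_eq R.res_zero_eq mod_add_left_eq eqm_0 dvd_eq_mod_eq_0 ..
  have b0: "\<zero>\<^bsub>Zmod p\<^esub> = b \<longleftrightarrow> b \<approx> 0"
    unfolding R.res_zero_eq using inj[of b 0] car(4) P_pos by auto
  let ?S = "lin_eq p a1 a2 a3 b"
  let ?C = "card (generate (units_of (Zmod p)) ?D) = p - 1 \<or> a1 + a2 + a3 \<approx> 0 \<and> \<not> b \<approx> 0"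
  have "rb p ?S = (if ?C then 3 else 4)"
  proof (cases ?C)
    case True
    have "rb p ?S = 3"
    proof (rule rb_eqI)
      fix c assume c: "exact_coloring p 3 c"
      show "has_rainbow_solution ?S c"
      proof (rule ccontr)
        assume n: "\<not> has_rainbow_solution ?S c"
        from upper_three[OF c n bc p3 coeffs ne D ratio] show False using True by blast
      qed
    next
      fix q :: nat assume "0 < q" "q < 3"
      then have "q = 1 \<or> q = 2" by linarith
      then show "\<exists>c. exact_coloring p q c \<and> \<not> has_rainbow_solution ?S c" by (rule two_colors)
    qed (use p3 in linarith)+
    then show ?thesis using True by simp
  next
    case False
    \<comment> \<open>Solvability of this congruence is precisely the failure of the second
      alternative.\<close>
    have "\<exists>s. s * (a1 + a2 + a3) \<approx> b"
    proof (cases "a1 + a2 + a3 \<approx> 0")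
      case True
      then have "b \<approx> 0" using False by blast
      then have "0 * (a1 + a2 + a3) \<approx> b" using eqm_sym by simp
      then show ?thesis by blast
    next
      case nz: False
      then obtain e where e: "(a1 + a2 + a3) * e \<approx> 1" using ex_inverse unfolding eqm_0 by blast
      have "(e * b) * (a1 + a2 + a3) = ((a1 + a2 + a3) * e) * b" by (simp only: mult_ac)
      also have "\<dots> \<approx> 1 * b" by (rule eqm_scalar_right[OF e])
      finally show ?thesis by auto
    qed
    then obtain s where s: "s * (a1 + a2 + a3) \<approx> b" by blast
    have "rb p ?S = 4"
    proof (rule rb_eqI)
      fix c assume c: "exact_coloring p 4 c"
      show "has_rainbow_solution ?S c"
      proof (rule ccontr)
        assume n: "\<not> has_rainbow_solution ?S c"
        define k where "k = (\<lambda>x. c (x mod P))"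
        have rf: "rainbow_free a1 a2 a3 b k" unfolding k_def by (rule coloring_rainbow_free[OF bc n])
        have per: "periodic k" unfolding k_def by (rule coloring_cls(1)[OF c])
        have 4: "{1..4} = {1, 2, 3, 4::nat}" by auto
        have k: "k x \<in> {1, 2, 3, 4}" for x
          unfolding k_def 4[symmetric] by (rule coloring_cls(2)[OF c])
        have ex: "cls k i \<noteq> {}" if "i \<in> {1, 2, 3, 4}" for i
          using that unfolding k_def 4[symmetric] by (rule coloring_cls(3)[OF c])
        show False by (rule no_four_coloring[OF rf per p3 k _ ex coeffs ne]) simp
      qed
    next
      fix q :: nat assume "0 < q" "q < 4"
      then consider "q = 1 \<or> q = 2" | "q = 3" by linarith
      then show "\<exists>c. exact_coloring p q c \<and> \<not> has_rainbow_solution ?S c"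
      proof cases
        case 1
        then show ?thesis by (rule two_colors)
      next
        case 2
        have "card (generate (units_of (Zmod p)) ?D) \<noteq> p - 1" using False by blast
        from lower_three[OF bc s coeffs D _ q(6) _ q(5) _ q(3) this] show ?thesis unfolding 2 by simp
      qed
    qed (use assms(3) in linarith)+
    then show ?thesis using False by simp
  qed
  then show ?thesis unfolding R_def sum0 b0 .
qed

end
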